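(* Let $n\ge 2$ and let $\chi$ be a regular dominant root-lattice character lying in the deep chamber $\mathcal C^\lambda_{\mathrm{deep}}$. Then $$(\mathrm{Pet}_n)^{ss}_{G_0}(\mathcal L(\chi))=(\mathrm{Pet}_n)^{s}_{G_0}(\mathcal L(\chi)),$$ and there is an isomorphism of varieties $$(\mathrm{Pet}_n)^{ss}_{G_0}(\mathcal L(\chi))/\!/G_0\;\cong\;\mathbb P(1,2,\ldots,n-1),$$ the weighted projective space with weights $1,2,\ldots,n-1$.
   Context: Let $G=\mathrm{GL}(n,\mathbb C)$, $B\subset G$ the upper triangular matrices, $T$ the diagonal torus, $\epsilon_i$ the $i$-th coordinate character of $T$, and $S=\{\alpha_1,\ldots,\alpha_{n-1}\}$, $\alpha_i=\epsilon_i-\epsilon_{i+1}$, the simple roots. The Weyl group $W=S_n$ acts on characters by $w(\epsilon_i)=\epsilon_{w(i)}$. For $I\subseteq S$ let $W_I\subseteq W$ be generated by the simple reflections in $I$ and let $w_I$ be its longest element. Peterson variety: $N=\sum_{i=1}^{n-1}E_{i,i+1}$ and $\mathrm{Pet}_n=\{gB\in G/B : (g^{-1}Ng)_{ij}=0 \text{ for } i>j+1\}$, i.e. the closed subvariety of full flags $(V_i)$ in $\mathbb C^n$ with $NV_i\subseteq V_{i+1}$ for $1\le i\le n-1$. Torus action: $\lambda:\mathbb G_m\to T$, $\lambda(t)=\mathrm{diag}(t,t^2,\ldots,t^n)$; $G_0=\lambda(\mathbb G_m)$ acts on $\mathrm{Pet}_n$ by left multiplication. The pairing is $\langle\sum_i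 x_i\epsilon_i,\lambda\rangle=\sum_i i\,x_i$. Characters: $Q=\mathbb ZS$ is the root lattice, $Q_{\mathbb R}=Q\otimes\mathbb R=\{\sum x_i\epsilon_i:\sum x_i=0\}$. An element $\sum x_i\epsilon_i$ is regular dominant if $x_1>\cdots>x_n$; $\mathcal D\subset Q_{\mathbb R}$ is the set of regular dominant elements. A regular dominant root-lattice character is an element of $Q\cap\mathcal D$. Deep chamber: with $K_r=S\setminus\{\alpha_r\}$, $\mathcal C^\lambda_{\mathrm{deep}}=\{\chi\in\mathcal D:\langle w_{K_r}(\chi),\lambda\rangle<0\text{ for }1\le r\le n-1\}$. Linearization: $\mathcal L(\chi)=G\times^B\mathbb C_{-\chi}$ on $G/B$ (so $H^0(G/B,\mathcal L(\chi))\simeq V(\chi)^*$ for dominant $\chi$, and $\mathcal L(\chi)$ is ample for regular dominant $\chi$), restricted to $\mathrm{Pet}_n$, with the $G_0$-linearization obtained by restricting the natural $G$-linearization. A point is semistable if some $G_0$-invariant section of a positive power of $\mathcal L(\chi)$ does not vanish at it; stable if it is semistable, its $G_0$-orbit is closed in the semistable locus and its stabilizer in $G_0$ is finite. The loci are $(\mathrm{Pet}_n)^{ss}_{G_0}(\mathcal L(\chi))$, $(\mathrm{Pet}_n)^{s}_{G_0}(\mathcal L(\chi))$, and $/\!/G_0$ denotes the GIT (good) quotient. *)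

theory Defs
  imports
    "HOL-Analysis.Abstract_Topology"
    "HOL-Combinatorics.Transposition"
    "Jordan_Normal_Form.Matrix"
begin

section \<open>Complex varieties as spaces with functions\<close>

text \<open>
  A (reduced) complex variety is represented by its set of closed points with the Zariski topology
  and, for every open set \<open>U\<close>, the set of regular functions on \<open>U\<close>.  Only the values on \<open>U\<close> of a
  function in \<open>reg X U\<close> are meaningful, and \<open>reg X U\<close> is meaningful only for \<open>U\<close> open.
\<close>

record 'a fspace =
  zar :: "'a topology"
  reg :: "'a set \<Rightarrow> ('a \<Rightarrow> complex) set"

abbreviation points :: "('a, 'm) fspace_scheme \<Rightarrow> 'a set"
  where "points X \<equiv> topspace (zar X)"

definition morphism :: "'a fspace \<Rightarrow> 'b fspace \<Rightarrow> ('a \<Rightarrow> 'b) \<Rightarrow> bool"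
  where "morphism X Y f \<longleftrightarrow>
    continuous_map (zar X) (zar Y) f \<and>
    (\<forall>V h. openin (zar Y) V \<and> h \<in> reg Y V \<longrightarrow> h \<circ> f \<in> reg X {x \<in> points X. f x \<in> V})"

definition isomorphic :: "'a fspace \<Rightarrow> 'b fspace \<Rightarrow> bool"
  where "isomorphic X Y \<longleftrightarrow>
    (\<exists>f g. morphism X Y f \<and> morphism Y X g \<and>
       (\<forall>x \<in> points X. g (f x) = x) \<and> (\<forall>y \<in> points Y. f (g y) = y))"

inductive_set polynomial_functions :: "('a \<Rightarrow> complex) set \<Rightarrow> ('a \<Rightarrow> complex) set"
  for F :: "('a \<Rightarrow> complex) set" where
  const: "(\<lambda>_. c) \<in> polynomial_functions F"
| coord: "f \<in> F \<Longrightarrow> f \<in> polynomial_functions F"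
| add: "p \<in> polynomial_functions F \<Longrightarrow> q \<in> polynomial_functions F \<Longrightarrow>
    (\<lambda>x. p x + q x) \<in> polynomial_functions F"
| mult: "p \<in> polynomial_functions F \<Longrightarrow> q \<in> polynomial_functions F \<Longrightarrow>
    (\<lambda>x. p x * q x) \<in> polynomial_functions F"

text \<open>
  A subset \<open>A\<close> of an affine space whose coordinate functions are \<open>F\<close>, with the induced Zariski
  topology; regular functions are locally quotients of polynomials.  It is used for sets that are
  locally closed in the affine space.
\<close>

definition coordinate_space :: "'a set \<Rightarrow> ('a \<Rightarrow> complex) set \<Rightarrow> 'a fspace"
  where "coordinate_space A F =
    (let T = topology_generated_by {{x \<in> A. p x \<noteq> 0} | p. p \<in> polynomial_functions F}
     in \<lparr>zar = T,
         reg = (\<lambda>U. {f. \<forall>x\<in>U. \<exists>V p q. openin T V \<and> x \<in> V \<and> V \<subseteq> U \<and>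
                   p \<in> polynomial_functions F \<and> q \<in> polynomial_functions F \<and>
                   (\<forall>y\<in>V. q y \<noteq> 0 \<and> f y = p y / q y)})\<rparr>)"

lemma points_coordinate_space: "points (coordinate_space A F) = A"
proof -
  have "A \<in> {{x \<in> A. p x \<noteq> 0} | p. p \<in> polynomial_functions F}"
    by (rule CollectI, rule exI[of _ "\<lambda>_. 1"]) (simp add: polynomial_functions.const)
  then show ?thesis
    by (auto simp: coordinate_space_def Let_def)
qed

text \<open>
  The structure induced on a locally closed subset \<open>Z\<close> (open subvariety, or closed subvariety with
  its reduced structure): regular functions are locally restrictions of regular functions on \<open>X\<close>.
\<close>

definition induced_on :: "'a fspace \<Rightarrow> 'a set \<Rightarrow> 'a fspace"
  where "induced_on X Z =
    \<lparr>zar = subtopology (zar X) Z,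
     reg = (\<lambda>U. {f. \<forall>x\<in>U. \<exists>V g. openin (zar X) V \<and> x \<in> V \<and> g \<in> reg X V \<and>
               (\<forall>y \<in> V \<inter> U. f y = g y)})\<rparr>"

definition identification_topology :: "'a topology \<Rightarrow> ('a \<Rightarrow> 'b) \<Rightarrow> 'b topology"
  where "identification_topology T q =
    topology (\<lambda>V. V \<subseteq> q ` topspace T \<and> openin T {x \<in> topspace T. q x \<in> V})"

lemma openin_identification_topology:
  "openin (identification_topology T q) V \<longleftrightarrow>
     V \<subseteq> q ` topspace T \<and> openin T {x \<in> topspace T. q x \<in> V}"
proof -
  have "istopology (\<lambda>V. V \<subseteq> q ` topspace T \<and> openin T {x \<in> topspace T. q x \<in> V})"
    unfolding istopology_def
  proof (intro conjI allI impI)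
    fix S S'
    assume "S \<subseteq> q ` topspace T \<and> openin T {x \<in> topspace T. q x \<in> S}"
      and "S' \<subseteq> q ` topspace T \<and> openin T {x \<in> topspace T. q x \<in> S'}"
    moreover have "{x \<in> topspace T. q x \<in> S \<inter> S'} =
      {x \<in> topspace T. q x \<in> S} \<inter> {x \<in> topspace T. q x \<in> S'}"
      by auto
    ultimately show "S \<inter> S' \<subseteq> q ` topspace T" "openin T {x \<in> topspace T. q x \<in> S \<inter> S'}"
      by auto
  next
    fix \<K>
    assume *: "\<forall>K\<in>\<K>. K \<subseteq> q ` topspace T \<and> openin T {x \<in> topspace T. q x \<in> K}"
    then show "\<Union> \<K> \<subseteq> q ` topspace T"
      by blast
    have "{x \<in> topspace T. q x \<in> \<Union> \<K>} = (\<Union>K\<in>\<K>. {x \<in> topspace T. q x \<in> K})"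
      by auto
    with * show "openin T {x \<in> topspace T. q x \<in> \<Union> \<K>}"
      by auto
  qed
  then show ?thesis
    by (simp add: identification_topology_def)
qed

text \<open>The quotient of \<open>X\<close> by the equivalence relation \<open>q x = q y\<close>, on the set \<open>q ` points X\<close>.\<close>

definition quotient_space :: "'a fspace \<Rightarrow> ('a \<Rightarrow> 'b) \<Rightarrow> 'b fspace"
  where "quotient_space X q =
    \<lparr>zar = identification_topology (zar X) q,
     reg = (\<lambda>U. {f. f \<circ> q \<in> reg X {x \<in> points X. q x \<in> U}})\<rparr>"

definition affine_space :: "nat \<Rightarrow> complex vec fspace"
  where "affine_space m = coordinate_space (carrier_vec m) {\<lambda>v. vec_index v i | i. i < m}"

definition affine_variety :: "'a fspace \<Rightarrow> bool"
  where "affine_variety X \<longleftrightarrow>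
    (\<exists>m Z. closedin (zar (affine_space m)) Z \<and> isomorphic X (induced_on (affine_space m) Z))"

definition weighted_projective_space :: "nat list \<Rightarrow> complex vec set fspace"
  where "weighted_projective_space ws =
    (let m = length ws
     in quotient_space (induced_on (affine_space m) (carrier_vec m - {0\<^sub>v m}))
          (\<lambda>v. {vec m (\<lambda>i. t ^ (ws ! i) * vec_index v i) | t. t \<noteq> 0}))"


section \<open>Quotients by group actions\<close>

definition group_orbit :: "'g set \<Rightarrow> ('g \<Rightarrow> 'a \<Rightarrow> 'a) \<Rightarrow> 'a \<Rightarrow> 'a set"
  where "group_orbit G act x = (\<lambda>g. act g x) ` G"

definition group_stabilizer :: "'g set \<Rightarrow> ('g \<Rightarrow> 'a \<Rightarrow> 'a) \<Rightarrow> 'a \<Rightarrow> 'g set"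
  where "group_stabilizer G act x = {g \<in> G. act g x = x}"

definition invariant_set :: "'g set \<Rightarrow> ('g \<Rightarrow> 'a \<Rightarrow> 'a) \<Rightarrow> 'a set \<Rightarrow> bool"
  where "invariant_set G act Z \<longleftrightarrow> (\<forall>g\<in>G. \<forall>z\<in>Z. act g z \<in> Z)"

text \<open>
  Good quotient in the sense of Seshadri.  The last condition says that \<open>\<pi>\<close> is an affine morphism.
\<close>

definition good_quotient ::
    "'g set \<Rightarrow> ('g \<Rightarrow> 'a \<Rightarrow> 'a) \<Rightarrow> 'a fspace \<Rightarrow> 'b fspace \<Rightarrow> ('a \<Rightarrow> 'b) \<Rightarrow> bool"
  where "good_quotient G act X Y \<pi> \<longleftrightarrow>
    morphism X Y \<pi> \<and> \<pi> ` points X = points Y \<and>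
    (\<forall>g\<in>G. \<forall>x \<in> points X. \<pi> (act g x) = \<pi> x) \<and>
    (\<forall>U h. openin (zar Y) U \<and> h \<in> reg X {x \<in> points X. \<pi> x \<in> U} \<and>
       (\<forall>g\<in>G. \<forall>x \<in> points X. \<pi> x \<in> U \<longrightarrow> h (act g x) = h x) \<longrightarrow>
       (\<exists>f \<in> reg Y U. \<forall>x \<in> points X. \<pi> x \<in> U \<longrightarrow> h x = f (\<pi> x))) \<and>
    (\<forall>Z. closedin (zar X) Z \<and> invariant_set G act Z \<longrightarrow> closedin (zar Y) (\<pi> ` Z)) \<and>
    (\<forall>Z Z'. closedin (zar X) Z \<and> invariant_set G act Z \<and>
       closedin (zar X) Z' \<and> invariant_set G act Z' \<and> Z \<inter> Z' = {} \<longrightarrow> \<pi> ` Z \<inter> \<pi> ` Z' = {}) \<and>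
    (\<exists>\<V>. \<Union> \<V> = points Y \<and>
       (\<forall>V\<in>\<V>. openin (zar Y) V \<and> affine_variety (induced_on Y V) \<and>
          affine_variety (induced_on X {x \<in> points X. \<pi> x \<in> V})))"

text \<open>
  If a good quotient of \<open>X\<close> exists, it identifies two points exactly when the closures of their orbits
  meet, carries the quotient topology, and its regular functions are the invariant ones.  So it is
  (up to unique isomorphism) the space \<open>git_quotient\<close>, with quotient map \<open>s_class\<close>.
\<close>

definition s_class :: "'g set \<Rightarrow> ('g \<Rightarrow> 'a \<Rightarrow> 'a) \<Rightarrow> 'a fspace \<Rightarrow> 'a \<Rightarrow> 'a set"
  where "s_class G act X x =
    {y \<in> points X. (zar X closure_of group_orbit G act x) \<inter> (zar X closure_of group_orbit G act y) \<noteq> {}}"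

definition git_quotient :: "'g set \<Rightarrow> ('g \<Rightarrow> 'a \<Rightarrow> 'a) \<Rightarrow> 'a fspace \<Rightarrow> 'a set fspace"
  where "git_quotient G act X = quotient_space X (s_class G act X)"


section \<open>Characters and the deep chamber\<close>

text \<open>
  The character \<open>\<Sum>i. x i * \<epsilon>\<^sub>i\<close> is the function \<open>x\<close>, which vanishes outside \<open>{1..n}\<close>; a set of simple
  roots is the set of their indices, a subset of \<open>{1..<n}\<close>; an element of the Weyl group is a
  permutation of \<open>nat\<close> that fixes everything outside \<open>{1..n}\<close>.
\<close>

definition simple_root :: "nat \<Rightarrow> nat \<Rightarrow> int"
  where "simple_root r = (\<lambda>i. if i = r then 1 else if i = Suc r then - 1 else 0)"

definition root_lattice :: "nat \<Rightarrow> (nat \<Rightarrow> int) set"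
  where "root_lattice n = {\<lambda>i. \<Sum>r\<in>{1..<n}. c r * simple_root r i | c. True}"

definition regular_dominant :: "nat \<Rightarrow> (nat \<Rightarrow> real) set"
  where "regular_dominant n =
    {x. (\<forall>i. i \<notin> {1..n} \<longrightarrow> x i = 0) \<and> (\<Sum>i=1..n. x i) = 0 \<and> (\<forall>i\<in>{1..<n}. x i > x (Suc i))}"

definition reflection_word :: "nat list \<Rightarrow> nat \<Rightarrow> nat"
  where "reflection_word is = foldr (\<lambda>i w. Transposition.transpose i (Suc i) \<circ> w) is id"

definition parabolic_subgroup :: "nat set \<Rightarrow> (nat \<Rightarrow> nat) set"
  where "parabolic_subgroup I = {reflection_word is | is. set is \<subseteq> I}"

definition weyl_length :: "nat \<Rightarrow> (nat \<Rightarrow> nat) \<Rightarrow> nat"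
  where "weyl_length n w =
    (LEAST k. \<exists>is. set is \<subseteq> {1..<n} \<and> length is = k \<and> reflection_word is = w)"

definition longest_element :: "nat \<Rightarrow> nat set \<Rightarrow> nat \<Rightarrow> nat"
  where "longest_element n I =
    (THE w. w \<in> parabolic_subgroup I \<and>
       (\<forall>v \<in> parabolic_subgroup I. weyl_length n v \<le> weyl_length n w))"

text \<open>Since \<open>w(\<epsilon>\<^sub>i) = \<epsilon>\<^bsub>w(i)\<^esub>\<close>, the coefficient of \<open>\<epsilon>\<^sub>j\<close> in \<open>w(x)\<close> is the one of \<open>\<epsilon>\<^bsub>w\<^sup>-\<^sup>1(j)\<^esub>\<close> in \<open>x\<close>.\<close>

definition weyl_act :: "(nat \<Rightarrow> nat) \<Rightarrow> (nat \<Rightarrow> real) \<Rightarrow> nat \<Rightarrow> real"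
  where "weyl_act w x = (\<lambda>j. x (inv_into UNIV w j))"

definition lambda_pairing :: "nat \<Rightarrow> (nat \<Rightarrow> real) \<Rightarrow> real"
  where "lambda_pairing n x = (\<Sum>i=1..n. real i * x i)"

definition deep_chamber :: "nat \<Rightarrow> (nat \<Rightarrow> real) set"
  where "deep_chamber n =
    {x \<in> regular_dominant n.
       \<forall>r\<in>{1..<n}. lambda_pairing n (weyl_act (longest_element n ({1..<n} - {r})) x) < 0}"


section \<open>The flag variety, the Peterson variety and the torus\<close>

text \<open>Matrix indices start at 0, so \<open>\<epsilon>\<^sub>i\<close> reads off the entry \<open>(i - 1, i - 1)\<close>.\<close>

definition GL :: "nat \<Rightarrow> complex mat set"
  where "GL n = {g \<in> carrier_mat n n. invertible_mat g}"

definition Borel :: "nat \<Rightarrow> complex mat set"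
  where "Borel n = {b \<in> GL n. upper_triangular b}"

definition GL_space :: "nat \<Rightarrow> complex mat fspace"
  where "GL_space n = coordinate_space (GL n) {\<lambda>g. g $$ (i, j) | i j. i < n \<and> j < n}"

definition flag_point :: "nat \<Rightarrow> complex mat \<Rightarrow> complex mat set"
  where "flag_point n g = {g * b | b. b \<in> Borel n}"

definition flag_variety :: "nat \<Rightarrow> complex mat set fspace"
  where "flag_variety n = quotient_space (GL_space n) (flag_point n)"

definition nilp :: "nat \<Rightarrow> complex mat"
  where "nilp n = mat n n (\<lambda>(i, j). if j = Suc i then 1 else 0)"

definition Pet :: "nat \<Rightarrow> complex mat set set"
  where "Pet n = {flag_point n g | g h. g \<in> GL n \<and> h \<in> carrier_mat n n \<and>
    inverts_mat g h \<and> inverts_mat h g \<and>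
    (\<forall>i<n. \<forall>j<n. i > j + 1 \<longrightarrow> (h * nilp n * g) $$ (i, j) = 0)}"

definition Peterson_variety :: "nat \<Rightarrow> complex mat set fspace"
  where "Peterson_variety n = induced_on (flag_variety n) (Pet n)"

definition lam :: "nat \<Rightarrow> complex \<Rightarrow> complex mat"
  where "lam n t = mat n n (\<lambda>(i, j). if i = j then t ^ Suc i else 0)"

definition G0 :: "nat \<Rightarrow> complex mat set"
  where "G0 n = {lam n t | t. t \<noteq> 0}"

definition flag_act :: "complex mat \<Rightarrow> complex mat set \<Rightarrow> complex mat set"
  where "flag_act h x = (\<lambda>g. h * g) ` x"


section \<open>Linearization and (semi)stability\<close>

definition char_value :: "nat \<Rightarrow> (nat \<Rightarrow> int) \<Rightarrow> complex mat \<Rightarrow> complex"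
  where "char_value n x b = (\<Prod>i=1..n. (b $$ (i - 1, i - 1)) powi x i)"

text \<open>
  \<open>G \<times>\<^sup>B \<complex>\<^sub>x\<close> is the quotient of \<open>G \<times> \<complex>\<close> by the right \<open>B\<close>-action \<open>(g, v) b = (g b, x(b)\<^sup>-\<^sup>1 v)\<close>.  A point
  of it is an orbit of this action, and the first components of its elements form the coset \<open>g B\<close>
  over which it lies.
\<close>

definition bundle_class :: "nat \<Rightarrow> (nat \<Rightarrow> int) \<Rightarrow> complex mat \<times> complex \<Rightarrow> (complex mat \<times> complex) set"
  where "bundle_class n x = (\<lambda>(g, v). {(g * b, inverse (char_value n x b) * v) | b. b \<in> Borel n})"

definition assoc_bundle :: "nat \<Rightarrow> (nat \<Rightarrow> int) \<Rightarrow> (complex mat \<times> complex) set fspace"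
  where "assoc_bundle n x =
    quotient_space
      (coordinate_space (GL n \<times> UNIV)
        (insert (\<lambda>(g, v). v) {\<lambda>(g, v). g $$ (i, j) | i j. i < n \<and> j < n}))
      (bundle_class n x)"

definition bundle_proj :: "(complex mat \<times> complex) set \<Rightarrow> complex mat set"
  where "bundle_proj e = fst ` e"

definition bundle_act ::
    "complex mat \<Rightarrow> (complex mat \<times> complex) set \<Rightarrow> (complex mat \<times> complex) set"
  where "bundle_act h e = (\<lambda>(g, v). (h * g, v)) ` e"

definition zero_vector :: "complex mat set \<Rightarrow> (complex mat \<times> complex) set"
  where "zero_vector x = x \<times> {0}"

definition line_bundle :: "nat \<Rightarrow> (nat \<Rightarrow> int) \<Rightarrow> (complex mat \<times> complex) set fspace"
  where "line_bundle n \<chi> = assoc_bundle n (\<lambda>i. - \<chi> i)"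

definition Pet_section ::
    "nat \<Rightarrow> (nat \<Rightarrow> int) \<Rightarrow> (complex mat set \<Rightarrow> (complex mat \<times> complex) set) \<Rightarrow> bool"
  where "Pet_section n \<chi> s \<longleftrightarrow>
    morphism (Peterson_variety n) (line_bundle n \<chi>) s \<and> (\<forall>x \<in> Pet n. bundle_proj (s x) = x)"

definition G0_invariant_section ::
    "nat \<Rightarrow> (complex mat set \<Rightarrow> (complex mat \<times> complex) set) \<Rightarrow> bool"
  where "G0_invariant_section n s \<longleftrightarrow>
    (\<forall>h \<in> G0 n. \<forall>x \<in> Pet n. s (flag_act h x) = bundle_act h (s x))"

text \<open>The \<open>k\<close>-th tensor power of the linearized bundle of \<open>\<chi>\<close> is the linearized bundle of \<open>k \<chi>\<close>.\<close>

definition Pet_ss :: "nat \<Rightarrow> (nat \<Rightarrow> int) \<Rightarrow> complex mat set set"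
  where "Pet_ss n \<chi> =
    {x \<in> Pet n. \<exists>k\<ge>1. \<exists>s. Pet_section n (\<lambda>i. int k * \<chi> i) s \<and> G0_invariant_section n s \<and>
       s x \<noteq> zero_vector x}"

definition Pet_ss_space :: "nat \<Rightarrow> (nat \<Rightarrow> int) \<Rightarrow> complex mat set fspace"
  where "Pet_ss_space n \<chi> = induced_on (Peterson_variety n) (Pet_ss n \<chi>)"

definition Pet_s :: "nat \<Rightarrow> (nat \<Rightarrow> int) \<Rightarrow> complex mat set set"
  where "Pet_s n \<chi> =
    {x \<in> Pet_ss n \<chi>. closedin (zar (Pet_ss_space n \<chi>)) (group_orbit (G0 n) flag_act x) \<and>
       finite (group_stabilizer (G0 n) flag_act x)}"

end

theory Submission
  imports Defs
    "HOL-Combinatorics.Permutations"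
    "HOL-Computational_Algebra.Polynomial"
    "Jordan_Normal_Form.Determinant"
begin

text \<open>
  The Peterson variety meets the open Bruhat cell in the orbit of \<open>w\<^sub>0 B\<close> under the unipotent
  centralizer of \<open>nilp n\<close>.  This orbit is an affine space \<open>\<complex>\<^bsup>n - 1\<^esup>\<close> on which \<open>\<lambda>(t)\<close> acts with weights
  \<open>-1, ..., -(n - 1)\<close>, the origin being \<open>w\<^sub>0 B\<close>.  In the deep chamber \<open>w\<^sub>0 B\<close> is the only fixed point
  of positive weight.  Hence the semistable locus is the cell without its origin: a point outside the
  cell flows, as \<open>t\<close> tends to infinity, to a fixed point of negative weight, so that every invariant
  section vanishes there, and for a point of the cell other than the origin a product of minors that
  is nonzero at the limit \<open>t = 0\<close> combines with the minors defining the cell to an invariant section.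
  Both limits are coordinate flags given by pivot positions \<open>w\<close>.  The Hessenberg condition forces
  \<open>w\<close> to begin with a block reversal \<open>r, r - 1, ..., 1\<close>, and among these the largest pairing with
  \<open>\<lambda>\<close> is the one in the definition of the deep chamber.

  It remains to see that the quotient of a punctured affine space by a positively weighted action
  of \<open>\<complex>\<^sup>*\<close> is a good quotient.  On the chart where the coordinate \<open>i\<close> does not vanish finitely many
  Laurent monomials of weight zero generate the invariants, and a point satisfying all relations
  among them is a character of the monoid of these monomials, which extends to all monomials
  because \<open>\<complex>\<^sup>*\<close> is divisible.
\<close>

section \<open>Spaces with functions\<close>

text \<open>The record \<open>fspace\<close> carries no axioms, so whatever the argument needs of a
  structure sheaf is collected in \<open>function_space\<close> and proved for the coordinate,
  induced and quotient structures, from which every space here is built. Three further points carry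
  the proof. Both limits of the torus flow are read off from one normal form, \<open>pivots\<close>,
  with the row order \<open>\<sigma>\<close> as parameter; comparing leading rows in
  \<open>N g = g H\<close> with \<open>H\<close> Hessenberg shows that the value
  \<open>w l - 1\<close> is taken at a position at most \<open>l + 1\<close>, and this is what
  forces the initial block. An extremal section, a product of Pluecker coordinates, has torus weight
  equal to the pairing, so two of them with weights of opposite sign have an invariant product of
  powers. On the quotient side the slice \<open>v $ i = 1\<close> still carries an action of the
  roots of unity of order \<open>ws ! i\<close>; instead of dividing by this finite group, variables
  are corrected by powers of one monomial whose weight generates the weights modulo
  \<open>ws ! i\<close>, and the remaining ambiguity is the choice of one complex root.\<close>

locale function_space =
  fixes X :: "'a fspace"
  assumes reg_local: "openin (zar X) U \<Longrightarrow>
      (\<And>x. x \<in> U \<Longrightarrow> \<exists>V g. openin (zar X) V \<and> x \<in> V \<and> g \<in> reg X V \<and> (\<forall>y\<in>V \<inter> U. f y = g y)) \<Longrightarrow>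
      f \<in> reg X U"
    and reg_const: "openin (zar X) U \<Longrightarrow> (\<lambda>_. c) \<in> reg X U"
    and reg_add: "openin (zar X) U \<Longrightarrow> f \<in> reg X U \<Longrightarrow> g \<in> reg X U \<Longrightarrow> (\<lambda>x. f x + g x) \<in> reg X U"
    and reg_mult: "openin (zar X) U \<Longrightarrow> f \<in> reg X U \<Longrightarrow> g \<in> reg X U \<Longrightarrow> (\<lambda>x. f x * g x) \<in> reg X U"
    and reg_inverse: "openin (zar X) U \<Longrightarrow> f \<in> reg X U \<Longrightarrow> (\<forall>x\<in>U. f x \<noteq> 0) \<Longrightarrow>
      (\<lambda>x. inverse (f x)) \<in> reg X U"
    and open_nonzero: "openin (zar X) U \<Longrightarrow> f \<in> reg X U \<Longrightarrow> openin (zar X) {x \<in> U. f x \<noteq> 0}"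
begin

text \<open>Gluing from the single function \<open>f\<close> gives restriction; since only values on
  the open set are compared, the same step permits changing a function off \<open>V\<close>.\<close>

lemma reg_restrict:
  assumes "openin (zar X) U" "openin (zar X) V" "V \<subseteq> U" "f \<in> reg X U" "\<And>x. x \<in> V \<Longrightarrow> g x = f x"
  shows "g \<in> reg X V"
  using assms by (intro reg_local) blast+

lemma reg_cong: "openin (zar X) U \<Longrightarrow> f \<in> reg X U \<Longrightarrow> (\<And>x. x \<in> U \<Longrightarrow> g x = f x) \<Longrightarrow> g \<in> reg X U"
  by (rule reg_restrict[of U U f g]) auto

lemma reg_divide:
  "openin (zar X) U \<Longrightarrow> f \<in> reg X U \<Longrightarrow> g \<in> reg X U \<Longrightarrow> (\<forall>x\<in>U. g x \<noteq> 0) \<Longrightarrow>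
    (\<lambda>x. f x / g x) \<in> reg X U"
  unfolding divide_inverse by (intro reg_mult reg_inverse)

lemma reg_prod:
  assumes "openin (zar X) U" "\<And>i. i \<in> I \<Longrightarrow> f i \<in> reg X U"
  shows "(\<lambda>x. \<Prod>i\<in>I. f i x) \<in> reg X U"
  using assms(2)
  by (induction I rule: infinite_finite_induct) (simp_all add: reg_const reg_mult assms(1))

lemma reg_power: "openin (zar X) U \<Longrightarrow> f \<in> reg X U \<Longrightarrow> (\<lambda>x. f x ^ k) \<in> reg X U"
  by (induction k) (simp_all add: reg_const reg_mult)

lemma reg_power_int:
  assumes "openin (zar X) U" "f \<in> reg X U" "k \<ge> 0 \<or> (\<forall>x\<in>U. f x \<noteq> 0)"
  shows "(\<lambda>x. f x powi k) \<in> reg X U"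
proof (cases "k \<ge> 0")
  case True
  then show ?thesis using reg_power[OF assms(1,2), of "nat k"]
    by (simp add: power_int_def)
next
  case False
  then have "(\<lambda>x. inverse (f x) ^ nat (- k)) \<in> reg X U"
    using assms by (intro reg_power reg_inverse) auto
  then show ?thesis using False by (simp add: power_int_def)
qed

end

section \<open>Polynomial functions and coordinate spaces\<close>

lemma polynomial_functions_power:
  "p \<in> polynomial_functions F \<Longrightarrow> (\<lambda>x. p x ^ k) \<in> polynomial_functions F"
  by (induction k) (auto simp: polynomial_functions.const polynomial_functions.mult)

lemma polynomial_functions_sum:
  "(\<And>i. i \<in> I \<Longrightarrow> p i \<in> polynomial_functions F) \<Longrightarrow> (\<lambda>x. \<Sum>i\<in>I. p i x) \<in> polynomial_functions F"
  by (induction I rule: infinite_finite_induct)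
    (auto simp: polynomial_functions.const polynomial_functions.add polynomial_functions.mult)

lemma polynomial_functions_prod:
  "(\<And>i. i \<in> I \<Longrightarrow> p i \<in> polynomial_functions F) \<Longrightarrow> (\<lambda>x. \<Prod>i\<in>I. p i x) \<in> polynomial_functions F"
  by (induction I rule: infinite_finite_induct)
    (auto simp: polynomial_functions.const polynomial_functions.add polynomial_functions.mult)

lemma polynomial_functions_diff:
  assumes "p \<in> polynomial_functions F" "q \<in> polynomial_functions F"
  shows "(\<lambda>x. p x - q x) \<in> polynomial_functions F"
proof -
  have "(\<lambda>x. p x + (- 1) * q x) \<in> polynomial_functions F"
    by (intro polynomial_functions.add polynomial_functions.mult polynomial_functions.const assms)
  then show ?thesis by simp
qed

text \<open>The sets \<open>p x \<noteq> 0\<close> are only a subbasis by definition; a product of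
  polynomials realizes the intersection of two of them, so they form a basis.\<close>

lemma openin_coordinate_space:
  "openin (zar (coordinate_space A F)) U \<longleftrightarrow>
    U \<subseteq> A \<and> (\<forall>x\<in>U. \<exists>p\<in>polynomial_functions F. p x \<noteq> 0 \<and> (\<forall>y\<in>A. p y \<noteq> 0 \<longrightarrow> y \<in> U))"
    (is "?L \<longleftrightarrow> ?R U")
proof
  assume ?L
  then have "generate_topology_on {{x \<in> A. p x \<noteq> 0} | p. p \<in> polynomial_functions F} U"
    by (simp add: coordinate_space_def Let_def openin_topology_generated_by_iff)
  then show "?R U"
  proof induction
    case (Int a b)
    show ?case
    proof (intro conjI ballI)
      show "a \<inter> b \<subseteq> A" using Int by auto
      fix x assume "x \<in> a \<inter> b"
      with Int obtain p q where
        "p \<in> polynomial_functions F" "p x \<noteq> 0" "\<forall>y\<in>A. p y \<noteq> 0 \<longrightarrow> y \<in> a"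
        "q \<in> polynomial_functions F" "q x \<noteq> 0" "\<forall>y\<in>A. q y \<noteq> 0 \<longrightarrow> y \<in> b"
        by blast
      then show "\<exists>p\<in>polynomial_functions F. p x \<noteq> 0 \<and> (\<forall>y\<in>A. p y \<noteq> 0 \<longrightarrow> y \<in> a \<inter> b)"
        by (intro bexI[of _ "\<lambda>x. p x * q x"]) (auto simp: polynomial_functions.add polynomial_functions.mult)
    qed
  next
    case (UN K)
    show ?case
    proof (intro conjI ballI)
      show "\<Union> K \<subseteq> A" using UN.IH by blast
      fix x assume "x \<in> \<Union> K"
      then obtain k where k: "k \<in> K" "x \<in> k" by blast
      with UN.IH[OF k(1)] obtain p where "p \<in> polynomial_functions F" "p x \<noteq> 0"
        "\<forall>y\<in>A. p y \<noteq> 0 \<longrightarrow> y \<in> k" by blast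
      then show "\<exists>p\<in>polynomial_functions F. p x \<noteq> 0 \<and> (\<forall>y\<in>A. p y \<noteq> 0 \<longrightarrow> y \<in> \<Union> K)"
        using k(1) by (intro bexI[of _ p]) auto
    qed
  qed auto
next
  assume R: "?R U"
  let ?B = "{{x \<in> A. p x \<noteq> 0} | p. p \<in> polynomial_functions F}"
  have "U = \<Union> {B \<in> ?B. B \<subseteq> U}"
  proof
    show "U \<subseteq> \<Union> {B \<in> ?B. B \<subseteq> U}"
    proof
      fix x assume x: "x \<in> U"
      with R obtain p where "p \<in> polynomial_functions F" "p x \<noteq> 0" "\<forall>y\<in>A. p y \<noteq> 0 \<longrightarrow> y \<in> U"
        by blast
      then have "{x \<in> A. p x \<noteq> 0} \<in> {B \<in> ?B. B \<subseteq> U}" "x \<in> {x \<in> A. p x \<noteq> 0}" using R x by auto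
      then show "x \<in> \<Union> {B \<in> ?B. B \<subseteq> U}" by blast
    qed
  qed auto
  moreover have "openin (topology_generated_by ?B) (\<Union> {B \<in> ?B. B \<subseteq> U})"
    by (rule openin_Union) (auto intro: topology_generated_by_Basis)
  ultimately show ?L by (simp add: coordinate_space_def Let_def)
qed

text \<open>The neighbourhood in the definition may be taken basic, \<open>r y \<noteq> 0\<close>,
  so that regularity becomes a statement about three polynomials.\<close>

lemma reg_coordinate_space:
  "f \<in> reg (coordinate_space A F) U \<longleftrightarrow>
    (\<forall>x\<in>U. x \<in> A \<and> (\<exists>r\<in>polynomial_functions F. \<exists>p\<in>polynomial_functions F. \<exists>q\<in>polynomial_functions F.
      r x \<noteq> 0 \<and> (\<forall>y\<in>A. r y \<noteq> 0 \<longrightarrow> y \<in> U \<and> q y \<noteq> 0 \<and> f y = p y / q y)))"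
    (is "?L \<longleftrightarrow> ?R")
proof
  have eq: "?L \<longleftrightarrow> (\<forall>x\<in>U. \<exists>V p q. openin (zar (coordinate_space A F)) V \<and> x \<in> V \<and> V \<subseteq> U \<and>
                   p \<in> polynomial_functions F \<and> q \<in> polynomial_functions F \<and>
                   (\<forall>y\<in>V. q y \<noteq> 0 \<and> f y = p y / q y))"
    by (simp add: coordinate_space_def Let_def)
  show ?R if ?L
  proof
    fix x assume "x \<in> U"
    with \<open>?L\<close>[unfolded eq] obtain V p q where "openin (zar (coordinate_space A F)) V" "x \<in> V" "V \<subseteq> U"
                   "p \<in> polynomial_functions F" "q \<in> polynomial_functions F"
                   "\<forall>y\<in>V. q y \<noteq> 0 \<and> f y = p y / q y" by metis
    moreover from this obtain r where "x \<in> A" "r \<in> polynomial_functions F" "r x \<noteq> 0" "\<forall>y\<in>A. r y \<noteq> 0 \<longrightarrow> y \<in> V"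
      unfolding openin_coordinate_space by blast
    ultimately show "x \<in> A \<and> (\<exists>r\<in>polynomial_functions F. \<exists>p\<in>polynomial_functions F. \<exists>q\<in>polynomial_functions F.
      r x \<noteq> 0 \<and> (\<forall>y\<in>A. r y \<noteq> 0 \<longrightarrow> y \<in> U \<and> q y \<noteq> 0 \<and> f y = p y / q y))"
      by (intro conjI bexI[of _ r] bexI[of _ p] bexI[of _ q]) auto
  qed
  show ?L if ?R
    unfolding eq
  proof
    fix x assume "x \<in> U"
    from bspec[OF \<open>?R\<close> this] obtain r p q where r: "x \<in> A" "r \<in> polynomial_functions F"
        "p \<in> polynomial_functions F" "q \<in> polynomial_functions F" "r x \<noteq> 0"
        "\<forall>y\<in>A. r y \<noteq> 0 \<longrightarrow> y \<in> U \<and> q y \<noteq> 0 \<and> f y = p y / q y"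
      by (elim bexE conjE) (rule that)
    then have "openin (zar (coordinate_space A F)) {y \<in> A. r y \<noteq> 0}"
      unfolding openin_coordinate_space by blast
    with r show "\<exists>V p q. openin (zar (coordinate_space A F)) V \<and> x \<in> V \<and> V \<subseteq> U \<and>
                   p \<in> polynomial_functions F \<and> q \<in> polynomial_functions F \<and>
                   (\<forall>y\<in>V. q y \<noteq> 0 \<and> f y = p y / q y)"
      by (intro exI[of _ "{y \<in> A. r y \<noteq> 0}"] exI[of _ p] exI[of _ q]) auto
  qed
qed

lemma reg_coordinate_spaceE:
  assumes "f \<in> reg (coordinate_space A F) U" "x \<in> U"
  obtains r p q where "r \<in> polynomial_functions F" "p \<in> polynomial_functions F" "q \<in> polynomial_functions F"
      "x \<in> A" "r x \<noteq> 0" "\<And>y. y \<in> A \<Longrightarrow> r y \<noteq> 0 \<Longrightarrow> y \<in> U \<and> q y \<noteq> 0 \<and> f y = p y / q y"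
proof -
  have "x \<in> A \<and> (\<exists>r\<in>polynomial_functions F. \<exists>p\<in>polynomial_functions F. \<exists>q\<in>polynomial_functions F.
      r x \<noteq> 0 \<and> (\<forall>y\<in>A. r y \<noteq> 0 \<longrightarrow> y \<in> U \<and> q y \<noteq> 0 \<and> f y = p y / q y))"
    using assms unfolding reg_coordinate_space by (rule bspec)
  then show thesis
    by (elim conjE bexE) (rule that, assumption+, simp)
qed

text \<open>The fraction is only required on \<open>U\<close>; multiplying \<open>r\<close> by a
  polynomial whose nonvanishing forces membership in \<open>U\<close> confines the neighbourhood to
  \<open>U\<close>.\<close>

lemma reg_coordinate_spaceI:
  assumes "openin (zar (coordinate_space A F)) U"
    and "\<And>x. x \<in> U \<Longrightarrow> \<exists>r\<in>polynomial_functions F. \<exists>p\<in>polynomial_functions F. \<exists>q\<in>polynomial_functions F.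
      r x \<noteq> 0 \<and> (\<forall>y\<in>U. r y \<noteq> 0 \<longrightarrow> q y \<noteq> 0 \<and> f y = p y / q y)"
  shows "f \<in> reg (coordinate_space A F) U"
  unfolding reg_coordinate_space
proof
  fix x assume x: "x \<in> U"
  with assms(1) obtain s where s: "x \<in> A" "s \<in> polynomial_functions F" "s x \<noteq> 0" "\<forall>y\<in>A. s y \<noteq> 0 \<longrightarrow> y \<in> U"
    unfolding openin_coordinate_space by blast
  from assms(2)[OF x] obtain r p q where r: "r \<in> polynomial_functions F" "p \<in> polynomial_functions F"
      "q \<in> polynomial_functions F" "r x \<noteq> 0" "\<forall>y\<in>U. r y \<noteq> 0 \<longrightarrow> q y \<noteq> 0 \<and> f y = p y / q y"
    by blast
  show "x \<in> A \<and> (\<exists>r\<in>polynomial_functions F. \<exists>p\<in>polynomial_functions F. \<exists>q\<in>polynomial_functions F.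
      r x \<noteq> 0 \<and> (\<forall>y\<in>A. r y \<noteq> 0 \<longrightarrow> y \<in> U \<and> q y \<noteq> 0 \<and> f y = p y / q y))"
    using s r by (intro conjI bexI[of _ "\<lambda>y. r y * s y"] bexI[of _ p] bexI[of _ q])
      (auto simp: polynomial_functions.add polynomial_functions.mult)
qed

lemma polynomial_functions_reg:
  assumes "openin (zar (coordinate_space A F)) U" "p \<in> polynomial_functions F"
  shows "p \<in> reg (coordinate_space A F) U"
proof (rule reg_coordinate_spaceI[OF assms(1)])
  fix x
  show "\<exists>r\<in>polynomial_functions F. \<exists>p'\<in>polynomial_functions F. \<exists>q\<in>polynomial_functions F.
      r x \<noteq> 0 \<and> (\<forall>y\<in>U. r y \<noteq> 0 \<longrightarrow> q y \<noteq> 0 \<and> p y = p' y / q y)"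
    using assms(2) by (intro bexI[of _ "\<lambda>_. 1"] bexI[of _ p]) (auto simp: polynomial_functions.const)
qed

lemma function_space_coordinate_space: "function_space (coordinate_space A F)"
proof
  let ?P = "polynomial_functions F" and ?X = "coordinate_space A F"
  fix U f g
  assume U: "openin (zar ?X) U"
  {
    assume "\<And>x. x \<in> U \<Longrightarrow> \<exists>V g. openin (zar ?X) V \<and> x \<in> V \<and> g \<in> reg ?X V \<and> (\<forall>y\<in>V \<inter> U. f y = g y)"
    then show "f \<in> reg ?X U"
    proof (intro reg_coordinate_spaceI[OF U])
      fix x assume x: "x \<in> U"
      assume "\<And>x. x \<in> U \<Longrightarrow> \<exists>V g. openin (zar ?X) V \<and> x \<in> V \<and> g \<in> reg ?X V \<and> (\<forall>y\<in>V \<inter> U. f y = g y)"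
      from this[OF x] obtain V g where V: "x \<in> V" "g \<in> reg ?X V" "\<forall>y\<in>V \<inter> U. f y = g y" by blast
      from V(2,1) obtain r p q where *: "r \<in> ?P" "p \<in> ?P" "q \<in> ?P" "r x \<noteq> 0"
        "\<And>y. y \<in> A \<Longrightarrow> r y \<noteq> 0 \<Longrightarrow> y \<in> V \<and> q y \<noteq> 0 \<and> g y = p y / q y"
        by (rule reg_coordinate_spaceE) blast
      have "U \<subseteq> A" using U unfolding openin_coordinate_space by blast
      then have "\<forall>y\<in>U. r y \<noteq> 0 \<longrightarrow> q y \<noteq> 0 \<and> f y = p y / q y" using *(5) V(3) by auto
      then show "\<exists>r\<in>?P. \<exists>p\<in>?P. \<exists>q\<in>?P. r x \<noteq> 0 \<and> (\<forall>y\<in>U. r y \<noteq> 0 \<longrightarrow> q y \<noteq> 0 \<and> f y = p y / q y)"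
        using * by blast
    qed
  }
  show "(\<lambda>_. c) \<in> reg ?X U" for c
    by (intro polynomial_functions_reg U polynomial_functions.const)
  assume f: "f \<in> reg ?X U"
  {
    assume g: "g \<in> reg ?X U"
    \<comment> \<open>The product of the polynomials \<open>r\<close> and \<open>r'\<close> defines
      one basic open set on which both functions are fractions, so that sums and products can be
      computed there.\<close>
    have *: "\<exists>r\<in>?P. \<exists>p\<in>?P. \<exists>q\<in>?P. \<exists>p'\<in>?P. \<exists>q'\<in>?P. r x \<noteq> 0 \<and>
      (\<forall>y\<in>U. r y \<noteq> 0 \<longrightarrow> q y \<noteq> 0 \<and> q' y \<noteq> 0 \<and> f y = p y / q y \<and> g y = p' y / q' y)" if x: "x \<in> U" for x
    proof -
      from f x obtain r p q where 1: "r \<in> ?P" "p \<in> ?P" "q \<in> ?P" "r x \<noteq> 0"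
        "\<And>y. y \<in> A \<Longrightarrow> r y \<noteq> 0 \<Longrightarrow> y \<in> U \<and> q y \<noteq> 0 \<and> f y = p y / q y"
        by (rule reg_coordinate_spaceE) blast
      from g x obtain r' p' q' where 2: "r' \<in> ?P" "p' \<in> ?P" "q' \<in> ?P" "r' x \<noteq> 0"
        "\<And>y. y \<in> A \<Longrightarrow> r' y \<noteq> 0 \<Longrightarrow> y \<in> U \<and> q' y \<noteq> 0 \<and> g y = p' y / q' y"
        by (rule reg_coordinate_spaceE) blast
      have "U \<subseteq> A" using U unfolding openin_coordinate_space by blast
      then have 3: "q y \<noteq> 0 \<and> q' y \<noteq> 0 \<and> f y = p y / q y \<and> g y = p' y / q' y"
        if "y \<in> U" "r y * r' y \<noteq> 0" for y
        using 1(5)[of y] 2(5)[of y] that by auto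
      have "r x * r' x \<noteq> 0 \<and> (\<forall>y\<in>U. r y * r' y \<noteq> 0 \<longrightarrow>
          q y \<noteq> 0 \<and> q' y \<noteq> 0 \<and> f y = p y / q y \<and> g y = p' y / q' y)"
        using 1(4) 2(4) 3 by simp
      then show ?thesis
        by - (rule bexI[where x="\<lambda>y. r y * r' y"], rule bexI[where x=p], rule bexI[where x=q],
          rule bexI[where x=p'], rule bexI[where x=q'], assumption,
          (rule 1(1-3) 2(1-3) polynomial_functions.mult)+)
    qed
    show "(\<lambda>x. f x + g x) \<in> reg ?X U"
    proof (intro reg_coordinate_spaceI[OF U])
      fix x assume "x \<in> U"
      from *[OF this] obtain r p q p' q' where 1: "r \<in> ?P" "p \<in> ?P" "q \<in> ?P" "p' \<in> ?P" "q' \<in> ?P" "r x \<noteq> 0"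
        "\<forall>y\<in>U. r y \<noteq> 0 \<longrightarrow> q y \<noteq> 0 \<and> q' y \<noteq> 0 \<and> f y = p y / q y \<and> g y = p' y / q' y"
        by (elim bexE conjE) (rule that)
      have 2: "q y * q' y \<noteq> 0 \<and> f y + g y = (p y * q' y + p' y * q y) / (q y * q' y)" if "y \<in> U" "r y \<noteq> 0" for y
        using 1(7) that by (auto simp: field_simps)
      show "\<exists>r\<in>?P. \<exists>p\<in>?P. \<exists>q\<in>?P. r x \<noteq> 0 \<and> (\<forall>y\<in>U. r y \<noteq> 0 \<longrightarrow> q y \<noteq> 0 \<and> f y + g y = p y / q y)"
        by (intro bexI[OF _ 1(1)] bexI[of _ "\<lambda>y. p y * q' y + p' y * q y"] bexI[of _ "\<lambda>y. q y * q' y"]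
          conjI ballI impI polynomial_functions.mult polynomial_functions.add 1) (use 2 in auto)
    qed
    show "(\<lambda>x. f x * g x) \<in> reg ?X U"
    proof (intro reg_coordinate_spaceI[OF U])
      fix x assume "x \<in> U"
      from *[OF this] obtain r p q p' q' where 1: "r \<in> ?P" "p \<in> ?P" "q \<in> ?P" "p' \<in> ?P" "q' \<in> ?P" "r x \<noteq> 0"
        "\<forall>y\<in>U. r y \<noteq> 0 \<longrightarrow> q y \<noteq> 0 \<and> q' y \<noteq> 0 \<and> f y = p y / q y \<and> g y = p' y / q' y"
        by (elim bexE conjE) (rule that)
      have 2: "q y * q' y \<noteq> 0 \<and> f y * g y = (p y * p' y) / (q y * q' y)" if "y \<in> U" "r y \<noteq> 0" for y
        using 1(7) that by (auto simp: field_simps)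
      show "\<exists>r\<in>?P. \<exists>p\<in>?P. \<exists>q\<in>?P. r x \<noteq> 0 \<and> (\<forall>y\<in>U. r y \<noteq> 0 \<longrightarrow> q y \<noteq> 0 \<and> f y * g y = p y / q y)"
        by (intro bexI[OF _ 1(1)] bexI[of _ "\<lambda>y. p y * p' y"] bexI[of _ "\<lambda>y. q y * q' y"]
          conjI ballI impI polynomial_functions.mult polynomial_functions.add 1) (use 2 in auto)
    qed
  }
  {
    assume nz: "\<forall>x\<in>U. f x \<noteq> 0"
    show "(\<lambda>x. inverse (f x)) \<in> reg ?X U"
    proof (intro reg_coordinate_spaceI[OF U])
      fix x assume "x \<in> U"
      with f obtain r p q where 1: "r \<in> ?P" "p \<in> ?P" "q \<in> ?P" "r x \<noteq> 0"
        "\<And>y. y \<in> A \<Longrightarrow> r y \<noteq> 0 \<Longrightarrow> y \<in> U \<and> q y \<noteq> 0 \<and> f y = p y / q y"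
        by (rule reg_coordinate_spaceE) blast
      have UA: "U \<subseteq> A" using U unfolding openin_coordinate_space by blast
      have "p y \<noteq> 0 \<and> inverse (f y) = q y / p y" if "y \<in> U" "r y \<noteq> 0" for y
        using 1(5)[of y] nz UA that by (auto simp: field_simps)
      then show "\<exists>r\<in>?P. \<exists>p\<in>?P. \<exists>q\<in>?P. r x \<noteq> 0 \<and> (\<forall>y\<in>U. r y \<noteq> 0 \<longrightarrow> q y \<noteq> 0 \<and> inverse (f y) = p y / q y)"
        using 1 by blast
    qed
  }
  show "openin (zar ?X) {x \<in> U. f x \<noteq> 0}"
    unfolding openin_coordinate_space
  proof (intro conjI ballI)
    show "{x \<in> U. f x \<noteq> 0} \<subseteq> A" using U unfolding openin_coordinate_space by blast
    fix x assume x: "x \<in> {x \<in> U. f x \<noteq> 0}"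
    then have "x \<in> U" by simp
    with f obtain r p q where 1: "r \<in> ?P" "p \<in> ?P" "q \<in> ?P" "x \<in> A" "r x \<noteq> 0"
        "\<And>y. y \<in> A \<Longrightarrow> r y \<noteq> 0 \<Longrightarrow> y \<in> U \<and> q y \<noteq> 0 \<and> f y = p y / q y"
        by (rule reg_coordinate_spaceE) blast
    \<comment> \<open>Where \<open>r\<close> is nonzero the function is \<open>p / q\<close>, so it
      is nonzero exactly where \<open>p\<close> is.\<close>
    then have "r x * p x \<noteq> 0" using x 1(6)[of x] by auto
    moreover have "y \<in> U \<and> f y \<noteq> 0" if "y \<in> A" "r y * p y \<noteq> 0" for y
      using 1(6)[of y] that by auto
    ultimately show "\<exists>p\<in>?P. p x \<noteq> 0 \<and> (\<forall>y\<in>A. p y \<noteq> 0 \<longrightarrow> y \<in> {x \<in> U. f x \<noteq> 0})"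
      by (intro bexI[of _ "\<lambda>y. r y * p y"]) (auto simp: polynomial_functions.mult 1)
  qed
qed

section \<open>Induced structures and quotients as spaces with functions\<close>

lemma zar_induced_on [simp]: "zar (induced_on X Z) = subtopology (zar X) Z"
  by (simp add: induced_on_def)

lemma reg_induced_on: "f \<in> reg (induced_on X Z) U \<longleftrightarrow>
    (\<forall>x\<in>U. \<exists>V g. openin (zar X) V \<and> x \<in> V \<and> g \<in> reg X V \<and> (\<forall>y \<in> V \<inter> U. f y = g y))"
  by (simp add: induced_on_def)

lemma reg_induced_onI:
  assumes "openin (zar X) V" "U \<subseteq> V" "f \<in> reg X V"
  shows "f \<in> reg (induced_on X Z) U"
  using assms unfolding reg_induced_on by blast

lemma function_space_induced_on:
  assumes "function_space X"
  shows "function_space (induced_on X Z)"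
proof -
  interpret X: function_space X by fact
  show ?thesis
  proof
    fix U f g
    assume U: "openin (zar (induced_on X Z)) U"
    then have UZ: "U \<subseteq> Z" "U \<subseteq> points X" by (auto simp: openin_subtopology dest: openin_subset)
    {
      assume *: "\<And>x. x \<in> U \<Longrightarrow> \<exists>V g. openin (zar (induced_on X Z)) V \<and> x \<in> V \<and>
        g \<in> reg (induced_on X Z) V \<and> (\<forall>y\<in>V \<inter> U. f y = g y)"
      show "f \<in> reg (induced_on X Z) U"
        unfolding reg_induced_on
      proof
        fix x assume x: "x \<in> U"
        from *[OF x] obtain V g where V: "openin (zar (induced_on X Z)) V" "x \<in> V"
           "g \<in> reg (induced_on X Z) V" "\<forall>y\<in>V \<inter> U. f y = g y" by blast
        from V(1) obtain O1 where O1: "openin (zar X) O1" "V = O1 \<inter> Z" by (auto simp: openin_subtopology)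
        from V(2,3) obtain O2 g' where O2: "openin (zar X) O2" "x \<in> O2" "g' \<in> reg X O2" "\<forall>y\<in>O2 \<inter> V. g y = g' y"
          unfolding reg_induced_on by blast
        \<comment> \<open>\<open>g'\<close> represents \<open>g\<close> only on \<open>V\<close>,
          which is cut out by \<open>O1\<close>; outside \<open>O1\<close> it bears no relation to
          \<open>f\<close>, hence the intersection.\<close>
        have "g' \<in> reg X (O1 \<inter> O2)" by (rule X.reg_restrict[of O2]) (use O1 O2 in auto)
        then show "\<exists>V g. openin (zar X) V \<and> x \<in> V \<and> g \<in> reg X V \<and> (\<forall>y\<in>V \<inter> U. f y = g y)"
          using O1 O2 V UZ x by (intro exI[of _ "O1 \<inter> O2"] exI[of _ g']) auto
      qed
    }
    show "(\<lambda>_. c) \<in> reg (induced_on X Z) U" for c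
      using UZ by (intro reg_induced_onI[of _ "points X"] X.reg_const) auto
    assume f: "f \<in> reg (induced_on X Z) U"
    {
      assume g: "g \<in> reg (induced_on X Z) U"
      have *: "\<exists>V f' g'. openin (zar X) V \<and> x \<in> V \<and> f' \<in> reg X V \<and> g' \<in> reg X V \<and>
          (\<forall>y\<in>V \<inter> U. f y = f' y \<and> g y = g' y)" if "x \<in> U" for x
      proof -
        from f that obtain V f' where 1: "openin (zar X) V" "x \<in> V" "f' \<in> reg X V" "\<forall>y\<in>V \<inter> U. f y = f' y"
          unfolding reg_induced_on by blast
        from g that obtain V' g' where 2: "openin (zar X) V'" "x \<in> V'" "g' \<in> reg X V'" "\<forall>y\<in>V' \<inter> U. g y = g' y"
          unfolding reg_induced_on by blast
        have "f' \<in> reg X (V \<inter> V')" by (rule X.reg_restrict[of V]) (use 1 2 in auto)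
        moreover have "g' \<in> reg X (V \<inter> V')" by (rule X.reg_restrict[of V']) (use 1 2 in auto)
        ultimately show ?thesis
          using 1 2 by (intro exI[of _ "V \<inter> V'"] exI[of _ f'] exI[of _ g']) auto
      qed
      show "(\<lambda>x. f x + g x) \<in> reg (induced_on X Z) U"
        unfolding reg_induced_on
      proof
        fix x assume "x \<in> U"
        from *[OF this] obtain V f' g' where "openin (zar X) V" "x \<in> V" "f' \<in> reg X V" "g' \<in> reg X V"
          "\<forall>y\<in>V \<inter> U. f y = f' y \<and> g y = g' y" by blast
        then show "\<exists>V h. openin (zar X) V \<and> x \<in> V \<and> h \<in> reg X V \<and> (\<forall>y\<in>V \<inter> U. f y + g y = h y)"
          by (intro exI[of _ V] exI[of _ "\<lambda>y. f' y + g' y"]) (auto intro: X.reg_add)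
      qed
      show "(\<lambda>x. f x * g x) \<in> reg (induced_on X Z) U"
        unfolding reg_induced_on
      proof
        fix x assume "x \<in> U"
        from *[OF this] obtain V f' g' where "openin (zar X) V" "x \<in> V" "f' \<in> reg X V" "g' \<in> reg X V"
          "\<forall>y\<in>V \<inter> U. f y = f' y \<and> g y = g' y" by blast
        then show "\<exists>V h. openin (zar X) V \<and> x \<in> V \<and> h \<in> reg X V \<and> (\<forall>y\<in>V \<inter> U. f y * g y = h y)"
          by (intro exI[of _ V] exI[of _ "\<lambda>y. f' y * g' y"]) (auto intro: X.reg_mult)
      qed
    }
    {
      assume nz: "\<forall>x\<in>U. f x \<noteq> 0"
      show "(\<lambda>x. inverse (f x)) \<in> reg (induced_on X Z) U"
        unfolding reg_induced_on
      proof
        fix x assume x: "x \<in> U"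
        with f obtain V f' where 1: "openin (zar X) V" "x \<in> V" "f' \<in> reg X V" "\<forall>y\<in>V \<inter> U. f y = f' y"
          unfolding reg_induced_on by blast
        \<comment> \<open>The local extension \<open>f'\<close> may have zeros off \<open>U\<close>,
          so the neighbourhood is shrunk before inverting.\<close>
        let ?W = "{y \<in> V. f' y \<noteq> 0}"
        have W: "openin (zar X) ?W" by (rule X.open_nonzero[OF 1(1,3)])
        have "f' \<in> reg X ?W" by (rule X.reg_restrict[OF 1(1) W _ 1(3)]) auto
        then have "(\<lambda>x. inverse (f' x)) \<in> reg X ?W" using W by (intro X.reg_inverse) auto
        then show "\<exists>V g. openin (zar X) V \<and> x \<in> V \<and> g \<in> reg X V \<and> (\<forall>y\<in>V \<inter> U. inverse (f y) = g y)"
          using 1 x nz W by (intro exI[of _ ?W] exI[of _ "\<lambda>x. inverse (f' x)"]) auto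
      qed
    }
    show "openin (zar (induced_on X Z)) {x \<in> U. f x \<noteq> 0}"
    proof (subst openin_subopen, intro ballI)
      fix x assume x: "x \<in> {x \<in> U. f x \<noteq> 0}"
      with f obtain V f' where 1: "openin (zar X) V" "x \<in> V" "f' \<in> reg X V" "\<forall>y\<in>V \<inter> U. f y = f' y"
          unfolding reg_induced_on by blast
      let ?W = "{y \<in> V. f' y \<noteq> 0}"
      have W: "openin (zar X) ?W" by (rule X.open_nonzero[OF 1(1,3)])
      have "openin (zar (induced_on X Z)) (?W \<inter> U)"
      proof -
        obtain O1 where O1: "openin (zar X) O1" "U = O1 \<inter> Z" using U by (auto simp: openin_subtopology)
        then have "?W \<inter> U = (?W \<inter> O1) \<inter> Z" by auto
        then show ?thesis using O1 W by (auto simp: openin_subtopology)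
      qed
      then show "\<exists>T. openin (zar (induced_on X Z)) T \<and> x \<in> T \<and> T \<subseteq> {x \<in> U. f x \<noteq> 0}"
        using x 1 by (intro exI[of _ "?W \<inter> U"]) auto
    qed
  qed
qed

lemma openin_quotient_space: "openin (zar (quotient_space X q)) V \<longleftrightarrow>
   V \<subseteq> q ` points X \<and> openin (zar X) {x \<in> points X. q x \<in> V}"
  by (simp add: quotient_space_def openin_identification_topology)

lemma points_quotient_space [simp]: "points (quotient_space X q) = q ` points X"
proof
  show "points (quotient_space X q) \<subseteq> q ` points X"
    using openin_topspace[of "zar (quotient_space X q)"] unfolding openin_quotient_space by blast
  have "{x \<in> points X. q x \<in> q ` points X} = points X" by auto
  then have "openin (zar (quotient_space X q)) (q ` points X)"
    by (simp add: openin_quotient_space)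
  then show "q ` points X \<subseteq> points (quotient_space X q)"
    by (rule openin_subset)
qed

lemma reg_quotient_space: "f \<in> reg (quotient_space X q) U \<longleftrightarrow> f \<circ> q \<in> reg X {x \<in> points X. q x \<in> U}"
  by (simp add: quotient_space_def)

text \<open>Every axiom for an open set is the same axiom of \<open>X\<close> for its preimage,
  because openness and regularity on the quotient are defined by pulling back along
  \<open>q\<close>.\<close>

lemma function_space_quotient_space:
  assumes "function_space X"
  shows "function_space (quotient_space X q)"
proof -
  interpret X: function_space X by fact
  show ?thesis
  proof
    fix U f g
    assume U: "openin (zar (quotient_space X q)) U"
    let ?U = "{x \<in> points X. q x \<in> U}"
    have oU: "openin (zar X) ?U" using U by (simp add: openin_quotient_space)
    {
      assume *: "\<And>x. x \<in> U \<Longrightarrow> \<exists>V g. openin (zar (quotient_space X q)) V \<and> x \<in> V \<and>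
        g \<in> reg (quotient_space X q) V \<and> (\<forall>y\<in>V \<inter> U. f y = g y)"
      show "f \<in> reg (quotient_space X q) U"
        unfolding reg_quotient_space
      proof (rule X.reg_local[OF oU])
        fix x assume x: "x \<in> ?U"
        then obtain V g where "openin (zar (quotient_space X q)) V" "q x \<in> V"
          "g \<in> reg (quotient_space X q) V" "\<forall>y\<in>V \<inter> U. f y = g y" using *[of "q x"] by blast
        then show "\<exists>V g. openin (zar X) V \<and> x \<in> V \<and> g \<in> reg X V \<and> (\<forall>y\<in>V \<inter> ?U. (f \<circ> q) y = g y)"
          using x by (intro exI[of _ "{x \<in> points X. q x \<in> V}"] exI[of _ "g \<circ> q"])
            (auto simp: openin_quotient_space reg_quotient_space)
      qed
    }
    show "(\<lambda>_. c) \<in> reg (quotient_space X q) U" for c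
      using X.reg_const[OF oU, of c] by (simp add: reg_quotient_space o_def)
    assume f: "f \<in> reg (quotient_space X q) U"
    {
      assume g: "g \<in> reg (quotient_space X q) U"
      show "(\<lambda>x. f x + g x) \<in> reg (quotient_space X q) U" "(\<lambda>x. f x * g x) \<in> reg (quotient_space X q) U"
        using X.reg_add[OF oU] X.reg_mult[OF oU] f g by (simp_all add: reg_quotient_space o_def)
    }
    {
      assume "\<forall>x\<in>U. f x \<noteq> 0"
      then show "(\<lambda>x. inverse (f x)) \<in> reg (quotient_space X q) U"
        using X.reg_inverse[OF oU] f by (simp add: reg_quotient_space o_def)
    }
    have "{x \<in> points X. q x \<in> {x \<in> U. f x \<noteq> 0}} = {x \<in> ?U. (f \<circ> q) x \<noteq> 0}" by auto
    then show "openin (zar (quotient_space X q)) {x \<in> U. f x \<noteq> 0}"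
      using X.open_nonzero[OF oU, of "f \<circ> q"] f U by (auto simp: reg_quotient_space openin_quotient_space)
  qed
qed

section \<open>Morphisms\<close>

lemma morphism_maps: "morphism X Y f \<Longrightarrow> x \<in> points X \<Longrightarrow> f x \<in> points Y"
  by (auto simp: morphism_def continuous_map_def)

lemma morphism_openin: "morphism X Y f \<Longrightarrow> openin (zar Y) V \<Longrightarrow> openin (zar X) {x \<in> points X. f x \<in> V}"
  by (auto simp: morphism_def continuous_map_def)

lemma morphism_reg: "morphism X Y f \<Longrightarrow> openin (zar Y) V \<Longrightarrow> h \<in> reg Y V \<Longrightarrow>
    h \<circ> f \<in> reg X {x \<in> points X. f x \<in> V}"
  by (auto simp: morphism_def)

lemma morphismI:
  assumes "\<And>x. x \<in> points X \<Longrightarrow> f x \<in> points Y"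
    and "\<And>V. openin (zar Y) V \<Longrightarrow> openin (zar X) {x \<in> points X. f x \<in> V}"
    and "\<And>V h. openin (zar Y) V \<Longrightarrow> h \<in> reg Y V \<Longrightarrow> h \<circ> f \<in> reg X {x \<in> points X. f x \<in> V}"
  shows "morphism X Y f"
  using assms by (auto simp: morphism_def continuous_map_def)

lemma morphism_compose:
  assumes "morphism X Y f" "morphism Y Z g"
  shows "morphism X Z (g \<circ> f)"
proof (rule morphismI)
  fix V assume V: "openin (zar Z) V"
  have eq: "{x \<in> points X. (g \<circ> f) x \<in> V} = {x \<in> points X. f x \<in> {y \<in> points Y. g y \<in> V}}"
    using morphism_maps[OF assms(1)] by auto
  show "openin (zar X) {x \<in> points X. (g \<circ> f) x \<in> V}"
    unfolding eq by (intro morphism_openin[OF assms(1)] morphism_openin[OF assms(2)] V)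
  fix h assume h: "h \<in> reg Z V"
  show "h \<circ> (g \<circ> f) \<in> reg X {x \<in> points X. (g \<circ> f) x \<in> V}"
    unfolding eq o_assoc
    by (intro morphism_reg[OF assms(1)] morphism_reg[OF assms(2)] morphism_openin[OF assms(2)] V h)
qed (use assms in \<open>auto dest: morphism_maps\<close>)

text \<open>Polynomials in regular coordinates are regular, so preimages of basic open sets are
  nonvanishing loci, and fractions pull back to fractions with nonvanishing denominator.\<close>

lemma morphism_to_coordinate_space:
  assumes "function_space X" "\<And>x. x \<in> points X \<Longrightarrow> \<phi> x \<in> A"
    and F: "\<And>f. f \<in> F \<Longrightarrow> (\<lambda>x. f (\<phi> x)) \<in> reg X (points X)"
  shows "morphism X (coordinate_space A F) \<phi>"
proof -
  interpret X: function_space X by fact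
  have poly: "(\<lambda>x. p (\<phi> x)) \<in> reg X (points X)" if "p \<in> polynomial_functions F" for p
    using that by induction (simp_all add: X.reg_const X.reg_add X.reg_mult F)
  have polyr: "(\<lambda>x. p (\<phi> x)) \<in> reg X V" if "p \<in> polynomial_functions F" "openin (zar X) V" for p V
    by (rule X.reg_restrict[OF _ that(2) _ poly[OF that(1)]]) (use that openin_subset in auto)
  show ?thesis
  proof (rule morphismI)
    show "\<phi> x \<in> points (coordinate_space A F)" if "x \<in> points X" for x
      using assms(2) that by (simp add: points_coordinate_space)
    fix V assume V: "openin (zar (coordinate_space A F)) V"
    show o: "openin (zar X) {x \<in> points X. \<phi> x \<in> V}"
    proof (subst openin_subopen, intro ballI)
      fix x assume x: "x \<in> {x \<in> points X. \<phi> x \<in> V}"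
      with V obtain p where p: "p \<in> polynomial_functions F" "p (\<phi> x) \<noteq> 0" "\<forall>y\<in>A. p y \<noteq> 0 \<longrightarrow> y \<in> V"
        unfolding openin_coordinate_space by blast
      then show "\<exists>T. openin (zar X) T \<and> x \<in> T \<and> T \<subseteq> {x \<in> points X. \<phi> x \<in> V}"
        using x assms(2) X.open_nonzero[OF _ poly[OF p(1)]]
        by (intro exI[of _ "{x \<in> points X. p (\<phi> x) \<noteq> 0}"]) auto
    qed
    fix h assume h: "h \<in> reg (coordinate_space A F) V"
    show "h \<circ> \<phi> \<in> reg X {x \<in> points X. \<phi> x \<in> V}"
    proof (rule X.reg_local[OF o])
      fix x assume x: "x \<in> {x \<in> points X. \<phi> x \<in> V}"
      then have "\<phi> x \<in> V" by simp
      with h obtain r p q where *: "r \<in> polynomial_functions F" "p \<in> polynomial_functions F"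
        "q \<in> polynomial_functions F" "r (\<phi> x) \<noteq> 0"
        "\<And>y. y \<in> A \<Longrightarrow> r y \<noteq> 0 \<Longrightarrow> y \<in> V \<and> q y \<noteq> 0 \<and> h y = p y / q y"
        by (rule reg_coordinate_spaceE) blast
      let ?W = "{x \<in> points X. r (\<phi> x) \<noteq> 0}"
      have W: "openin (zar X) ?W" by (rule X.open_nonzero[OF _ poly[OF *(1)]]) auto
      have "(\<lambda>x. p (\<phi> x) / q (\<phi> x)) \<in> reg X ?W"
        using *(5) assms(2) by (intro X.reg_divide W polyr *) auto
      then show "\<exists>U g. openin (zar X) U \<and> x \<in> U \<and> g \<in> reg X U \<and>
          (\<forall>y\<in>U \<inter> {x \<in> points X. \<phi> x \<in> V}. (h \<circ> \<phi>) y = g y)"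
        using W x * assms(2) by (intro exI[of _ ?W] exI[of _ "\<lambda>x. p (\<phi> x) / q (\<phi> x)"]) auto
    qed
  qed
qed

text \<open>A regular function on the subspace is only locally a restriction from \<open>Y\<close>,
  so its pullback must be glued on \<open>X\<close>; this is where the axioms for \<open>X\<close>
  enter.\<close>

lemma morphism_into_induced_on:
  assumes "function_space X" "morphism X Y f" "\<And>x. x \<in> points X \<Longrightarrow> f x \<in> B"
  shows "morphism X (induced_on Y B) f"
proof -
  interpret X: function_space X by fact
  show ?thesis
  proof (rule morphismI)
    show "f x \<in> points (induced_on Y B)" if "x \<in> points X" for x
      using assms that morphism_maps by fastforce
    fix V assume V: "openin (zar (induced_on Y B)) V"
    then obtain V' where V': "openin (zar Y) V'" "V = V' \<inter> B" by (auto simp: openin_subtopology)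
    have eq: "{x \<in> points X. f x \<in> V} = {x \<in> points X. f x \<in> V'}" using V' assms(3) by auto
    show o: "openin (zar X) {x \<in> points X. f x \<in> V}"
      unfolding eq by (rule morphism_openin[OF assms(2) V'(1)])
    fix h assume h: "h \<in> reg (induced_on Y B) V"
    show "h \<circ> f \<in> reg X {x \<in> points X. f x \<in> V}"
    proof (rule X.reg_local[OF o])
      fix x assume x: "x \<in> {x \<in> points X. f x \<in> V}"
      with h obtain W g where W: "openin (zar Y) W" "f x \<in> W" "g \<in> reg Y W" "\<forall>y\<in>W \<inter> V. h y = g y"
        unfolding reg_induced_on by blast
      then show "\<exists>U g. openin (zar X) U \<and> x \<in> U \<and> g \<in> reg X U \<and>
          (\<forall>y\<in>U \<inter> {x \<in> points X. f x \<in> V}. (h \<circ> f) y = g y)"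
        using x morphism_openin[OF assms(2) W(1)] morphism_reg[OF assms(2) W(1,3)]
        by (intro exI[of _ "{x \<in> points X. f x \<in> W}"] exI[of _ "g \<circ> f"]) auto
    qed
  qed
qed

lemma morphism_induced_on_restrict:
  assumes "function_space X" "morphism X Y f"
  shows "morphism (induced_on X A) Y f"
proof (rule morphismI)
  show "f x \<in> points Y" if "x \<in> points (induced_on X A)" for x
    using assms that morphism_maps by fastforce
  fix V assume V: "openin (zar Y) V"
  have eq: "{x \<in> points (induced_on X A). f x \<in> V} = {x \<in> points X. f x \<in> V} \<inter> A" by auto
  show "openin (zar (induced_on X A)) {x \<in> points (induced_on X A). f x \<in> V}"
    unfolding eq using morphism_openin[OF assms(2) V] by (auto simp: openin_subtopology)
  fix h assume "h \<in> reg Y V"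
  then show "h \<circ> f \<in> reg (induced_on X A) {x \<in> points (induced_on X A). f x \<in> V}"
    unfolding eq using morphism_openin[OF assms(2) V] morphism_reg[OF assms(2) V]
    by (intro reg_induced_onI) auto
qed

lemma morphism_induced_on:
  assumes "function_space X" "morphism X Y f" "\<And>x. x \<in> points X \<Longrightarrow> x \<in> A \<Longrightarrow> f x \<in> B"
  shows "morphism (induced_on X A) (induced_on Y B) f"
  by (intro morphism_into_induced_on function_space_induced_on morphism_induced_on_restrict assms(1,2))
    (use assms(3) in auto)

lemma morphism_quotient_map: "morphism X (quotient_space X q) q"
  by (rule morphismI) (auto simp: openin_quotient_space reg_quotient_space)

lemma morphism_from_quotient:
  assumes "morphism X Y (\<phi> \<circ> q)"
  shows "morphism (quotient_space X q) Y \<phi>"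
proof (rule morphismI)
  show "\<phi> x \<in> points Y" if "x \<in> points (quotient_space X q)" for x
    using assms that morphism_maps by fastforce
  fix V assume V: "openin (zar Y) V"
  have eq: "{x \<in> points X. q x \<in> {x \<in> points (quotient_space X q). \<phi> x \<in> V}} = {x \<in> points X. (\<phi> \<circ> q) x \<in> V}"
    by auto
  show "openin (zar (quotient_space X q)) {x \<in> points (quotient_space X q). \<phi> x \<in> V}"
    unfolding openin_quotient_space eq using morphism_openin[OF assms V] by auto
  fix h assume "h \<in> reg Y V"
  then show "h \<circ> \<phi> \<in> reg (quotient_space X q) {x \<in> points (quotient_space X q). \<phi> x \<in> V}"
    unfolding reg_quotient_space eq using morphism_reg[OF assms V] by (simp add: o_assoc)
qed

lemma morphism_cong:
  assumes "function_space X" "morphism X Y f" "\<And>x. x \<in> points X \<Longrightarrow> g x = f x"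
  shows "morphism X Y g"
proof -
  interpret X: function_space X by fact
  show ?thesis
  proof (rule morphismI)
    show "g x \<in> points Y" if "x \<in> points X" for x
      using assms that morphism_maps by fastforce
    fix V assume V: "openin (zar Y) V"
    have eq: "{x \<in> points X. g x \<in> V} = {x \<in> points X. f x \<in> V}" using assms(3) by auto
    show "openin (zar X) {x \<in> points X. g x \<in> V}" unfolding eq by (rule morphism_openin[OF assms(2) V])
    fix h assume "h \<in> reg Y V"
    from X.reg_cong[OF morphism_openin[OF assms(2) V] morphism_reg[OF assms(2) V this], of "h \<circ> g"]
    show "h \<circ> g \<in> reg X {x \<in> points X. g x \<in> V}"
      unfolding eq by (simp add: assms(3))
  qed
qed

lemma isomorphicI:
  assumes "morphism X Y f" "morphism Y X g"
    "\<And>x. x \<in> points X \<Longrightarrow> g (f x) = x" "\<And>y. y \<in> points Y \<Longrightarrow> f (g y) = y"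
  shows "isomorphic X Y"
  using assms unfolding isomorphic_def by blast

lemma isomorphic_trans:
  assumes "isomorphic X Y" "isomorphic Y Z"
  shows "isomorphic X Z"
proof -
  from assms(1) obtain f g where
    1: "morphism X Y f" "morphism Y X g" "\<forall>x \<in> points X. g (f x) = x" "\<forall>y \<in> points Y. f (g y) = y"
    unfolding isomorphic_def by metis
  from assms(2) obtain f' g' where
    2: "morphism Y Z f'" "morphism Z Y g'" "\<forall>x \<in> points Y. g' (f' x) = x" "\<forall>y \<in> points Z. f' (g' y) = y"
    unfolding isomorphic_def by metis
  show ?thesis
    using 1(3,4) 2(3,4) morphism_maps[OF 1(1)] morphism_maps[OF 2(2)]
    by (intro isomorphicI[of X Z "f' \<circ> f" "g \<circ> g'"] morphism_compose[OF 1(1) 2(1)] morphism_compose[OF 2(2) 1(2)])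
      auto
qed

lemma affine_variety_isomorphic: "isomorphic X Y \<Longrightarrow> affine_variety Y \<Longrightarrow> affine_variety X"
  unfolding affine_variety_def by (elim exE conjE, intro exI conjI, assumption, rule isomorphic_trans)

lemma isomorphic_induced_on:
  assumes "function_space X" "function_space Y" "morphism X Y f" "morphism Y X g"
    "\<And>x. x \<in> points X \<Longrightarrow> g (f x) = x" "\<And>y. y \<in> points Y \<Longrightarrow> f (g y) = y"
    and "B \<subseteq> points Y" "A = {x \<in> points X. f x \<in> B}"
  shows "isomorphic (induced_on X A) (induced_on Y B)"
  by (intro isomorphicI[of _ _ f g] morphism_induced_on assms(1-4))
    (use assms(5-) morphism_maps[OF assms(4)] in auto)

lemma morphism_quotient_quotient:
  assumes "function_space X" "morphism X Y f" "\<And>x. x \<in> points X \<Longrightarrow> \<phi> (q x) = q' (f x)"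
  shows "morphism (quotient_space X q) (quotient_space Y q') \<phi>"
proof (rule morphism_from_quotient, rule morphism_cong[OF assms(1)])
  show "morphism X (quotient_space Y q') (q' \<circ> f)"
    by (rule morphism_compose[OF assms(2) morphism_quotient_map])
qed (use assms(3) in auto)

section \<open>Weighted projective spaces\<close>

definition weight :: "nat list \<Rightarrow> (nat \<Rightarrow> nat) \<Rightarrow> nat"
  where "weight ws e = (\<Sum>j<length ws. ws ! j * e j)"

definition monomial :: "nat \<Rightarrow> (nat \<Rightarrow> nat) \<Rightarrow> complex vec \<Rightarrow> complex"
  where "monomial d e v = (\<Prod>j<d. v $ j ^ e j)"

definition weighted_scale :: "nat list \<Rightarrow> complex \<Rightarrow> complex vec \<Rightarrow> complex vec"
  where "weighted_scale ws t v = vec (length ws) (\<lambda>i. t ^ (ws ! i) * v $ i)"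

abbreviation coordinates :: "nat \<Rightarrow> (complex vec \<Rightarrow> complex) set"
  where "coordinates m \<equiv> {\<lambda>v. v $ i | i. i < m}"

abbreviation polynomials :: "nat \<Rightarrow> (complex vec \<Rightarrow> complex) set"
  where "polynomials m \<equiv> polynomial_functions (coordinates m)"

lemma complex_nth_root_exists:
  assumes "n > 0"
  shows "\<exists>y::complex. y ^ n = z"
proof -
  have "rcis (root n (cmod z)) (Arg z / real n) ^ n = z"
    using assms by (simp add: DeMoivre2 rcis_cmod_Arg)
  then show ?thesis by blast
qed

lemma weight_add: "weight ws (\<lambda>j. e j + e' j) = weight ws e + weight ws e'"
  by (simp add: weight_def sum.distrib distrib_left)

lemma weight_mult: "weight ws (\<lambda>j. c * e j) = c * weight ws e"
  by (simp add: weight_def sum_distrib_left mult_ac)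

lemma weight_sum: "weight ws (\<lambda>j. \<Sum>l\<in>A. x l j) = (\<Sum>l\<in>A. weight ws (x l))"
  unfolding weight_def sum_distrib_left by (rule sum.swap)

lemma weight_single: "i < length ws \<Longrightarrow> weight ws (\<lambda>j. if j = i then c else 0) = ws ! i * c"
  by (simp add: weight_def sum.delta if_distrib[of "(*) _"] cong: if_cong)

lemma weight_cong: "(\<And>j. j < length ws \<Longrightarrow> e j = e' j) \<Longrightarrow> weight ws e = weight ws e'"
  by (simp add: weight_def)

lemma monomial_add: "monomial d (\<lambda>j. e j + e' j) v = monomial d e v * monomial d e' v"
  by (simp add: monomial_def power_add prod.distrib)

lemma monomial_mult: "monomial d (\<lambda>j. c * e j) v = monomial d e v ^ c"
  unfolding monomial_def prod_power_distrib by (intro prod.cong) (simp_all add: mult.commute flip: power_mult)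

lemma monomial_cong: "(\<And>j. j < d \<Longrightarrow> e j = e' j) \<Longrightarrow> monomial d e v = monomial d e' v"
  by (simp add: monomial_def)

lemma monomial_single:
  assumes "i < d"
  shows "monomial d (\<lambda>j. if j = i then c else 0) v = v $ i ^ c"
proof -
  have "monomial d (\<lambda>j. if j = i then c else 0) v = (\<Prod>j<d. if j = i then v $ i ^ c else 1)"
    unfolding monomial_def by (intro prod.cong) auto
  then show ?thesis using assms by (simp add: prod.delta)
qed

lemma monomial_in_polynomial_functions: "monomial d e \<in> polynomials d"
proof -
  have "(\<lambda>v. v $ j) \<in> polynomials d" if "j < d" for j
    using that by (intro polynomial_functions.coord) auto
  then have "(\<lambda>v. \<Prod>j<d. v $ j ^ e j) \<in> polynomials d"
    by (intro polynomial_functions_prod polynomial_functions_power) simp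
  then show ?thesis by (simp add: monomial_def[abs_def])
qed

lemma dim_weighted_scale [simp]: "dim_vec (weighted_scale ws t v) = length ws"
  by (simp add: weighted_scale_def)

lemma weighted_scale_carrier [simp]: "weighted_scale ws t v \<in> carrier_vec (length ws)"
  by (simp add: weighted_scale_def)

lemma index_weighted_scale [simp]: "i < length ws \<Longrightarrow> weighted_scale ws t v $ i = t ^ (ws ! i) * v $ i"
  by (simp add: weighted_scale_def)

lemma weighted_scale_mult:
  "weighted_scale ws s (weighted_scale ws t v) = weighted_scale ws (s * t) v"
  by (intro eq_vecI) (auto simp: power_mult_distrib)

lemma weighted_scale_one: "v \<in> carrier_vec (length ws) \<Longrightarrow> weighted_scale ws 1 v = v"
  by (intro eq_vecI) auto

lemma monomial_weighted_scale:
  "monomial (length ws) e (weighted_scale ws t v) = t ^ weight ws e * monomial (length ws) e v"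
  by (simp add: monomial_def weight_def power_mult_distrib prod.distrib power_sum flip: power_mult)

lemma weighted_scale_eq_zero_iff:
  assumes "t \<noteq> 0" "v \<in> carrier_vec (length ws)"
  shows "weighted_scale ws t v = 0\<^sub>v (length ws) \<longleftrightarrow> v = 0\<^sub>v (length ws)"
  using assms by (auto simp: vec_eq_iff)

text \<open>Polynomials occur only as functions, so homogeneity is expressed through some list of
  coefficients and exponents; repeated monomials are harmless because uniqueness of the list is
  never claimed.\<close>

definition isobaric :: "nat list \<Rightarrow> nat \<Rightarrow> (complex vec \<Rightarrow> complex) \<Rightarrow> bool"
  where "isobaric ws w p \<longleftrightarrow> (\<exists>L. (\<forall>(c, e)\<in>set L. weight ws e = w) \<and>
    (\<forall>v. p v = (\<Sum>(c, e)\<leftarrow>L. c * monomial (length ws) e v)))"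

lemma sum_list_monomial_mult:
  "(\<Sum>(c, e)\<leftarrow>L. c * monomial d e v) * (\<Sum>(c, e)\<leftarrow>L'. c * monomial d e v) =
   (\<Sum>(c, e)\<leftarrow>concat (map (\<lambda>(c, e). map (\<lambda>(c', e'). (c * c', \<lambda>j. e j + e' j)) L') L). c * monomial d e v)"
proof (induction L)
  case (Cons x L)
  obtain c e where x: "x = (c, e)" by force
  have "c * monomial d e v * (\<Sum>(c, e)\<leftarrow>L'. c * monomial d e v) =
      (\<Sum>(c, e)\<leftarrow>map (\<lambda>(c', e'). (c * c', \<lambda>j. e j + e' j)) L'. c * monomial d e v)"
    by (induction L') (auto simp: monomial_add algebra_simps)
  then show ?case using Cons by (simp add: x distrib_right)
qed simp

lemma isobaric_mult:
  assumes "isobaric ws w p" "isobaric ws w' q"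
  shows "isobaric ws (w + w') (\<lambda>v. p v * q v)"
proof -
  from assms(1) obtain L where L: "\<forall>(c, e)\<in>set L. weight ws e = w"
      "\<forall>v. p v = (\<Sum>(c, e)\<leftarrow>L. c * monomial (length ws) e v)"
    unfolding isobaric_def by blast
  from assms(2) obtain L' where L': "\<forall>(c, e)\<in>set L'. weight ws e = w'"
      "\<forall>v. q v = (\<Sum>(c, e)\<leftarrow>L'. c * monomial (length ws) e v)"
    unfolding isobaric_def by blast
  have "\<forall>(c, e)\<in>set (concat (map (\<lambda>(c, e). map (\<lambda>(c', e'). (c * c', \<lambda>j. e j + e' j)) L') L)).
      weight ws e = w + w'"
    using L(1) L'(1) by (fastforce simp: weight_add)
  then show ?thesis
    unfolding isobaric_def
    by (intro exI conjI) (assumption, simp only: L(2) L'(2) sum_list_monomial_mult, simp)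
qed

lemma isobaric_power:
  assumes "isobaric ws w p"
  shows "isobaric ws (k * w) (\<lambda>v. p v ^ k)"
proof (induction k)
  case 0
  show ?case
    unfolding isobaric_def
    by (rule exI[of _ "[(1, \<lambda>_. 0)]"]) (auto simp: weight_def monomial_def)
next
  case (Suc k)
  then show ?case using isobaric_mult[OF assms Suc] by simp
qed

lemma polynomial_function_expansion:
  assumes "p \<in> polynomials d"
  shows "\<exists>L. \<forall>v. p v = (\<Sum>(c, e)\<leftarrow>L. c * monomial d e v)"
  using assms
proof induction
  case (const c)
  show ?case by (rule exI[of _ "[(c, \<lambda>_. 0)]"]) (simp add: monomial_def)
next
  case (coord f)
  then obtain i where "i < d" "f = (\<lambda>v. v $ i)" by blast
  then show ?case
    by (intro exI[of _ "[(1, \<lambda>j. if j = i then 1 else 0)]"]) (simp add: monomial_single)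
next
  case (add p q)
  then obtain L L' where "\<forall>v. p v = (\<Sum>(c, e)\<leftarrow>L. c * monomial d e v)"
    "\<forall>v. q v = (\<Sum>(c, e)\<leftarrow>L'. c * monomial d e v)" by blast
  then show ?case by (intro exI[of _ "L @ L'"]) simp
next
  case (mult p q)
  then obtain L L' where L: "\<forall>v. p v = (\<Sum>(c, e)\<leftarrow>L. c * monomial d e v)"
    "\<forall>v. q v = (\<Sum>(c, e)\<leftarrow>L'. c * monomial d e v)" by blast
  show ?case by (intro exI allI) (simp only: L sum_list_monomial_mult)
qed

text \<open>The polynomial \<open>r\<close> is \<open>p\<close> along the orbit of \<open>v\<close>, so its coefficients are the isobaric parts.\<close>

lemma isobaric_components:
  assumes "p \<in> polynomials (length ws)"
  obtains P where "\<And>w. isobaric ws w (P w)"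
    "\<And>v. \<exists>r. (\<forall>t. poly r t = p (weighted_scale ws t v)) \<and> (\<forall>w. coeff r w = P w v)"
proof -
  let ?d = "length ws"
  obtain L where L: "\<And>v. p v = (\<Sum>(c, e)\<leftarrow>L. c * monomial ?d e v)"
    using polynomial_function_expansion[OF assms] by blast
  define P where "P w v = (\<Sum>(c, e)\<leftarrow>filter (\<lambda>(c, e). weight ws e = w) L. c * monomial ?d e v)" for w v
  define r where "r v = (\<Sum>(c, e)\<leftarrow>L. monom (c * monomial ?d e v) (weight ws e))" for v
  have "poly (r v) t = p (weighted_scale ws t v)" for v t
    unfolding L r_def
    by (induction L) (auto simp: poly_monom monomial_weighted_scale mult_ac)
  moreover have "coeff (r v) w = P w v" for v w
    unfolding P_def r_def by (induction L) auto
  moreover have "isobaric ws w (P w)" for w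
    unfolding isobaric_def P_def
    by (intro exI[of _ "filter (\<lambda>(c, e). weight ws e = w) L"]) auto
  ultimately show ?thesis using that[of P] by blast
qed

section \<open>Orbits and weight-zero Laurent monomials on one chart\<close>

lemma power_cong_mod:
  fixes x :: "'a :: monoid_mult"
  assumes "x ^ k = 1" "a mod k = b mod k"
  shows "x ^ a = x ^ b"
proof -
  have "x ^ a = x ^ (a mod k)" for a
  proof -
    have "x ^ a = x ^ (k * (a div k) + a mod k)" by simp
    also have "\<dots> = x ^ (a mod k)" unfolding power_add power_mult by (simp add: assms)
    finally show ?thesis .
  qed
  then show ?thesis using assms(2) by metis
qed

text \<open>With \<open>k = g * h\<close>, a variable of weight \<open>g * c\<close> multiplied by
  \<open>(h - 1) * c\<close> copies of a monomial of weight \<open>g\<close> has weight divisible by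
  \<open>k\<close>; this is the correction that makes single variables accessible to weight-zero
  monomials.\<close>

lemma nat_period_sum: "h > 0 \<Longrightarrow> g * c + (h - 1) * c * g = g * h * (c :: nat)"
  by (cases h) (simp_all add: algebra_simps)

text \<open>
  The weights of the monomials supported in \<open>S\<close> form a subgroup modulo \<open>ws ! i\<close>; \<open>e0\<close> has the
  weight of a generator \<open>g\<close>.
\<close>

lemma weight_generator:
  assumes i: "i \<in> S" "S \<subseteq> {..<length ws}" "ws ! i > 0"
  obtains g e0 where "g > 0" "\<And>j. j \<notin> S \<Longrightarrow> e0 j = 0" "weight ws e0 mod ws ! i = g mod ws ! i"
    "\<And>j. j \<in> S \<Longrightarrow> g dvd ws ! j"
proof -
  define k where "k = ws ! i"
  define Q where "Q g \<longleftrightarrow> g > 0 \<and> (\<exists>e. (\<forall>j. j \<notin> S \<longrightarrow> e j = 0) \<and> weight ws e mod k = g mod k)" for g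
  have "Q k" unfolding Q_def using i by (auto simp: k_def weight_def intro!: exI[of _ "\<lambda>_. 0"])
  define g where "g = (LEAST g. Q g)"
  have "Q g" unfolding g_def using \<open>Q k\<close> by (rule LeastI)
  then obtain e0 where e0: "g > 0" "\<forall>j. j \<notin> S \<longrightarrow> e0 j = 0" "weight ws e0 mod k = g mod k"
    unfolding Q_def by blast
  have min: "\<not> Q g'" if "g' < g" for g' using that unfolding g_def by (rule not_less_Least)
  have "g dvd ws ! j" if j: "j \<in> S" for j
  proof (rule ccontr)
    assume "\<not> g dvd ws ! j"
    then have pos: "ws ! j mod g > 0" by (simp add: dvd_eq_mod_eq_0)
    define c where "c = ws ! j div g"
    \<comment> \<open>Exponents cannot be negative, so \<open>(k - 1) * c\<close> stands for
      \<open>- c\<close> modulo \<open>k\<close>; the weight of \<open>e\<close> is then congruent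
      to the remainder of \<open>ws ! j\<close> by \<open>g\<close>, against minimality.\<close>
    define e where "e = (\<lambda>l. (if l = j then 1 else 0) + ((k - 1) * c) * e0 l)"
    have "weight ws e = ws ! j + (k - 1) * c * weight ws e0"
      unfolding e_def weight_add weight_mult using j i by (subst weight_single) auto
    also have "\<dots> mod k = (ws ! j + (k - 1) * c * g) mod k"
      using e0(3) by (metis mod_add_right_eq mod_mult_right_eq)
    also have "ws ! j + (k - 1) * c * g = ws ! j mod g + k * (c * g)"
    proof -
      have "k = Suc (k - 1)" using i by (simp add: k_def)
      then have "k * (c * g) = c * g + (k - 1) * c * g" by (metis mult.assoc mult_Suc)
      moreover have "ws ! j = ws ! j mod g + c * g" unfolding c_def by simp
      ultimately show ?thesis by linarith
    qed
    finally have "weight ws e mod k = (ws ! j mod g) mod k" by simp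
    moreover have "\<forall>l. l \<notin> S \<longrightarrow> e l = 0" using e0(2) j by (auto simp: e_def)
    ultimately have "Q (ws ! j mod g)" unfolding Q_def using pos by blast
    then show False using min e0(1) by simp
  qed
  then show thesis using that e0 unfolding k_def by blast
qed

locale weighted_chart =
  fixes ws :: "nat list" and i :: nat
  assumes positive: "\<And>j. j < length ws \<Longrightarrow> ws ! j > 0" and chart_index: "i < length ws"
begin

abbreviation "d \<equiv> length ws"
abbreviation "k \<equiv> ws ! i"

text \<open>A Laurent monomial of weight zero, provided that \<open>k\<close> divides the weight of
  \<open>e\<close>; for other \<open>e\<close> the exponent is rounded down and the function need
  not be invariant.\<close>

definition chart :: "(nat \<Rightarrow> nat) \<Rightarrow> complex vec \<Rightarrow> complex"
  where "chart e v = monomial d e v / v $ i ^ (weight ws e div k)"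

lemma k_pos: "k > 0" using positive chart_index by blast

lemma chart_add:
  assumes "k dvd weight ws e" "k dvd weight ws e'" "\<And>j. j < d \<Longrightarrow> e'' j = e j + e' j"
  shows "chart e'' v = chart e v * chart e' v"
proof -
  have "monomial d e'' v = monomial d e v * monomial d e' v"
    using assms(3) monomial_cong[of d e'' "\<lambda>j. e j + e' j"] by (simp add: monomial_add)
  moreover have "weight ws e'' div k = weight ws e div k + weight ws e' div k"
    using assms weight_cong[of ws e'' "\<lambda>j. e j + e' j"] by (simp add: weight_add)
  ultimately show ?thesis by (simp add: chart_def power_add)
qed

lemma chart_weighted_scale:
  assumes "k dvd weight ws e" "t \<noteq> 0"
  shows "chart e (weighted_scale ws t v) = chart e v"
proof -
  have "(t ^ k) ^ (weight ws e div k) = t ^ weight ws e" using assms(1) by (simp flip: power_mult)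
  then show ?thesis
    using assms(2) chart_index by (simp add: chart_def monomial_weighted_scale power_mult_distrib)
qed

text \<open>A root of order \<open>k\<close> of \<open>1 / v $ i\<close> scales \<open>v\<close>
  into the slice; it is determined only up to roots of unity of order \<open>k\<close>, the
  ambiguity that the separation of orbits has to resolve.\<close>

lemma scale_to_slice:
  assumes "v $ i \<noteq> 0"
  obtains t where "t \<noteq> 0" "weighted_scale ws t v $ i = 1"
proof -
  obtain t where t: "t ^ k = 1 / v $ i" using complex_nth_root_exists[OF k_pos] by blast
  have "t \<noteq> 0"
  proof
    assume "t = 0"
    then have "t ^ k = 0" using k_pos by simp
    then show False using t assms by simp
  qed
  moreover have "weighted_scale ws t v $ i = 1"
    using t assms chart_index by simp
  ultimately show thesis using that by blast
qed

lemma chart_slice: "v $ i = 1 \<Longrightarrow> chart e v = monomial d e v"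
  by (simp add: chart_def)

text \<open>In the slice the charts are the monomials of weight divisible by \<open>k\<close>. Two
  slice points on which these agree have the same support, and the values of the monomial
  \<open>e0\<close> at them differ by a root of unity of order dividing \<open>h = k / g\<close>. A
  \<open>g\<close>-th root \<open>\<eta>\<close> of this quotient scales one point so that
  \<open>e0\<close> agrees too, without disturbing the other monomials, and then every coordinate is
  determined.\<close>

lemma chart_determines_orbit:
  assumes v: "v \<in> carrier_vec d" "v' \<in> carrier_vec d" "v $ i \<noteq> 0" "v' $ i \<noteq> 0"
    and eq: "\<And>e. k dvd weight ws e \<Longrightarrow> chart e v = chart e v'"
  shows "\<exists>t. t \<noteq> 0 \<and> v = weighted_scale ws t v'"
proof -
  obtain s where s: "s \<noteq> 0" "weighted_scale ws s v $ i = 1" using scale_to_slice[OF v(3)] .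
  obtain s' where s': "s' \<noteq> 0" "weighted_scale ws s' v' $ i = 1" using scale_to_slice[OF v(4)] .
  define u where "u = weighted_scale ws s v"
  define u' where "u' = weighted_scale ws s' v'"
  have mon: "monomial d e u = monomial d e u'" if "k dvd weight ws e" for e
    using eq[OF that] chart_weighted_scale[OF that s(1), of v] chart_weighted_scale[OF that s'(1), of v'] s s'
    by (simp add: chart_slice u_def u'_def)
  define S where "S = {j. j < d \<and> u $ j \<noteq> 0}"
  \<comment> \<open>The \<open>k\<close>-th power of a variable has weight divisible by
    \<open>k\<close>, so vanishing of a coordinate is visible to the charts.\<close>
  have S': "u' $ j \<noteq> 0 \<longleftrightarrow> j \<in> S" if "j < d" for j
  proof -
    have "u $ j ^ k = u' $ j ^ k"
      using mon[of "\<lambda>l. if l = j then k else 0"] that by (simp add: weight_single monomial_single)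
    then have "u $ j = 0 \<longleftrightarrow> u' $ j = 0" using k_pos power_eq_0_iff[of "u $ j" k] power_eq_0_iff[of "u' $ j" k] by simp
    then show ?thesis using that by (simp add: S_def)
  qed
  have "i \<in> S" using s chart_index by (simp add: S_def u_def)
  moreover have "S \<subseteq> {..<d}" by (auto simp: S_def)
  ultimately obtain g e0 where g: "g > 0" "\<And>j. j \<notin> S \<Longrightarrow> e0 j = 0" "weight ws e0 mod k = g mod k"
    "\<And>j. j \<in> S \<Longrightarrow> g dvd ws ! j" using weight_generator k_pos by metis
  define h where "h = k div g"
  have k: "k = g * h" using g(4)[OF \<open>i \<in> S\<close>] by (simp add: h_def)
  have h: "h > 0" using k k_pos by (cases h) auto
  have dvd: "k dvd weight ws (\<lambda>l. (if l = j then 1 else 0) + (h - 1) * (ws ! j div g) * e0 l)" if "j \<in> S" for j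
  proof -
    let ?c = "ws ! j div g"
    have "weight ws (\<lambda>l. (if l = j then 1 else 0) + (h - 1) * ?c * e0 l) = ws ! j + (h - 1) * ?c * weight ws e0"
      unfolding weight_add weight_mult using that \<open>S \<subseteq> {..<d}\<close> by (subst weight_single) auto
    also have "\<dots> mod k = (ws ! j + (h - 1) * ?c * g) mod k"
      using g(3) by (metis mod_add_right_eq mod_mult_right_eq)
    also have "ws ! j + (h - 1) * ?c * g = k * ?c"
      using nat_period_sum[OF h, of g ?c] g(4)[OF that] unfolding k by simp
    finally show ?thesis by (simp add: dvd_eq_mod_eq_0)
  qed
  define Q where "Q = monomial d e0 u"
  define Q' where "Q' = monomial d e0 u'"
  have Q0: "Q \<noteq> 0" "Q' \<noteq> 0"
    using g(2) S' by (auto simp: Q_def Q'_def monomial_def S_def)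
  have "k dvd weight ws (\<lambda>j. h * e0 j)"
  proof -
    have "h * weight ws e0 mod k = h * g mod k" using g(3) by (metis mod_mult_right_eq)
    moreover have "h * g mod k = 0" unfolding k by simp
    ultimately show ?thesis by (simp add: weight_mult dvd_eq_mod_eq_0)
  qed
  from mon[OF this] have "Q ^ h = Q' ^ h" by (simp add: monomial_mult Q_def Q'_def)
  then have xi: "(Q / Q') ^ h = 1" using Q0 by (simp add: power_divide)
  obtain \<eta> where \<eta>: "\<eta> ^ g = Q / Q'" using complex_nth_root_exists[OF g(1)] by blast
  have etak: "\<eta> ^ k = 1" unfolding k power_mult \<eta> by (rule xi)
  have eta0: "\<eta> \<noteq> 0"
  proof
    assume "\<eta> = 0"
    then have "\<eta> ^ k = 0" using k_pos by simp
    then show False using etak by simp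
  qed
  define u'' where "u'' = weighted_scale ws \<eta> u'"
  \<comment> \<open>The weight of \<open>e0\<close> is congruent to \<open>g\<close> modulo
    \<open>k\<close> and \<open>\<eta> ^ k = 1\<close>, so scaling multiplies the value
    \<open>Q'\<close> by \<open>\<eta> ^ g = Q / Q'\<close>.\<close>
  have Qu'': "monomial d e0 u'' = Q"
    using power_cong_mod[OF etak g(3)] Q0 by (simp add: u''_def monomial_weighted_scale \<eta> Q'_def)
  have mon'': "monomial d e u'' = monomial d e u" if e: "k dvd weight ws e" for e
  proof -
    have "\<eta> ^ weight ws e = \<eta> ^ 0" by (rule power_cong_mod[OF etak]) (use e in simp)
    then show ?thesis using mon[OF e] by (simp add: u''_def monomial_weighted_scale)
  qed
  have "u $ j = u'' $ j" if j: "j < d" for j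
  proof (cases "j \<in> S")
    case True
    let ?c = "(h - 1) * (ws ! j div g)"
    \<comment> \<open>The weight of the variable \<open>j\<close> need not be divisible by
      \<open>k\<close>; after multiplication by this power of \<open>e0\<close> it is, and the power
      has the same nonzero value at both points.\<close>
    have "u'' $ j * Q ^ ?c = u $ j * Q ^ ?c"
      using mon''[OF dvd[OF True]] j Qu''
      by (simp add: monomial_add monomial_mult monomial_single Q_def del: One_nat_def)
    then show ?thesis using Q0 by simp
  next
    case False
    then have "u' $ j = 0" "u $ j = 0" using S'[OF j] j by (auto simp: S_def)
    then show ?thesis using j by (simp add: u''_def)
  qed
  then have "u = u''" by (intro eq_vecI) (auto simp: u_def u''_def)
  then have "weighted_scale ws s v = weighted_scale ws (\<eta> * s') v'"
    by (simp add: u_def u''_def u'_def weighted_scale_mult)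
  then have "weighted_scale ws (inverse s) (weighted_scale ws s v) =
      weighted_scale ws (inverse s) (weighted_scale ws (\<eta> * s') v')" by simp
  then have "v = weighted_scale ws (inverse s * (\<eta> * s')) v'"
    using s(1) v(1) by (simp add: weighted_scale_mult weighted_scale_one)
  then show ?thesis using s(1) s'(1) eta0 by (intro exI[of _ "inverse s * (\<eta> * s')"]) simp
qed

text \<open>
  \<open>Q\<close> is chosen as the value of the monomial \<open>e0\<close>; the \<open>j\<close>-th coordinate is then determined by
  \<open>\<zeta> (x j)\<close>, because \<open>x j\<close> is the \<open>j\<close>-th variable times a power of \<open>e0\<close> and has weight divisible by \<open>k\<close>.
\<close>

lemma multiplicative_is_evaluation:
  fixes \<zeta> :: "(nat \<Rightarrow> nat) \<Rightarrow> complex"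
  assumes mult: "\<And>e e' e''. k dvd weight ws e \<Longrightarrow> k dvd weight ws e' \<Longrightarrow>
      (\<And>j. j < d \<Longrightarrow> e'' j = e j + e' j) \<Longrightarrow> \<zeta> e'' = \<zeta> e * \<zeta> e'"
    and zero: "\<zeta> (\<lambda>_. 0) = 1" and one: "\<zeta> (\<lambda>j. if j = i then 1 else 0) = 1"
  shows "\<exists>v\<in>carrier_vec d. v $ i = 1 \<and> (\<forall>e. k dvd weight ws e \<longrightarrow> monomial d e v = \<zeta> e)"
proof -
  have cong: "\<zeta> e' = \<zeta> e" if "\<And>j. j < d \<Longrightarrow> e' j = e j" "k dvd weight ws e" for e e'
    using mult[of e "\<lambda>_. 0" e'] that zero by (simp add: weight_def)
  have pow: "\<zeta> (\<lambda>j. c * e j) = \<zeta> e ^ c" if "k dvd weight ws e" for c e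
  proof (induction c)
    case (Suc c)
    have "\<zeta> (\<lambda>j. Suc c * e j) = \<zeta> e * \<zeta> (\<lambda>j. c * e j)"
      by (rule mult) (use that in \<open>auto simp: weight_mult\<close>)
    then show ?case using Suc by simp
  qed (simp add: zero)
  have prod: "\<zeta> (\<lambda>j. \<Sum>l\<in>A. a l * x l j) = (\<Prod>l\<in>A. \<zeta> (x l) ^ a l)"
    if "finite A" "\<forall>l\<in>A. k dvd weight ws (x l)" for A a and x :: "nat \<Rightarrow> nat \<Rightarrow> nat"
    using that
  proof (induction A)
    case (insert y A)
    have "\<zeta> (\<lambda>j. \<Sum>l\<in>insert y A. a l * x l j) = \<zeta> (\<lambda>j. a y * x y j) * \<zeta> (\<lambda>j. \<Sum>l\<in>A. a l * x l j)"
    proof (rule mult)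
      show "k dvd weight ws (\<lambda>j. \<Sum>l\<in>A. a l * x l j)"
        unfolding weight_sum weight_mult using insert.prems by (intro dvd_sum dvd_mult) blast
      show "k dvd weight ws (\<lambda>j. a y * x y j)"
        unfolding weight_mult using insert.prems by simp
    qed (use insert.hyps in simp)
    moreover have "\<zeta> (\<lambda>j. a y * x y j) = \<zeta> (x y) ^ a y" using insert.prems by (intro pow) simp
    moreover have "\<zeta> (\<lambda>j. \<Sum>l\<in>A. a l * x l j) = (\<Prod>l\<in>A. \<zeta> (x l) ^ a l)"
      using insert.prems by (intro insert.IH) simp
    ultimately show ?case unfolding prod.insert[OF insert.hyps(1,2)] by (simp only:)
  qed (simp add: zero)
  define \<delta> where "\<delta> j c = (\<lambda>l. if l = j then c else 0 :: nat)" for j c :: nat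
  have wd: "weight ws (\<delta> j c) = ws ! j * c" if "j < d" for j c
    using that by (simp add: \<delta>_def weight_single)
  \<comment> \<open>The support of the point to be found, read off from \<open>k\<close>-th powers
    because a variable itself need not have weight divisible by \<open>k\<close>.\<close>
  define S where "S = {j. j < d \<and> \<zeta> (\<delta> j k) \<noteq> 0}"
  have "i \<in> S"
  proof -
    have "\<delta> i k = (\<lambda>j. k * (if j = i then 1 else 0))" by (auto simp: \<delta>_def)
    then have "\<zeta> (\<delta> i k) = 1" using pow[of "\<lambda>j. if j = i then 1 else 0" k] one chart_index
      by (simp add: weight_single)
    then show ?thesis using chart_index by (simp add: S_def)
  qed
  have S: "S \<subseteq> {..<d}" by (auto simp: S_def)
  obtain g e0 where g: "g > 0" "\<And>j. j \<notin> S \<Longrightarrow> e0 j = 0" "weight ws e0 mod k = g mod k"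
    "\<And>j. j \<in> S \<Longrightarrow> g dvd ws ! j" using weight_generator[OF \<open>i \<in> S\<close> S k_pos] by metis
  define h where "h = k div g"
  have k: "k = g * h" using g(4)[OF \<open>i \<in> S\<close>] by (simp add: h_def)
  have h: "h > 0" using k k_pos by (cases h) auto
  define c where "c j = ws ! j div g" for j
  have c: "ws ! j = g * c j" if "j \<in> S" for j using g(4)[OF that] by (simp add: c_def)
  define x where "x j = (\<lambda>l. \<delta> j 1 l + (h - 1) * c j * e0 l)" for j
  have dvd: "k dvd weight ws (x j)" if "j \<in> S" for j
  proof -
    have "weight ws (x j) = ws ! j + (h - 1) * c j * weight ws e0"
      unfolding x_def weight_add weight_mult using that S by (subst wd) auto
    also have "\<dots> mod k = (ws ! j + (h - 1) * c j * g) mod k"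
      using g(3) by (metis mod_add_right_eq mod_mult_right_eq)
    also have "ws ! j + (h - 1) * c j * g = k * c j"
      using nat_period_sum[OF h, of g "c j"] unfolding k c[OF that] .
    finally show ?thesis by (simp add: dvd_eq_mod_eq_0)
  qed
  have dvd0: "k dvd weight ws (\<lambda>j. h * e0 j)"
  proof -
    have "h * weight ws e0 mod k = h * g mod k" using g(3) by (metis mod_mult_right_eq)
    moreover have "h * g mod k = 0" unfolding k by simp
    ultimately show ?thesis by (simp add: weight_mult dvd_eq_mod_eq_0)
  qed
  \<comment> \<open>A further \<open>k\<close>-th power turns this monomial into a product of
    \<open>k\<close>-th powers of variables in \<open>S\<close>, on each of which
    \<open>\<zeta>\<close> is nonzero.\<close>
  have zn: "\<zeta> (\<lambda>j. h * e0 j) \<noteq> 0"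
  proof -
    have "\<zeta> (\<lambda>j. h * e0 j) ^ k = \<zeta> (\<lambda>j. k * (h * e0 j))" using pow[OF dvd0] by simp
    also have "\<dots> = \<zeta> (\<lambda>j. \<Sum>l\<in>S. h * e0 l * \<delta> l k j)"
    proof (rule cong)
      fix j assume "j < d"
      have "(\<Sum>l\<in>S. h * e0 l * \<delta> l k j) = (\<Sum>l\<in>S. if l = j then k * (h * e0 j) else 0)"
        by (intro sum.cong) (auto simp: \<delta>_def)
      then show "k * (h * e0 j) = (\<Sum>l\<in>S. h * e0 l * \<delta> l k j)"
        using g(2)[of j] finite_subset[OF S] by (simp add: sum.delta)
    next
      show "k dvd weight ws (\<lambda>j. \<Sum>l\<in>S. h * e0 l * \<delta> l k j)"
        unfolding weight_sum weight_mult using S by (intro dvd_sum dvd_mult) (simp add: wd subset_iff)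
    qed
    also have "\<dots> = (\<Prod>l\<in>S. \<zeta> (\<delta> l k) ^ (h * e0 l))"
      using S by (intro prod finite_subset[OF S]) (simp_all add: wd subset_iff)
    also have "\<dots> \<noteq> 0" using finite_subset[OF S] by (auto simp: S_def)
    finally show ?thesis using k_pos by auto
  qed
  obtain Q where Q: "Q ^ h = \<zeta> (\<lambda>j. h * e0 j)" using complex_nth_root_exists[OF h] by blast
  have Q0: "Q \<noteq> 0"
  proof
    assume "Q = 0"
    then have "Q ^ h = 0" using h by simp
    then show False using Q zn by simp
  qed
  define v where "v = vec d (\<lambda>j. if j \<in> S then \<zeta> (x j) / Q ^ ((h - 1) * c j) else 0)"
  have main: "monomial d e v = \<zeta> e" if e: "k dvd weight ws e" for e
  proof (cases "\<forall>j<d. e j \<noteq> 0 \<longrightarrow> j \<in> S")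
    case False
    then obtain j where j: "j < d" "e j \<noteq> 0" "j \<notin> S" by blast
    then have "v $ j ^ e j = 0" by (simp add: v_def)
    then have "monomial d e v = 0" unfolding monomial_def using j(1) by (intro prod_zero) blast+
    \<comment> \<open>Raising to the power \<open>k\<close> makes room for the factor
      \<open>\<delta> j k\<close>, which \<open>\<zeta>\<close> sends to zero.\<close>
    moreover have "\<zeta> e ^ k = \<zeta> (\<lambda>l. k * e l)" using pow[OF e] by simp
    moreover have "\<zeta> (\<lambda>l. k * e l) = \<zeta> (\<delta> j k) * \<zeta> (\<lambda>l. k * (e l - \<delta> j 1 l))"
    proof (rule mult)
      show "k * e l = \<delta> j k l + k * (e l - \<delta> j 1 l)" for l
        using j(2) by (auto simp: \<delta>_def diff_mult_distrib2)
    qed (use j in \<open>auto simp: wd weight_mult\<close>)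
    moreover have "\<zeta> (\<delta> j k) = 0" using j by (auto simp: S_def)
    ultimately have "\<zeta> e ^ k = 0" by simp
    then have "\<zeta> e = 0" by simp
    with \<open>monomial d e v = 0\<close> show ?thesis by simp
  next
    case True
    define C where "C = (\<Sum>j\<in>S. c j * e j)"
    have sumS: "(\<Sum>j<d. f j * e j) = (\<Sum>j\<in>S. f j * e j)" for f :: "nat \<Rightarrow> nat"
      using S True by (intro sum.mono_neutral_right) auto
    have "weight ws e = g * C"
      unfolding weight_def C_def sumS sum_distrib_left using c by (intro sum.cong) (auto simp: mult_ac)
    \<comment> \<open>This divisibility makes the surplus power of \<open>e0\<close>, with exponent
      \<open>(h - 1) * C\<close>, a power of \<open>h * e0\<close>, whose value under
      \<open>\<zeta>\<close> is \<open>Q ^ h\<close>.\<close>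
    then have "h dvd C" using e k g(1) by simp
    then obtain q where q: "C = h * q" by blast
    have "monomial d e v = (\<Prod>j\<in>S. (v $ j) ^ e j)"
      unfolding monomial_def using S True by (intro prod.mono_neutral_right) auto
    also have "\<dots> = (\<Prod>j\<in>S. \<zeta> (x j) ^ e j / Q ^ ((h - 1) * (c j * e j)))"
      using S by (intro prod.cong) (auto simp: v_def power_divide mult.assoc simp flip: power_mult)
    also have "\<dots> = (\<Prod>j\<in>S. \<zeta> (x j) ^ e j) / Q ^ ((h - 1) * C)"
      by (simp add: prod_dividef C_def sum_distrib_left power_sum)
    also have "(\<Prod>j\<in>S. \<zeta> (x j) ^ e j) = \<zeta> (\<lambda>l. \<Sum>j\<in>S. e j * x j l)"
      using dvd by (intro prod[symmetric] finite_subset[OF S]) simp_all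
    also have "\<dots> = \<zeta> e * \<zeta> (\<lambda>l. ((h - 1) * q) * (h * e0 l))"
    proof (rule mult)
      fix l assume l: "l < d"
      have "(\<Sum>j\<in>S. e j * x j l) = (\<Sum>j\<in>S. (if j = l then e j else 0) + (h - 1) * e0 l * (c j * e j))"
        by (intro sum.cong) (auto simp: x_def \<delta>_def algebra_simps)
      also have "\<dots> = e l + (h - 1) * e0 l * C"
        using True l finite_subset[OF S] by (auto simp: sum.distrib sum_distrib_left C_def sum.delta)
      finally show "(\<Sum>j\<in>S. e j * x j l) = e l + ((h - 1) * q) * (h * e0 l)" by (simp add: q mult_ac)
    next
      show "k dvd weight ws (\<lambda>l. (h - 1) * q * (h * e0 l))" using dvd0 unfolding weight_mult[of _ "(h - 1) * q"] by simp
    qed (rule e)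
    also have "\<zeta> (\<lambda>l. ((h - 1) * q) * (h * e0 l)) = Q ^ ((h - 1) * C)"
      unfolding pow[OF dvd0, of "(h - 1) * q"] Q[symmetric] q by (simp add: mult_ac flip: power_mult)
    finally show ?thesis using Q0 by simp
  qed
  have "v $ i = monomial d (\<lambda>j. if j = i then 1 else 0) v"
    using chart_index by (simp add: monomial_single del: One_nat_def)
  also have "\<dots> = 1" using main[of "\<lambda>j. if j = i then 1 else 0"] one chart_index by (simp add: weight_single del: One_nat_def)
  finally have "v $ i = 1" .
  moreover have "v \<in> carrier_vec d" by (simp add: v_def)
  ultimately show ?thesis using main by blast
qed

end

section \<open>The punctured space and its closed orbits\<close>

definition punctured_space :: "nat \<Rightarrow> complex vec fspace"
  where "punctured_space m = induced_on (affine_space m) (carrier_vec m - {0\<^sub>v m})"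

definition weighted_orbit :: "nat list \<Rightarrow> complex vec \<Rightarrow> complex vec set"
  where "weighted_orbit ws v = {weighted_scale ws t v | t. t \<noteq> 0}"

lemma weighted_projective_space_eq:
  "weighted_projective_space ws = quotient_space (punctured_space (length ws)) (weighted_orbit ws)"
  by (simp add: weighted_projective_space_def Let_def punctured_space_def weighted_orbit_def[abs_def]
    weighted_scale_def)

lemma points_affine_space [simp]: "points (affine_space m) = carrier_vec m"
  by (simp add: affine_space_def points_coordinate_space)

lemma points_punctured_space [simp]: "points (punctured_space m) = carrier_vec m - {0\<^sub>v m}"
  by (auto simp: punctured_space_def)

lemma function_space_affine_space: "function_space (affine_space m)"
  unfolding affine_space_def by (rule function_space_coordinate_space)

lemma function_space_punctured_space: "function_space (punctured_space m)"
  unfolding punctured_space_def by (intro function_space_induced_on function_space_affine_space)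

lemma function_space_weighted_projective_space: "function_space (weighted_projective_space ws)"
  unfolding weighted_projective_space_eq
  by (intro function_space_quotient_space function_space_punctured_space)

lemma openin_punctured_space:
  "openin (zar (punctured_space m)) U \<longleftrightarrow> U \<subseteq> carrier_vec m - {0\<^sub>v m} \<and>
    (\<forall>x\<in>U. \<exists>p\<in>polynomials m. p x \<noteq> 0 \<and>
      (\<forall>y\<in>carrier_vec m - {0\<^sub>v m}. p y \<noteq> 0 \<longrightarrow> y \<in> U))"
    (is "?L \<longleftrightarrow> ?R")
proof
  assume ?L
  then obtain W where W: "openin (zar (affine_space m)) W" "U = W \<inter> (carrier_vec m - {0\<^sub>v m})"
    by (auto simp: punctured_space_def openin_subtopology)
  show ?R
  proof (intro conjI ballI)
    fix x assume "x \<in> U"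
    with W obtain p where "p \<in> polynomials m" "p x \<noteq> 0"
      "\<forall>y\<in>carrier_vec m. p y \<noteq> 0 \<longrightarrow> y \<in> W"
      unfolding affine_space_def openin_coordinate_space by blast
    then show "\<exists>p\<in>polynomials m. p x \<noteq> 0 \<and>
      (\<forall>y\<in>carrier_vec m - {0\<^sub>v m}. p y \<noteq> 0 \<longrightarrow> y \<in> U)"
      using W by (intro bexI[of _ p]) auto
  qed (use W in auto)
next
  assume R: ?R
  show ?L
  proof (subst openin_subopen, intro ballI)
    fix x assume x: "x \<in> U"
    with R obtain p where p: "p \<in> polynomials m" "p x \<noteq> 0"
      "\<forall>y\<in>carrier_vec m - {0\<^sub>v m}. p y \<noteq> 0 \<longrightarrow> y \<in> U" by blast
    have "openin (zar (affine_space m)) {y \<in> carrier_vec m. p y \<noteq> 0}"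
      unfolding affine_space_def openin_coordinate_space using p by blast
    then have "openin (zar (punctured_space m)) ({y \<in> carrier_vec m. p y \<noteq> 0} \<inter> (carrier_vec m - {0\<^sub>v m}))"
      unfolding punctured_space_def by (auto simp: openin_subtopology)
    then show "\<exists>T. openin (zar (punctured_space m)) T \<and> x \<in> T \<and> T \<subseteq> U"
      using p x R
      by (intro exI[of _ "{y \<in> carrier_vec m. p y \<noteq> 0} \<inter> (carrier_vec m - {0\<^sub>v m})"]) auto
  qed
qed

lemma polynomial_reg_affine_space:
  assumes "p \<in> polynomials m" "openin (zar (affine_space m)) U"
  shows "p \<in> reg (affine_space m) U"
  using assms unfolding affine_space_def by (intro polynomial_functions_reg)

lemma polynomial_reg_induced_on_affine_space:
  assumes "p \<in> polynomials m" "U \<subseteq> carrier_vec m"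
  shows "p \<in> reg (induced_on (affine_space m) Z) U"
proof (rule reg_induced_onI)
  have "openin (zar (affine_space m)) (points (affine_space m))" by (rule openin_topspace)
  then show "openin (zar (affine_space m)) (carrier_vec m)" by simp
  then show "p \<in> reg (affine_space m) (carrier_vec m)" by (rule polynomial_reg_affine_space[OF assms(1)])
qed (rule assms(2))

lemma polynomial_reg_punctured_space:
  assumes "p \<in> polynomials m" "openin (zar (punctured_space m)) U"
  shows "p \<in> reg (punctured_space m) U"
  unfolding punctured_space_def
  using assms openin_subset[OF assms(2)] by (intro polynomial_reg_induced_on_affine_space) auto

lemma morphism_to_affine_space:
  assumes "function_space X" "\<And>x. x \<in> points X \<Longrightarrow> \<phi> x \<in> carrier_vec m"
    and "\<And>i. i < m \<Longrightarrow> (\<lambda>x. \<phi> x $ i) \<in> reg X (points X)"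
  shows "morphism X (affine_space m) \<phi>"
  unfolding affine_space_def
  using assms by (intro morphism_to_coordinate_space) auto

lemma reg_punctured_spaceE:
  assumes "f \<in> reg (punctured_space m) U" "x \<in> U"
  obtains r p q where "r \<in> polynomials m" "p \<in> polynomials m"
    "q \<in> polynomials m" "r x \<noteq> 0"
    "\<And>y. y \<in> U \<Longrightarrow> y \<in> carrier_vec m \<Longrightarrow> r y \<noteq> 0 \<Longrightarrow> q y \<noteq> 0 \<and> f y = p y / q y"
proof -
  from assms obtain V g where V: "x \<in> V" "g \<in> reg (affine_space m) V" "\<forall>y\<in>V \<inter> U. f y = g y"
    unfolding punctured_space_def reg_induced_on by blast
  from V(2,1)[unfolded affine_space_def] obtain r p q where *: "r \<in> polynomials m"
    "p \<in> polynomials m" "q \<in> polynomials m" "r x \<noteq> 0"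
    "\<And>y. y \<in> carrier_vec m \<Longrightarrow> r y \<noteq> 0 \<Longrightarrow> y \<in> V \<and> q y \<noteq> 0 \<and> g y = p y / q y"
    by (rule reg_coordinate_spaceE) (rule that)
  show thesis
    by (rule that[OF *(1-4)]) (use *(5) V(3) in auto)
qed

lemma weighted_orbit_self: "v \<in> carrier_vec (length ws) \<Longrightarrow> v \<in> weighted_orbit ws v"
  unfolding weighted_orbit_def by (intro CollectI exI[of _ 1]) (simp add: weighted_scale_one)

lemma weighted_orbit_scale:
  assumes "t \<noteq> 0"
  shows "weighted_orbit ws (weighted_scale ws t v) = weighted_orbit ws v"
proof
  show "weighted_orbit ws (weighted_scale ws t v) \<subseteq> weighted_orbit ws v"
    using assms by (force simp: weighted_orbit_def weighted_scale_mult)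
  show "weighted_orbit ws v \<subseteq> weighted_orbit ws (weighted_scale ws t v)"
  proof
    fix x assume "x \<in> weighted_orbit ws v"
    then obtain s where s: "s \<noteq> 0" "x = weighted_scale ws s v" by (auto simp: weighted_orbit_def)
    then have "x = weighted_scale ws (s / t) (weighted_scale ws t v)"
      using assms by (simp add: weighted_scale_mult)
    moreover have "s / t \<noteq> 0" using s assms by simp
    ultimately show "x \<in> weighted_orbit ws (weighted_scale ws t v)" unfolding weighted_orbit_def by blast
  qed
qed

lemma weighted_orbit_eq_iff:
  assumes "v \<in> carrier_vec (length ws)"
  shows "weighted_orbit ws v = weighted_orbit ws v' \<longleftrightarrow> (\<exists>t. t \<noteq> 0 \<and> v = weighted_scale ws t v')"
proof
  assume "weighted_orbit ws v = weighted_orbit ws v'"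
  then have "v \<in> weighted_orbit ws v'" using weighted_orbit_self[OF assms] by simp
  then show "\<exists>t. t \<noteq> 0 \<and> v = weighted_scale ws t v'" by (auto simp: weighted_orbit_def)
qed (auto simp: weighted_orbit_scale)

lemma weighted_stabilizer_finite:
  assumes "\<And>j. j < length ws \<Longrightarrow> ws ! j > 0" "v \<in> carrier_vec (length ws)" "v \<noteq> 0\<^sub>v (length ws)"
  shows "finite {t. weighted_scale ws t v = v}"
proof -
  obtain j where j: "j < length ws" "v $ j \<noteq> 0" using assms(2,3) by (auto simp: vec_eq_iff)
  have "t ^ (ws ! j) = 1" if "weighted_scale ws t v = v" for t
  proof -
    have "t ^ (ws ! j) * v $ j = v $ j" using that j index_weighted_scale by metis
    then show ?thesis using j by simp
  qed
  then have "{t. weighted_scale ws t v = v} \<subseteq> {t. t ^ (ws ! j) = 1}" by blast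
  moreover have "finite {t::complex. t ^ (ws ! j) = 1}" using assms(1)[OF j(1)] by (intro finite_nth_roots) simp
  ultimately show ?thesis by (rule finite_subset)
qed

text \<open>Off the chart, a coordinate \<open>j\<close> nonzero at \<open>v'\<close> and the chart
  coordinate are brought to the common weight \<open>k * ws ! j\<close>; the resulting binomial
  vanishes on the orbit and has only one nonzero term at \<open>v'\<close>. On the chart, a Laurent
  monomial separates the two points and is cleared of denominators.\<close>

lemma (in weighted_chart) orbit_separation:
  assumes v: "v \<in> carrier_vec d" "v $ i \<noteq> 0" and v': "v' \<in> carrier_vec d" "v' \<noteq> 0\<^sub>v d" "v' \<notin> weighted_orbit ws v"
  shows "\<exists>p\<in>polynomials d. p v' \<noteq> 0 \<and> (\<forall>x\<in>weighted_orbit ws v. p x = 0)"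
proof (cases "v' $ i = 0")
  case True
  obtain j where j: "j < d" "v' $ j \<noteq> 0" using v' by (auto simp: vec_eq_iff)
  have co: "(\<lambda>x. x $ l) \<in> polynomials d" if "l < d" for l
    using that by (intro polynomial_functions.coord) auto
  let ?p = "\<lambda>x. x $ j ^ k * v $ i ^ (ws ! j) - v $ j ^ k * x $ i ^ (ws ! j)"
  have "?p \<in> polynomials d"
    by (intro polynomial_functions_diff polynomial_functions.mult polynomial_functions_power
      polynomial_functions.const co j chart_index)
  moreover have "?p v' \<noteq> 0" using positive[OF j(1)] j True v by (simp add: zero_power)
  moreover have "?p x = 0" if x: "x \<in> weighted_orbit ws v" for x
  proof -
    obtain t where t: "x = weighted_scale ws t v" using x unfolding weighted_orbit_def by blast
    have "x $ j ^ k = (t ^ (ws ! j)) ^ k * v $ j ^ k" "x $ i ^ (ws ! j) = (t ^ k) ^ (ws ! j) * v $ i ^ (ws ! j)"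
      unfolding t using j chart_index by (simp_all add: power_mult_distrib)
    moreover have "(t ^ k) ^ (ws ! j) = (t ^ (ws ! j)) ^ k" by (metis power_mult mult.commute)
    ultimately show ?thesis by simp
  qed
  ultimately show ?thesis by (intro bexI[of _ ?p]) auto
next
  case False
  have "\<not> (\<exists>t. t \<noteq> 0 \<and> v' = weighted_scale ws t v)" using v' by (auto simp: weighted_orbit_def)
  then obtain e where e: "k dvd weight ws e" "chart e v' \<noteq> chart e v"
    using chart_determines_orbit[OF v'(1) v(1) False v(2)] by blast
  let ?q = "weight ws e div k"
  let ?p = "\<lambda>x. monomial d e x * v $ i ^ ?q - monomial d e v * x $ i ^ ?q"
  have co: "(\<lambda>x. x $ i) \<in> polynomials d"
    using chart_index by (intro polynomial_functions.coord) auto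
  have "?p \<in> polynomials d"
    by (intro polynomial_functions_diff polynomial_functions.mult polynomial_functions_power
      polynomial_functions.const co monomial_in_polynomial_functions)
  moreover have "?p v' \<noteq> 0" using e(2) v False by (simp add: chart_def field_simps)
  moreover have "?p x = 0" if x: "x \<in> weighted_orbit ws v" for x
  proof -
    obtain t where t: "t \<noteq> 0" "x = weighted_scale ws t v" using x unfolding weighted_orbit_def by blast
    have "chart e x = chart e v" unfolding t by (rule chart_weighted_scale[OF e(1) t(1)])
    moreover have "x $ i \<noteq> 0" using t v chart_index by simp
    ultimately show ?thesis using v by (simp add: chart_def field_simps)
  qed
  ultimately show ?thesis by (intro bexI[of _ ?p]) auto
qed

text \<open>The complement is covered by nonvanishing loci of separating polynomials. The origin has
  to be removed from the ambient space, since with positive weights it is a limit of every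
  orbit.\<close>

lemma weighted_orbit_closed:
  assumes "\<And>j. j < length ws \<Longrightarrow> ws ! j > 0" "v \<in> points (punctured_space (length ws))"
  shows "closedin (zar (punctured_space (length ws))) (weighted_orbit ws v)"
proof -
  obtain i where i: "i < length ws" "v $ i \<noteq> 0" using assms(2) by (auto simp: vec_eq_iff)
  interpret weighted_chart ws i by unfold_locales (use assms(1) i in auto)
  have sub: "weighted_orbit ws v \<subseteq> points (punctured_space d)"
    using assms(2) by (auto simp: weighted_orbit_def weighted_scale_eq_zero_iff)
  have "\<exists>p\<in>polynomials d. p x \<noteq> 0 \<and>
      (\<forall>y\<in>carrier_vec d - {0\<^sub>v d}. p y \<noteq> 0 \<longrightarrow> y \<in> points (punctured_space d) - weighted_orbit ws v)"
    if x: "x \<in> points (punctured_space d) - weighted_orbit ws v" for x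
  proof -
    obtain p where "p \<in> polynomials d" "p x \<noteq> 0" "\<forall>x\<in>weighted_orbit ws v. p x = 0"
      using orbit_separation[of v x] assms(2) x i(2) unfolding points_punctured_space by blast
    then show ?thesis by (intro bexI[of _ p]) auto
  qed
  then have "openin (zar (punctured_space d)) (points (punctured_space d) - weighted_orbit ws v)"
    unfolding openin_punctured_space by auto
  then show ?thesis using sub by (simp add: closedin_def)
qed

section \<open>Generators and relations of the invariants on a chart\<close>

locale weighted_chart_generators = weighted_chart +
  fixes m :: nat and \<epsilon> :: "nat \<Rightarrow> nat \<Rightarrow> nat"
  assumes generators: "\<epsilon> ` {..<m} = {e. (\<forall>j. j < d \<longrightarrow> e j \<le> k) \<and> (\<forall>j. j \<ge> d \<longrightarrow> e j = 0) \<and> k dvd weight ws e}"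
begin

definition invariants :: "complex vec \<Rightarrow> complex vec"
  where "invariants v = vec m (\<lambda>l. chart (\<epsilon> l) v)"

lemma dvd_weight_generator: "l < m \<Longrightarrow> k dvd weight ws (\<epsilon> l)"
  using generators by blast

text \<open>An exponent above \<open>k\<close> splits off the \<open>k\<close>-th power of its
  variable, which is itself among the generators, so induction on the degree reduces to exponents
  bounded by \<open>k\<close>.\<close>

lemma chart_by_generators:
  "k dvd weight ws e \<Longrightarrow>
    \<exists>P\<in>polynomials m. \<forall>v. v $ i \<noteq> 0 \<longrightarrow> P (invariants v) = chart e v"
proof (induction "\<Sum>j<d. e j" arbitrary: e rule: less_induct)
  case less
  have small: "\<exists>P\<in>polynomials m. \<forall>v. v $ i \<noteq> 0 \<longrightarrow> P (invariants v) = chart e v"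
    if e: "k dvd weight ws e" "\<forall>j<d. e j \<le> k" for e
  proof -
    \<comment> \<open>Generators vanish beyond \<open>d\<close>, which keeps their number finite;
      the truncation changes neither weight nor monomial.\<close>
    define e' where "e' = (\<lambda>j. if j < d then e j else 0)"
    have w: "weight ws e' = weight ws e" by (rule weight_cong) (simp add: e'_def)
    then have "e' \<in> \<epsilon> ` {..<m}" unfolding generators using e by (auto simp: e'_def)
    then obtain l where l: "l < m" "e' = \<epsilon> l" by blast
    have "chart e v = chart e' v" for v
      using monomial_cong[of d e e' v] w by (simp add: chart_def e'_def)
    moreover have "(\<lambda>z. z $ l) \<in> polynomials m"
      using l by (intro polynomial_functions.coord) auto
    ultimately show ?thesis using l by (intro bexI[of _ "\<lambda>z. z $ l"]) (auto simp: invariants_def)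
  qed
  show ?case
  proof (cases "\<forall>j<d. e j \<le> k")
    case True
    then show ?thesis using small less.prems by blast
  next
    case False
    then obtain j where j: "j < d" "e j > k" by (auto simp: not_le)
    define e' where "e' = (\<lambda>l. if l = j then e j - k else e l)"
    define \<delta> where "\<delta> = (\<lambda>l. if l = j then k else 0)"
    have e: "e = (\<lambda>l. e' l + \<delta> l)" using j by (auto simp: e'_def \<delta>_def)
    have w\<delta>: "weight ws \<delta> = ws ! j * k" using j by (simp add: \<delta>_def weight_single)
    have "weight ws e = weight ws e' + ws ! j * k" by (subst e) (simp add: weight_add w\<delta>)
    then have dvd: "k dvd weight ws e'" using less.prems by (metis dvd_add_left_iff dvd_triv_right)
    have "(\<Sum>l<d. e' l) < (\<Sum>l<d. e l)"
      using j k_pos by (intro sum_strict_mono_ex1) (auto simp: e'_def intro!: bexI[of _ j])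
    from less.hyps[OF this dvd] obtain P where P: "P \<in> polynomials m"
      "\<forall>v. v $ i \<noteq> 0 \<longrightarrow> P (invariants v) = chart e' v" by blast
    obtain P' where P': "P' \<in> polynomials m"
      "\<forall>v. v $ i \<noteq> 0 \<longrightarrow> P' (invariants v) = chart \<delta> v"
    proof -
      have "k dvd weight ws \<delta>" "\<forall>j<d. \<delta> j \<le> k" by (simp_all add: w\<delta>, simp add: \<delta>_def)
      from small[OF this] show ?thesis using that by blast
    qed
    have "chart e v = chart e' v * chart \<delta> v" for v
      by (rule chart_add) (use dvd w\<delta> e in \<open>auto simp: fun_eq_iff\<close>)
    then show ?thesis using P P'
      by (intro bexI[of _ "\<lambda>z. P z * P' z"]) (auto simp: polynomial_functions.mult)
  qed
qed

text \<open>Each monomial of weight \<open>k * w\<close>, divided by the \<open>w\<close>-th power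
  of the chart coordinate, is exactly its own \<open>chart\<close>.\<close>

lemma isobaric_by_generators:
  assumes "isobaric ws (k * w) p"
  shows "\<exists>P\<in>polynomials m. \<forall>v. v $ i \<noteq> 0 \<longrightarrow> P (invariants v) = p v / v $ i ^ w"
proof -
  obtain L where L: "\<forall>(c, e)\<in>set L. weight ws e = k * w" "p = (\<lambda>v. \<Sum>(c, e)\<leftarrow>L. c * monomial d e v)"
    using assms unfolding isobaric_def by blast
  have "\<exists>P\<in>polynomials m.
      \<forall>v. v $ i \<noteq> 0 \<longrightarrow> P (invariants v) = (\<Sum>(c, e)\<leftarrow>L. c * monomial d e v) / v $ i ^ w"
    using L(1)
  proof (induction L)
    case Nil
    show ?case by (intro bexI[of _ "\<lambda>_. 0"]) (auto simp: polynomial_functions.const)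
  next
    case (Cons x L)
    obtain c e where x: "x = (c, e)" by force
    obtain P where P: "P \<in> polynomials m"
      "\<forall>v. v $ i \<noteq> 0 \<longrightarrow> P (invariants v) = (\<Sum>(c, e)\<leftarrow>L. c * monomial d e v) / v $ i ^ w"
      using Cons by auto
    have w: "weight ws e = k * w" using Cons.prems x by simp
    then obtain P' where P': "P' \<in> polynomials m"
      "\<forall>v. v $ i \<noteq> 0 \<longrightarrow> P' (invariants v) = chart e v"
      using chart_by_generators[of e] by auto
    have "chart e v = monomial d e v / v $ i ^ w" for v using w k_pos by (simp add: chart_def)
    then show ?case using P P'
      by (intro bexI[of _ "\<lambda>z. c * P' z + P z"])
        (simp_all add: x polynomial_functions.add polynomial_functions.mult polynomial_functions.const add_divide_distrib)
  qed
  then show ?thesis using L(2) by simp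
qed

text \<open>The Zariski closure of the image of the chart, given by all relations at once so that no
  finite set of equations has to be found.\<close>

definition relations_locus :: "complex vec set"
  where "relations_locus = {z \<in> carrier_vec m. \<forall>P\<in>polynomials m.
    (\<forall>v\<in>carrier_vec d. v $ i \<noteq> 0 \<longrightarrow> P (invariants v) = 0) \<longrightarrow> P z = 0}"

lemma closedin_relations_locus: "closedin (zar (affine_space m)) relations_locus"
proof -
  have "openin (zar (affine_space m)) (carrier_vec m - relations_locus)"
    unfolding affine_space_def openin_coordinate_space
  proof (intro conjI ballI)
    fix z assume "z \<in> carrier_vec m - relations_locus"
    then obtain P where "P \<in> polynomials m" "P z \<noteq> 0"
      "\<forall>v\<in>carrier_vec d. v $ i \<noteq> 0 \<longrightarrow> P (invariants v) = 0"
      unfolding relations_locus_def by blast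
    then show "\<exists>p\<in>polynomials m. p z \<noteq> 0 \<and>
        (\<forall>y\<in>carrier_vec m. p y \<noteq> 0 \<longrightarrow> y \<in> carrier_vec m - relations_locus)"
      by (intro bexI[of _ P]) (auto simp: relations_locus_def)
  qed auto
  then show ?thesis by (auto simp: closedin_def relations_locus_def)
qed

lemma invariants_in_relations_locus:
  "v \<in> carrier_vec d \<Longrightarrow> v $ i \<noteq> 0 \<Longrightarrow> invariants v \<in> relations_locus"
  by (auto simp: relations_locus_def invariants_def)

text \<open>A point satisfying all relations among the generators assigns a number to every
  weight-zero Laurent monomial, and does so multiplicatively, because multiplicativity is itself a
  relation; such an assignment is evaluation at a point. Hence the image of the chart under the
  invariants is already closed.\<close>

lemma invariants_surj:
  assumes "z \<in> relations_locus"
  shows "\<exists>v\<in>carrier_vec d. v $ i = 1 \<and> invariants v = z"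
proof -
  have "\<forall>e. \<exists>P. k dvd weight ws e \<longrightarrow> P \<in> polynomials m \<and>
      (\<forall>v. v $ i \<noteq> 0 \<longrightarrow> P (invariants v) = chart e v)"
    using chart_by_generators by blast
  from choice[OF this] obtain Pf where Pf': "\<forall>e. k dvd weight ws e \<longrightarrow>
      Pf e \<in> polynomials m \<and> (\<forall>v. v $ i \<noteq> 0 \<longrightarrow> Pf e (invariants v) = chart e v)"
    by (elim exE)
  have Pf: "Pf e \<in> polynomials m"
    "\<And>v. v $ i \<noteq> 0 \<Longrightarrow> Pf e (invariants v) = chart e v" if "k dvd weight ws e" for e
    using Pf' that by simp_all
  have rel: "P z = 0" if "P \<in> polynomials m"
    "\<And>v. v \<in> carrier_vec d \<Longrightarrow> v $ i \<noteq> 0 \<Longrightarrow> P (invariants v) = 0" for P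
    using assms that unfolding relations_locus_def by blast
  have "\<exists>v\<in>carrier_vec d. v $ i = 1 \<and> (\<forall>e. k dvd weight ws e \<longrightarrow> monomial d e v = Pf e z)"
  proof (rule multiplicative_is_evaluation)
    fix e e' e'' assume *: "k dvd weight ws e" "k dvd weight ws e'" "\<And>j. j < d \<Longrightarrow> e'' j = e j + e' j"
    have dvd: "k dvd weight ws e''"
      using weight_cong[of ws e'' "\<lambda>j. e j + e' j"] * by (simp add: weight_add)
    have "Pf e'' z - Pf e z * Pf e' z = 0"
      using chart_add[OF *]
    proof (intro rel[of "\<lambda>z. Pf e'' z - Pf e z * Pf e' z"])
      show "(\<lambda>z. Pf e'' z - Pf e z * Pf e' z) \<in> polynomials m"
        by (intro polynomial_functions_diff polynomial_functions.mult Pf(1) dvd *)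
    qed (simp add: Pf(2) dvd *)
    then show "Pf e'' z = Pf e z * Pf e' z" by simp
  next
    have "Pf (\<lambda>_. 0) z - 1 = 0"
    proof (rule rel[of "\<lambda>z. Pf (\<lambda>_. 0) z - 1"])
      show "(\<lambda>z. Pf (\<lambda>_. 0) z - 1) \<in> polynomials m"
        by (intro polynomial_functions_diff polynomial_functions.const Pf(1)) (simp add: weight_def)
      show "Pf (\<lambda>_. 0) (invariants v) - 1 = 0" if "v $ i \<noteq> 0" for v
        using Pf(2)[of "\<lambda>_. 0" v] that by (simp add: chart_def monomial_def weight_def)
    qed
    then show "Pf (\<lambda>_. 0) z = 1" by simp
  next
    let ?e = "\<lambda>j. if j = i then 1 else 0 :: nat"
    have w: "weight ws ?e = k" using chart_index by (simp add: weight_single del: One_nat_def)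
    have "Pf ?e z - 1 = 0"
    proof (rule rel[of "\<lambda>z. Pf ?e z - 1"])
      show "(\<lambda>z. Pf ?e z - 1) \<in> polynomials m"
        by (intro polynomial_functions_diff polynomial_functions.const Pf(1)) (simp add: w del: One_nat_def)
      show "Pf ?e (invariants v) - 1 = 0" if "v $ i \<noteq> 0" for v
        using Pf(2)[of ?e v] that w k_pos chart_index
        by (simp add: chart_def monomial_single del: One_nat_def)
    qed
    then show "Pf ?e z = 1" by simp
  qed
  then obtain v where v: "v \<in> carrier_vec d" "v $ i = 1" "\<And>e. k dvd weight ws e \<Longrightarrow> monomial d e v = Pf e z" by blast
  have zc: "z \<in> carrier_vec m" using assms by (simp add: relations_locus_def)
  have "invariants v = z"
  proof (rule eq_vecI)
    fix l assume "l < dim_vec z"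
    then have l: "l < m" using zc by simp
    have "Pf (\<epsilon> l) z - z $ l = 0"
    proof (rule rel[of "\<lambda>z. Pf (\<epsilon> l) z - z $ l"])
      show "(\<lambda>z. Pf (\<epsilon> l) z - z $ l) \<in> polynomials m"
        by (intro polynomial_functions_diff Pf(1) dvd_weight_generator l polynomial_functions.coord) (use l in auto)
      show "Pf (\<epsilon> l) (invariants v) - invariants v $ l = 0" if "v $ i \<noteq> 0" for v
        using l that Pf(2)[OF dvd_weight_generator[OF l]] by (simp add: invariants_def)
    qed
    then show "invariants v $ l = z $ l"
      using l v by (simp add: invariants_def chart_slice dvd_weight_generator)
  qed (use zc in \<open>simp add: invariants_def\<close>)
  then show ?thesis using v by blast
qed

lemma invariants_eq_imp_same_orbit:
  assumes "v \<in> carrier_vec d" "v' \<in> carrier_vec d" "v $ i \<noteq> 0" "v' $ i \<noteq> 0" "invariants v = invariants v'"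
  shows "weighted_orbit ws v = weighted_orbit ws v'"
proof -
  have "chart e v = chart e v'" if "k dvd weight ws e" for e
    using chart_by_generators[OF that] assms by metis
  then show ?thesis
    using chart_determines_orbit[OF assms(1-4)] weighted_orbit_eq_iff[OF assms(1)] by blast
qed

lemma invariants_weighted_scale: "t \<noteq> 0 \<Longrightarrow> invariants (weighted_scale ws t v) = invariants v"
  by (auto simp: invariants_def chart_weighted_scale dvd_weight_generator)

end

lemma poly_nonzero_point:
  fixes r :: "complex poly"
  assumes "r \<noteq> 0"
  shows "\<exists>t. t \<noteq> 0 \<and> poly r t \<noteq> 0"
proof (rule ccontr)
  assume "\<not> ?thesis"
  then have "UNIV - {0} \<subseteq> {t. poly r t = 0}" by blast
  then have "finite (UNIV - {0 :: complex})" using poly_roots_finite[OF assms] finite_subset by blast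
  then show False using infinite_UNIV_char_0 by (metis finite_Diff2 finite.emptyI finite.insertI)
qed

lemma poly_eq_off_zero:
  fixes r s :: "complex poly"
  assumes "\<And>t. t \<noteq> 0 \<Longrightarrow> poly r t = poly s t"
  shows "r = s"
proof (rule ccontr)
  assume "r \<noteq> s"
  then have "r - s \<noteq> 0" by simp
  from poly_nonzero_point[OF this] show False using assms by auto
qed

section \<open>Affine charts of the punctured space\<close>

definition affine_part :: "nat \<Rightarrow> nat \<Rightarrow> complex vec set"
  where "affine_part m i = {v \<in> carrier_vec m. v $ i \<noteq> 0}"

lemma coordinate_polynomial: "i < m \<Longrightarrow> (\<lambda>v. v $ i) \<in> polynomials m"
  by (rule polynomial_functions.coord) blast

lemma affine_part_subset: "i < m \<Longrightarrow> affine_part m i \<subseteq> carrier_vec m - {0\<^sub>v m}"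
  by (auto simp: affine_part_def)

lemma openin_affine_part:
  assumes "i < m"
  shows "openin (zar (punctured_space m)) (affine_part m i)"
  unfolding openin_punctured_space
proof (intro conjI ballI)
  fix x assume "x \<in> affine_part m i"
  then show "\<exists>p\<in>polynomials m. p x \<noteq> 0 \<and>
      (\<forall>y\<in>carrier_vec m - {0\<^sub>v m}. p y \<noteq> 0 \<longrightarrow> y \<in> affine_part m i)"
    using coordinate_polynomial[OF assms] by (intro bexI[of _ "\<lambda>v. v $ i"]) (auto simp: affine_part_def)
qed (use affine_part_subset[OF assms] in auto)

text \<open>The chart is the graph of \<open>1 / v $ i\<close>, realized as the hypersurface
  \<open>u $ i * u $ m = 1\<close> in one more dimension.\<close>

lemma affine_variety_affine_part:
  assumes i: "i < m"
  shows "affine_variety (induced_on (punctured_space m) (affine_part m i))"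
proof -
  let ?U = "induced_on (punctured_space m) (affine_part m i)"
  define H where "H = {u \<in> carrier_vec (Suc m). u $ i * u $ m = (1 :: complex)}"
  define f where "f v = vec (Suc m) (\<lambda>j. if j < m then v $ j else 1 / v $ i)" for v :: "complex vec"
  define g where "g u = vec m (\<lambda>j. u $ j)" for u :: "complex vec"
  have pts: "points ?U = affine_part m i" using affine_part_subset[OF i] by auto
  have fsU: "function_space ?U" by (intro function_space_induced_on function_space_punctured_space)
  interpret U: function_space ?U by (rule fsU)
  have oU: "openin (zar ?U) (affine_part m i)" using openin_topspace[of "zar ?U"] unfolding pts .
  have regU: "p \<in> reg ?U (affine_part m i)" if "p \<in> polynomials m" for p
    by (rule reg_induced_onI[OF openin_affine_part[OF i] subset_refl])
      (rule polynomial_reg_punctured_space[OF that openin_affine_part[OF i]])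
  have cl: "closedin (zar (affine_space (Suc m))) H"
  proof -
    have pol: "(\<lambda>u. u $ i * u $ m - 1) \<in> polynomials (Suc m)"
      using i by (intro polynomial_functions_diff polynomial_functions.mult polynomial_functions.const
          coordinate_polynomial) auto
    have "openin (zar (affine_space (Suc m))) (carrier_vec (Suc m) - H)"
      unfolding affine_space_def openin_coordinate_space
      using pol by (intro conjI ballI bexI[of _ "\<lambda>u. u $ i * u $ m - 1"]) (auto simp: H_def)
    then show ?thesis by (auto simp: closedin_def H_def)
  qed
  have "isomorphic ?U (induced_on (affine_space (Suc m)) H)"
  proof (rule isomorphicI[of _ _ f g])
    show "morphism ?U (induced_on (affine_space (Suc m)) H) f"
    proof (intro morphism_into_induced_on fsU morphism_to_affine_space)
      show "f v \<in> H" if "v \<in> points ?U" for v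
        using that i unfolding pts by (auto simp: H_def f_def affine_part_def)
      show "(\<lambda>v. f v $ j) \<in> reg ?U (points ?U)" if "j < Suc m" for j
      proof (cases "j < m")
        case True
        then show ?thesis unfolding pts using that regU[OF coordinate_polynomial[OF True]] by (simp add: f_def)
      next
        case False
        have "(\<lambda>v. 1 / v $ i) \<in> reg ?U (affine_part m i)"
          by (intro U.reg_divide oU U.reg_const regU coordinate_polynomial[OF i]) (auto simp: affine_part_def)
        then show ?thesis unfolding pts using that False by (simp add: f_def)
      qed
    qed (simp add: f_def)
    show "morphism (induced_on (affine_space (Suc m)) H) ?U g"
      unfolding punctured_space_def
    proof (intro morphism_into_induced_on morphism_to_affine_space function_space_induced_on function_space_affine_space)
      fix u assume "u \<in> points (induced_on (affine_space (Suc m)) H)"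
      then have "u \<in> H" by simp
      then have "u $ i \<noteq> 0" by (auto simp: H_def)
      then show 1: "g u \<in> affine_part m i" using i by (simp add: affine_part_def g_def)
      then show "g u \<in> carrier_vec m - {0\<^sub>v m}" using affine_part_subset[OF i] by blast
    next
      fix j assume "j < m"
      then have "(\<lambda>u. u $ j) \<in> reg (induced_on (affine_space (Suc m)) H) (points (induced_on (affine_space (Suc m)) H))"
        by (intro polynomial_reg_induced_on_affine_space coordinate_polynomial) auto
      then show "(\<lambda>u. g u $ j) \<in> reg (induced_on (affine_space (Suc m)) H) (points (induced_on (affine_space (Suc m)) H))"
        using \<open>j < m\<close> by (simp add: g_def)
    qed (simp add: g_def)
    show "g (f v) = v" if "v \<in> points ?U" for v
      using that unfolding pts by (intro eq_vecI) (auto simp: g_def f_def affine_part_def)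
    show "f (g u) = u" if "u \<in> points (induced_on (affine_space (Suc m)) H)" for u
    proof (rule eq_vecI)
      have u: "u \<in> carrier_vec (Suc m)" "u $ i * u $ m = 1" using that by (auto simp: H_def)
      then show "dim_vec (f (g u)) = dim_vec u" by (simp add: f_def)
      fix j assume "j < dim_vec u"
      then have "j < Suc m" using u by simp
      moreover have "u $ m = 1 / u $ i" using u(2) by (cases "u $ i = 0") (simp_all add: field_simps)
      ultimately show "f (g u) $ j = u $ j" using i by (cases "j < m") (simp_all add: f_def g_def less_Suc_eq)
    qed
  qed
  then show ?thesis unfolding affine_variety_def using cl by blast
qed

section \<open>Saturated open sets and invariant functions on a chart\<close>

context weighted_chart_generators
begin

text \<open>The parts are the coefficients of a polynomial in \<open>t\<close> whose value at
  \<open>1\<close> is \<open>p v\<close>.\<close>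

lemma isobaric_part_nonzero:
  assumes "\<And>v. \<exists>r. (\<forall>t. poly r t = p (weighted_scale ws t v)) \<and> (\<forall>w. coeff r w = P w v)"
    and "p v \<noteq> 0" "v \<in> carrier_vec d"
  shows "\<exists>w. P w v \<noteq> 0"
proof (rule ccontr)
  obtain r where r: "\<And>t. poly r t = p (weighted_scale ws t v)" "\<And>w. coeff r w = P w v" using assms(1) by blast
  assume "\<not> ?thesis"
  then have "r = 0" using r(2) by (simp add: poly_eq_iff)
  then show False using r(1)[of 1] assms(2,3) by (simp add: weighted_scale_one)
qed

text \<open>
  An isobaric part that is nonzero at \<open>v\<close> vanishes wherever the given polynomial vanishes on a whole
  orbit, and its \<open>k\<close>-th power divided by a power of \<open>v $ i\<close> is an invariant.
\<close>

lemma invariant_open_separation: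
  assumes O: "openin (zar (punctured_space d)) U"
      "\<And>v t. v \<in> carrier_vec d \<Longrightarrow> t \<noteq> 0 \<Longrightarrow> weighted_scale ws t v \<in> U \<Longrightarrow> v \<in> U"
    and v: "v \<in> U" "v $ i \<noteq> 0"
  shows "\<exists>P\<in>polynomials m. P (invariants v) \<noteq> 0 \<and>
    (\<forall>y\<in>affine_part d i. P (invariants y) \<noteq> 0 \<longrightarrow> y \<in> U)"
proof -
  obtain p where p: "p \<in> polynomials d" "p v \<noteq> 0"
    "\<forall>y\<in>carrier_vec d - {0\<^sub>v d}. p y \<noteq> 0 \<longrightarrow> y \<in> U"
    using O(1) v(1) unfolding openin_punctured_space by blast
  have vc: "v \<in> carrier_vec d" using O(1) v(1) unfolding openin_punctured_space by blast
  obtain R where R: "\<And>w. isobaric ws w (R w)"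
    "\<And>v. \<exists>r. (\<forall>t. poly r t = p (weighted_scale ws t v)) \<and> (\<forall>w. coeff r w = R w v)"
    by (rule isobaric_components[OF p(1)]) (rule that)
  obtain w where w: "R w v \<noteq> 0" using isobaric_part_nonzero[OF R(2) p(2) vc] by blast
  obtain P where P: "P \<in> polynomials m"
    "\<forall>v. v $ i \<noteq> 0 \<longrightarrow> P (invariants v) = R w v ^ k / v $ i ^ w"
    using isobaric_by_generators[OF isobaric_power[OF R(1)[of w], of k]] by blast
  have "y \<in> U" if y: "y \<in> affine_part d i" "P (invariants y) \<noteq> 0" for y
  proof -
    have y': "y \<in> carrier_vec d" "y $ i \<noteq> 0" using y(1) by (auto simp: affine_part_def)
    then have "R w y \<noteq> 0" using y(2) P(2) k_pos by (auto simp: zero_power)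
    moreover obtain r where r: "\<And>t. poly r t = p (weighted_scale ws t y)" "\<And>w. coeff r w = R w y" using R(2) by blast
    ultimately have "r \<noteq> 0" by auto
    \<comment> \<open>A nonzero part at \<open>y\<close> only guarantees that \<open>p\<close> is
      nonzero somewhere on the orbit of \<open>y\<close>; saturation of \<open>U\<close> brings
      membership back to \<open>y\<close>.\<close>
    then obtain t where t: "t \<noteq> 0" "p (weighted_scale ws t y) \<noteq> 0" using poly_nonzero_point[of r] r(1) by auto
    have "y \<noteq> 0\<^sub>v d" using y'(2) chart_index by auto
    then have "weighted_scale ws t y \<in> carrier_vec d - {0\<^sub>v d}"
      using weighted_scale_eq_zero_iff[OF t(1) y'(1)] by simp
    then have "weighted_scale ws t y \<in> U" using p(3) t(2) by blast
    then show ?thesis using O(2)[OF y'(1) t(1)] by blast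
  qed
  moreover have "P (invariants v) \<noteq> 0" using P(2) v(2) w by simp
  ultimately show ?thesis using P(1) by blast
qed

text \<open>Writing \<open>f * a = b\<close> with polynomials and using that \<open>f\<close> is
  constant on orbits, the coefficients in \<open>t\<close> satisfy the same identity in each weight.
  A part of \<open>a\<close> that is nonzero at \<open>v\<close> serves as denominator, after
  numerator and denominator are multiplied by its power \<open>k - 1\<close> to reach a weight
  divisible by \<open>k\<close>.\<close>

lemma invariant_regular_function:
  assumes O: "openin (zar (punctured_space d)) U"
      "\<And>v t. v \<in> U \<Longrightarrow> t \<noteq> 0 \<Longrightarrow> weighted_scale ws t v \<in> U"
    and f: "f \<in> reg (punctured_space d) U" "\<And>v t. v \<in> U \<Longrightarrow> t \<noteq> 0 \<Longrightarrow> f (weighted_scale ws t v) = f v"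
    and v: "v \<in> U" "v $ i \<noteq> 0"
  shows "\<exists>P\<in>polynomials m. \<exists>Q\<in>polynomials m.
    Q (invariants v) \<noteq> 0 \<and>
    (\<forall>y\<in>U. y $ i \<noteq> 0 \<longrightarrow> Q (invariants y) \<noteq> 0 \<longrightarrow> f y = P (invariants y) / Q (invariants y))"
proof -
  have Uc: "U \<subseteq> carrier_vec d" using O(1) unfolding openin_punctured_space by blast
  from f(1) v(1) obtain r p q where pq: "r \<in> polynomials d"
    "p \<in> polynomials d" "q \<in> polynomials d" "r v \<noteq> 0"
    "\<And>y. y \<in> U \<Longrightarrow> y \<in> carrier_vec d \<Longrightarrow> r y \<noteq> 0 \<Longrightarrow> q y \<noteq> 0 \<and> f y = p y / q y"
    by (rule reg_punctured_spaceE) (rule that)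
  \<comment> \<open>The extra factor \<open>r\<close> makes \<open>f * a = b\<close> true on all of
    \<open>U\<close>, both sides being zero where the local fraction may fail.\<close>
  define a where "a = (\<lambda>y. q y * r y)"
  define b where "b = (\<lambda>y. p y * r y)"
  have ab: "a \<in> polynomials d" "b \<in> polynomials d"
    unfolding a_def b_def by (intro polynomial_functions.mult pq)+
  have fab: "f y * a y = b y" if "y \<in> U" for y
    using pq(5)[OF that] that Uc by (cases "r y = 0") (auto simp: a_def b_def)
  have av: "a v \<noteq> 0" using pq(4,5) v Uc by (auto simp: a_def)
  obtain A where A: "\<And>w. isobaric ws w (A w)"
    "\<And>v. \<exists>r. (\<forall>t. poly r t = a (weighted_scale ws t v)) \<and> (\<forall>w. coeff r w = A w v)"
    by (rule isobaric_components[OF ab(1)]) (rule that)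
  obtain B where B: "\<And>w. isobaric ws w (B w)"
    "\<And>v. \<exists>r. (\<forall>t. poly r t = b (weighted_scale ws t v)) \<and> (\<forall>w. coeff r w = B w v)"
    by (rule isobaric_components[OF ab(2)]) (rule that)
  have fAB: "f y * A w y = B w y" if y: "y \<in> U" for y w
  proof -
    obtain r where r: "\<And>t. poly r t = a (weighted_scale ws t y)" "\<And>w. coeff r w = A w y" using A(2) by blast
    obtain s where s: "\<And>t. poly s t = b (weighted_scale ws t y)" "\<And>w. coeff s w = B w y" using B(2) by blast
    have "poly (smult (f y) r) t = poly s t" if "t \<noteq> 0" for t
      using fab[OF O(2)[OF y that]] f(2)[OF y that] by (simp add: r(1) s(1))
    then have "smult (f y) r = s" by (rule poly_eq_off_zero)
    then show ?thesis using r(2) s(2) by (metis coeff_smult)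
  qed
  obtain w where w: "A w v \<noteq> 0" using isobaric_part_nonzero[OF A(2) av] v(1) Uc by blast
  obtain Q where Q: "Q \<in> polynomials m"
    "\<forall>v. v $ i \<noteq> 0 \<longrightarrow> Q (invariants v) = A w v ^ k / v $ i ^ w"
    using isobaric_by_generators[OF isobaric_power[OF A(1)[of w], of k]] by blast
  have kw: "w + (k - 1) * w = k * w" using k_pos by (cases k) auto
  obtain P where P: "P \<in> polynomials m"
    "\<forall>v. v $ i \<noteq> 0 \<longrightarrow> P (invariants v) = B w v * A w v ^ (k - 1) / v $ i ^ w"
    using isobaric_by_generators[OF isobaric_mult[OF B(1)[of w] isobaric_power[OF A(1)[of w], of "k - 1"], unfolded kw]]
    by blast
  have "f y = P (invariants y) / Q (invariants y)"
    if y: "y \<in> U" "y $ i \<noteq> 0" "Q (invariants y) \<noteq> 0" for y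
  proof -
    have Ay: "A w y \<noteq> 0" using y Q(2) k_pos by (auto simp: zero_power)
    have "A w y ^ k = A w y * A w y ^ (k - 1)" using k_pos by (cases k) auto
    then have "P (invariants y) / Q (invariants y) = B w y / A w y"
      using P(2) Q(2) y Ay by simp
    then show ?thesis using fAB[OF y(1), of w, symmetric] Ay by simp
  qed
  moreover have "Q (invariants v) \<noteq> 0" using Q(2) v(2) w by simp
  ultimately show ?thesis using P(1) Q(1) by blast
qed

end

section \<open>Standard charts of the weighted projective space\<close>

context weighted_chart
begin

definition projective_chart :: "complex vec set set"
  where "projective_chart = weighted_orbit ws ` affine_part d i"

lemma weighted_orbit_in_projective_chart:
  assumes "v \<in> carrier_vec d"
  shows "weighted_orbit ws v \<in> projective_chart \<longleftrightarrow> v $ i \<noteq> 0"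
proof
  assume "weighted_orbit ws v \<in> projective_chart"
  then obtain v' where v': "v' \<in> affine_part d i" "weighted_orbit ws v = weighted_orbit ws v'"
    unfolding projective_chart_def by blast
  then obtain t where "t \<noteq> 0" "v = weighted_scale ws t v'" using weighted_orbit_eq_iff[OF assms] by blast
  then show "v $ i \<noteq> 0" using v' chart_index by (simp add: affine_part_def)
qed (use assms in \<open>auto simp: projective_chart_def affine_part_def\<close>)

lemma projective_chart_preimage:
  "{v \<in> points (punctured_space d). weighted_orbit ws v \<in> projective_chart} = affine_part d i"
  using weighted_orbit_in_projective_chart affine_part_subset[OF chart_index] by (auto simp: affine_part_def)

lemma openin_projective_chart: "openin (zar (weighted_projective_space ws)) projective_chart"
  unfolding weighted_projective_space_eq openin_quotient_space projective_chart_preimage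
  using openin_affine_part[OF chart_index] affine_part_subset[OF chart_index]
  by (auto simp: projective_chart_def)

end

text \<open>The inverse \<open>G\<close> picks a preimage in the slice, but its continuity and
  regularity are checked on the punctured space: saturated open sets and invariant functions over
  the chart are locally given by polynomials in the invariants.\<close>

lemma (in weighted_chart_generators) projective_chart_isomorphic:
  "isomorphic (induced_on (weighted_projective_space ws) projective_chart)
    (induced_on (affine_space m) relations_locus)"
proof -
  let ?P = "punctured_space d" and ?W = "weighted_projective_space ws"
  let ?V = "induced_on ?W projective_chart" and ?Z = "induced_on (affine_space m) relations_locus"
  define F where "F orb = invariants (SOME v. v \<in> orb)" for orb
  define G where "G z = weighted_orbit ws (SOME v. v \<in> carrier_vec d \<and> v $ i = 1 \<and> invariants v = z)" for z
  interpret P: function_space ?P by (rule function_space_punctured_space)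
  interpret W: function_space ?W by (rule function_space_weighted_projective_space)
  have fsV: "function_space ?V" by (intro function_space_induced_on function_space_weighted_projective_space)
  have fsZ: "function_space ?Z" by (intro function_space_induced_on function_space_affine_space)
  have ptsV: "points ?V = projective_chart" using openin_subset[OF openin_projective_chart] by auto
  have ptsZ: "points ?Z = relations_locus" by (auto simp: relations_locus_def)
  have F: "F (weighted_orbit ws v) = invariants v" if "v \<in> carrier_vec d" for v
  proof -
    have "(SOME x. x \<in> weighted_orbit ws v) \<in> weighted_orbit ws v"
      using weighted_orbit_self[OF that] by (rule someI)
    then show ?thesis unfolding F_def weighted_orbit_def using invariants_weighted_scale by auto
  qed
  have G: "G (invariants v) = weighted_orbit ws v" if "v \<in> carrier_vec d" "v $ i \<noteq> 0" for v
  proof -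
    let ?u = "SOME u. u \<in> carrier_vec d \<and> u $ i = 1 \<and> invariants u = invariants v"
    have "\<exists>u. u \<in> carrier_vec d \<and> u $ i = 1 \<and> invariants u = invariants v"
      using invariants_surj[OF invariants_in_relations_locus[OF that]] by blast
    from someI_ex[OF this] have "?u \<in> carrier_vec d" "?u $ i = 1" "invariants ?u = invariants v" by auto
    then show ?thesis unfolding G_def using that by (intro invariants_eq_imp_same_orbit) auto
  qed
  have surj: "\<exists>v. v \<in> affine_part d i \<and> invariants v = z" if "z \<in> relations_locus" for z
  proof -
    from invariants_surj[OF that] obtain v where "v \<in> carrier_vec d" "v $ i = 1" "invariants v = z" by blast
    then show ?thesis by (intro exI[of _ v]) (simp add: affine_part_def)
  qed
  have "morphism ?V ?Z F"
  proof (intro morphism_into_induced_on fsV morphism_to_affine_space)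
    fix orb assume "orb \<in> points ?V"
    then obtain v where v: "v \<in> carrier_vec d" "v $ i \<noteq> 0" "orb = weighted_orbit ws v"
      unfolding ptsV unfolding projective_chart_def affine_part_def by blast
    then show "F orb \<in> relations_locus" using invariants_in_relations_locus F by simp
    show "F orb \<in> carrier_vec m" using F v by (simp add: invariants_def)
  next
    fix l assume l: "l < m"
    have "(\<lambda>v. monomial d (\<epsilon> l) v / v $ i ^ (weight ws (\<epsilon> l) div k)) \<in> reg ?P (affine_part d i)"
      by (intro P.reg_divide P.reg_power polynomial_reg_punctured_space openin_affine_part chart_index
          monomial_in_polynomial_functions coordinate_polynomial) (simp add: affine_part_def)
    then have "(\<lambda>orb. F orb $ l) \<circ> weighted_orbit ws \<in> reg ?P (affine_part d i)"
      by (rule P.reg_cong[OF openin_affine_part[OF chart_index]])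
        (use l F in \<open>simp add: affine_part_def invariants_def chart_def\<close>)
    then have "(\<lambda>orb. F orb $ l) \<in> reg ?W projective_chart"
      unfolding weighted_projective_space_eq reg_quotient_space projective_chart_preimage .
    then show "(\<lambda>orb. F orb $ l) \<in> reg ?V (points ?V)"
      unfolding ptsV by (intro reg_induced_onI[OF openin_projective_chart]) auto
  qed
  moreover have "morphism ?Z ?V G"
  proof (intro morphism_into_induced_on fsZ morphismI)
    fix z assume "z \<in> points ?Z"
    then obtain v where v: "v \<in> affine_part d i" "z = invariants v" using surj unfolding ptsZ by metis
    then show "G z \<in> projective_chart" using G by (auto simp: projective_chart_def affine_part_def)
    then show "G z \<in> points ?W" using openin_subset[OF openin_projective_chart] by blast
  next
    fix V assume V: "openin (zar ?W) V"
    define U where "U = {v \<in> points ?P. weighted_orbit ws v \<in> V}"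
    have oU: "openin (zar ?P) U" using V unfolding weighted_projective_space_eq openin_quotient_space U_def by blast
    have GV: "G (invariants v) \<in> V \<longleftrightarrow> v \<in> U" if "v \<in> affine_part d i" for v
      using that G affine_part_subset[OF chart_index] by (auto simp: U_def affine_part_def)
    have U1: "v \<in> U" if "v \<in> carrier_vec d" "t \<noteq> 0" "weighted_scale ws t v \<in> U" for v t
      using that by (simp add: U_def weighted_orbit_scale weighted_scale_eq_zero_iff)
    have U2: "weighted_scale ws t v \<in> U" if "v \<in> U" "t \<noteq> 0" for v t
      using that by (simp add: U_def weighted_orbit_scale weighted_scale_eq_zero_iff)
    have sep: "\<exists>v. v \<in> U \<and> v \<in> affine_part d i \<and> z = invariants v" if z: "z \<in> points ?Z" "G z \<in> V" for z
    proof -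
      obtain v where "v \<in> affine_part d i" "z = invariants v" using z(1) surj unfolding ptsZ by metis
      then show ?thesis using GV z(2) by blast
    qed
    have oD: "openin (zar (affine_space m)) {z \<in> carrier_vec m. P z \<noteq> 0}"
      if "P \<in> polynomials m" for P
      unfolding affine_space_def openin_coordinate_space using that by blast
    show o: "openin (zar ?Z) {z \<in> points ?Z. G z \<in> V}"
    proof (subst openin_subopen, intro ballI)
      fix z assume "z \<in> {z \<in> points ?Z. G z \<in> V}"
      then have z: "z \<in> points ?Z" "G z \<in> V" by auto
      then obtain v where v: "v \<in> U" "v \<in> affine_part d i" "z = invariants v" using sep by blast
      have vi: "v $ i \<noteq> 0" using v(2) by (simp add: affine_part_def)
      have "\<exists>P\<in>polynomials m. P (invariants v) \<noteq> 0 \<and>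
          (\<forall>y\<in>affine_part d i. P (invariants y) \<noteq> 0 \<longrightarrow> y \<in> U)"
        by (rule invariant_open_separation[OF oU]) (fact U1 v(1) vi)+
      then obtain P where P: "P \<in> polynomials m"
        "P (invariants v) \<noteq> 0" "\<forall>y\<in>affine_part d i. P (invariants y) \<noteq> 0 \<longrightarrow> y \<in> U" by blast
      let ?T = "{z \<in> carrier_vec m. P z \<noteq> 0} \<inter> relations_locus"
      have "openin (zar ?Z) ?T" using oD[OF P(1)] by (auto simp: openin_subtopology)
      moreover have "z \<in> ?T" using z v P by (auto simp: ptsZ)
      moreover have "?T \<subseteq> {z \<in> points ?Z. G z \<in> V}"
      proof
        fix z' assume z': "z' \<in> ?T"
        then obtain y where "y \<in> affine_part d i" "z' = invariants y" using surj by blast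
        then show "z' \<in> {z \<in> points ?Z. G z \<in> V}" using z' P(3) GV by (auto simp: ptsZ)
      qed
      ultimately show "\<exists>T. openin (zar ?Z) T \<and> z \<in> T \<and> T \<subseteq> {z \<in> points ?Z. G z \<in> V}" by blast
    qed
    fix h assume h: "h \<in> reg ?W V"
    have f: "h \<circ> weighted_orbit ws \<in> reg ?P U"
      using h unfolding weighted_projective_space_eq reg_quotient_space U_def .
    show "h \<circ> G \<in> reg ?Z {z \<in> points ?Z. G z \<in> V}"
      unfolding reg_induced_on
    proof
      fix z assume "z \<in> {z \<in> points ?Z. G z \<in> V}"
      then have z: "z \<in> points ?Z" "G z \<in> V" by auto
      then obtain v where v: "v \<in> U" "v \<in> affine_part d i" "z = invariants v" using sep by blast
      have vi: "v $ i \<noteq> 0" using v(2) by (simp add: affine_part_def)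
      have inv: "(h \<circ> weighted_orbit ws) (weighted_scale ws t v) = (h \<circ> weighted_orbit ws) v"
        if "v \<in> U" "t \<noteq> 0" for v t
        using that by (simp add: weighted_orbit_scale)
      have "\<exists>P\<in>polynomials m. \<exists>Q\<in>polynomials m.
          Q (invariants v) \<noteq> 0 \<and> (\<forall>y\<in>U. y $ i \<noteq> 0 \<longrightarrow> Q (invariants y) \<noteq> 0 \<longrightarrow>
          (h \<circ> weighted_orbit ws) y = P (invariants y) / Q (invariants y))"
        by (rule invariant_regular_function[OF oU]) (fact U2 f inv v(1) vi)+
      then obtain P Q where PQ:
        "P \<in> polynomials m" "Q \<in> polynomials m"
        "Q (invariants v) \<noteq> 0" "\<forall>y\<in>U. y $ i \<noteq> 0 \<longrightarrow> Q (invariants y) \<noteq> 0 \<longrightarrow>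
          (h \<circ> weighted_orbit ws) y = P (invariants y) / Q (invariants y)" by blast
      let ?T = "{z \<in> carrier_vec m. Q z \<noteq> 0}"
      interpret A: function_space "affine_space m" by (rule function_space_affine_space)
      have "(\<lambda>z. P z / Q z) \<in> reg (affine_space m) ?T"
        by (intro A.reg_divide polynomial_reg_affine_space PQ oD) auto
      moreover have "z \<in> ?T" using z v PQ(3) by (auto simp: relations_locus_def)
      moreover have "(h \<circ> G) y = P y / Q y" if y: "y \<in> ?T \<inter> {z \<in> points ?Z. G z \<in> V}" for y
      proof -
        obtain u where u: "u \<in> U" "u \<in> affine_part d i" "y = invariants u" using sep[of y] y by blast
        have "u \<in> carrier_vec d" "u $ i \<noteq> 0" using u(2) by (auto simp: affine_part_def)
        then show ?thesis using PQ(4) u y G by auto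
      qed
      ultimately show "\<exists>V' g. openin (zar (affine_space m)) V' \<and> z \<in> V' \<and> g \<in> reg (affine_space m) V' \<and>
          (\<forall>y\<in>V' \<inter> {z \<in> points ?Z. G z \<in> V}. (h \<circ> G) y = g y)"
        using oD[OF PQ(2)] by blast
    qed
  qed
  moreover have "G (F orb) = orb" if "orb \<in> points ?V" for orb
    using that F G unfolding ptsV unfolding projective_chart_def affine_part_def by auto
  moreover have "F (G z) = z" if z: "z \<in> points ?Z" for z
  proof -
    obtain v where "v \<in> affine_part d i" "z = invariants v" using z surj unfolding ptsZ by metis
    then show ?thesis using F G by (simp add: affine_part_def)
  qed
  ultimately show ?thesis by (rule isomorphicI)
qed

lemma (in weighted_chart) affine_variety_projective_chart:
  "affine_variety (induced_on (weighted_projective_space ws) projective_chart)"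
proof -
  let ?E = "{e. (\<forall>j. j < d \<longrightarrow> e j \<le> k) \<and> (\<forall>j. j \<ge> d \<longrightarrow> e j = 0) \<and> k dvd weight ws e}"
  have "?E \<subseteq> {e. \<forall>x. (x \<in> {..<d} \<longrightarrow> e x \<in> {..k}) \<and> (x \<notin> {..<d} \<longrightarrow> e x = 0)}" by auto
  then have "finite ?E" by (rule finite_subset) (intro finite_set_of_finite_funs; simp)
  from finite_imp_nat_seg_image_inj_on[OF this]
  obtain m and \<epsilon> :: "nat \<Rightarrow> nat \<Rightarrow> nat" where "?E = \<epsilon> ` {j. j < m}" by blast
  then have "\<epsilon> ` {..<m} = ?E" by (simp add: lessThan_def)
  then interpret weighted_chart_generators ws i m \<epsilon> by unfold_locales
  show ?thesis
    unfolding affine_variety_def using closedin_relations_locus projective_chart_isomorphic by blast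
qed

section \<open>The deep chamber\<close>

lemma reflection_word_Nil [simp]: "reflection_word [] = id"
  by (simp add: reflection_word_def)

lemma reflection_word_append:
  "reflection_word (is @ js) = reflection_word is \<circ> reflection_word js"
  by (induction "is") (simp_all add: reflection_word_def comp_assoc)

lemma reflection_word_single: "reflection_word [i] = Transposition.transpose i (Suc i)"
  by (simp add: reflection_word_def)

definition inversions :: "nat \<Rightarrow> (nat \<Rightarrow> nat) \<Rightarrow> (nat \<times> nat) set"
  where "inversions n w = {(a, b). 1 \<le> a \<and> a < b \<and> b \<le> n \<and> w b < w a}"

lemma finite_inversions: "finite (inversions n w)"
  by (rule finite_subset[of _ "{..n} \<times> {..n}"]) (auto simp: inversions_def)

lemma transpose_permutes: "i \<in> {1..<n} \<Longrightarrow> Transposition.transpose i (Suc i) permutes {1..n}"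
  by (rule permutes_swap_id) auto

text \<open>The transposition preserves the order of every pair of positions except
  \<open>(i, Suc i)\<close>, so it matches the old inversions with the new ones other than that
  pair.\<close>

lemma card_inversions_ascent:
  assumes i: "i \<in> {1..<n}" "w i < w (Suc i)"
  shows "card (inversions n (w \<circ> Transposition.transpose i (Suc i))) = Suc (card (inversions n w))"
proof -
  let ?s = "Transposition.transpose i (Suc i)"
  let ?\<phi> = "\<lambda>(a, b). (?s a, ?s b)"
  have lt: "?s a < ?s b" if "a < b" "(a, b) \<noteq> (i, Suc i)" for a b
    using that by (auto simp: Transposition.transpose_def)
  have bd: "1 \<le> ?s a \<longleftrightarrow> 1 \<le> a" "?s a \<le> n \<longleftrightarrow> a \<le> n" for a
    using i by (auto simp: Transposition.transpose_def)
  have "inversions n (w \<circ> ?s) = insert (i, Suc i) (?\<phi> ` inversions n w)"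
  proof (intro equalityI subsetI)
    fix p assume p: "p \<in> inversions n (w \<circ> ?s)"
    obtain a b where ab: "p = (a, b)" by force
    show "p \<in> insert (i, Suc i) (?\<phi> ` inversions n w)"
    proof (cases "p = (i, Suc i)")
      case False
      then have "(?s a, ?s b) \<in> inversions n w"
        using p lt[of a b] bd by (auto simp: ab inversions_def)
      then have "?\<phi> (?s a, ?s b) \<in> ?\<phi> ` inversions n w" by (rule imageI)
      then show ?thesis by (simp add: ab)
    qed simp
  next
    fix p assume "p \<in> insert (i, Suc i) (?\<phi> ` inversions n w)"
    then consider "p = (i, Suc i)" | a b where "(a, b) \<in> inversions n w" "p = (?s a, ?s b)" by auto
    then show "p \<in> inversions n (w \<circ> ?s)"
    proof cases
      case 1
      then show ?thesis using i by (simp add: inversions_def)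
    next
      case 2
      then have "(a, b) \<noteq> (i, Suc i)" using i by (auto simp: inversions_def)
      then show ?thesis using 2 lt[of a b] bd by (simp add: inversions_def)
    qed
  qed
  moreover have "(i, Suc i) \<notin> ?\<phi> ` inversions n w"
  proof
    assume "(i, Suc i) \<in> ?\<phi> ` inversions n w"
    then obtain a b where "(a, b) \<in> inversions n w" "?s a = i" "?s b = Suc i" by auto
    moreover from this have "a = Suc i" "b = i"
      by (metis transpose_involutory transpose_apply_first, metis transpose_involutory transpose_apply_second)
    ultimately show False by (simp add: inversions_def)
  qed
  moreover have "inj_on ?\<phi> (inversions n w)"
    by (rule inj_on_inverseI[where g = ?\<phi>]) auto
  ultimately show ?thesis by (simp add: card_image finite_inversions)
qed

lemma card_inversions_descent:
  assumes i: "i \<in> {1..<n}" "w (Suc i) < w i"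
  shows "card (inversions n w) = Suc (card (inversions n (w \<circ> Transposition.transpose i (Suc i))))"
  using card_inversions_ascent[of i n "w \<circ> Transposition.transpose i (Suc i)"] i
  by (simp add: comp_assoc)

text \<open>Growth by at least one at each step gives \<open>i \<le> w i\<close>, and the equal sums
  over \<open>{1..n}\<close> leave no room for strict inequality.\<close>

lemma permutes_increasing_eq_id:
  fixes w :: "nat \<Rightarrow> nat"
  assumes w: "w permutes {1..n}" "\<And>i. i \<in> {1..<n} \<Longrightarrow> w i < w (Suc i)"
  shows "w = id"
proof -
  have ge: "i \<le> w i" if "1 \<le> i" "i \<le> n" for i
    using that
  proof (induction i)
    case (Suc i)
    show ?case
    proof (cases "i = 0")
      case True
      then show ?thesis using permutes_in_image[OF w(1), of 1] Suc.prems by simp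
    next
      case False
      then show ?thesis using Suc w(2)[of i] by simp
    qed
  qed simp
  have "sum (\<lambda>i. i) {1..n} = sum w {1..n}"
    using sum.permute[OF w(1), of "\<lambda>i. i"] by (simp add: o_def)
  then have "w i = i" if "i \<in> {1..n}" for i
    using sum_mono_inv[of "\<lambda>i. i" "{1..n}" w i] ge that by simp
  then show ?thesis using w(1) by (auto simp: permutes_def fun_eq_iff)
qed

lemma reflection_word_permutes: "set is \<subseteq> {1..<n} \<Longrightarrow> reflection_word is permutes {1..n}"
proof (induction "is" rule: rev_induct)
  case (snoc i "is")
  then have "(reflection_word is \<circ> Transposition.transpose i (Suc i)) permutes {1..n}"
    by (intro permutes_compose transpose_permutes) auto
  then show ?case by (simp only: reflection_word_append reflection_word_single)
qed (simp add: permutes_id)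

text \<open>Each letter changes the number of inversions by exactly one, in one direction or the
  other.\<close>

lemma card_inversions_reflection_word:
  "set is \<subseteq> {1..<n} \<Longrightarrow> card (inversions n (reflection_word is)) \<le> length is"
proof (induction "is" rule: rev_induct)
  case Nil
  have "inversions n (reflection_word []) = {}" by (auto simp: inversions_def)
  then show ?case by (simp only: card.empty le0)
next
  case (snoc i "is")
  let ?w = "reflection_word is"
  have "?w permutes {1..n}" using snoc.prems by (intro reflection_word_permutes) auto
  then have "inj ?w" by (rule permutes_inj)
  then have "?w i \<noteq> ?w (Suc i)" by (simp add: inj_eq)
  then consider "?w i < ?w (Suc i)" | "?w (Suc i) < ?w i" by linarith
  then have "card (inversions n (?w \<circ> Transposition.transpose i (Suc i))) \<le> Suc (card (inversions n ?w))"
    using card_inversions_ascent[of i n ?w] card_inversions_descent[of i n ?w] snoc.prems by cases auto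
  moreover have "card (inversions n ?w) \<le> length is" using snoc by simp
  ultimately show ?case unfolding reflection_word_append reflection_word_single length_append list.size
    by linarith
qed

text \<open>Removing a descent lowers the number of inversions by one. If \<open>w\<close> preserves
  \<open>{1..r}\<close>, position \<open>r\<close> is never a descent, so the letter
  \<open>r\<close> does not occur. For \<open>r = 0\<close> no letter is excluded, which gives the
  statement on the full symmetric group.\<close>

lemma reduced_word_exists:
  assumes "w permutes {1..n}" "w ` {1..r} \<subseteq> {1..r}" "r \<le> n"
  shows "\<exists>is. set is \<subseteq> {1..<n} - {r} \<and> length is = card (inversions n w) \<and> reflection_word is = w"
  using assms(1,2)
proof (induction "card (inversions n w)" arbitrary: w rule: less_induct)
  case (less w)
  show ?case
  proof (cases "\<exists>i\<in>{1..<n}. w (Suc i) < w i")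
    case False
    have "w i \<noteq> w (Suc i)" for i using permutes_inj[OF less.prems(1)] by (simp add: inj_eq)
    then have "w = id"
      using False by (intro permutes_increasing_eq_id[OF less.prems(1)]) (meson linorder_neqE_nat)
    moreover have "inversions n id = {}" by (auto simp: inversions_def)
    ultimately show ?thesis by (intro exI[of _ "[]"]) auto
  next
    case True
    then obtain i where i: "i \<in> {1..<n}" "w (Suc i) < w i" by blast
    have surj: "w ` {1..r} = {1..r}"
      using less.prems(2) permutes_inj_on[OF less.prems(1)] by (intro endo_inj_surj) auto
    have "i \<noteq> r"
    proof
      assume "i = r"
      then have "i \<in> {1..r}" using i(1) by simp
      then have "w i \<in> {1..r}" using less.prems(2) by blast
      then have "w i \<le> r" by simp
      with i have "w (Suc i) \<in> {1..r}"
        using permutes_in_image[OF less.prems(1), of "Suc i"] \<open>i = r\<close> by auto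
      with surj obtain j where "j \<in> {1..r}" "w j = w (Suc i)" by (metis (no_types, lifting) imageE)
      then show False using \<open>i = r\<close> by (auto simp: inj_eq[OF permutes_inj[OF less.prems(1)]])
    qed
    let ?s = "Transposition.transpose i (Suc i)"
    have "(w \<circ> ?s) ` {1..r} \<subseteq> {1..r}"
    proof -
      have "?s ` {1..r} \<subseteq> {1..r}" using \<open>i \<noteq> r\<close> i by (auto simp: Transposition.transpose_def)
      then show ?thesis using less.prems(2) by (auto simp: image_comp[symmetric])
    qed
    moreover have "(w \<circ> ?s) permutes {1..n}" by (intro permutes_compose transpose_permutes i less.prems)
    moreover have c: "card (inversions n w) = Suc (card (inversions n (w \<circ> ?s)))"
      by (rule card_inversions_descent[OF i])
    ultimately obtain "is" where "is": "set is \<subseteq> {1..<n} - {r}" "length is = card (inversions n (w \<circ> ?s))"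
      "reflection_word is = w \<circ> ?s" using less.hyps[of "w \<circ> ?s"] by auto
    then show ?thesis using i \<open>i \<noteq> r\<close> c
      by (intro exI[of _ "is @ [i]"]) (auto simp: reflection_word_append reflection_word_single comp_assoc)
  qed
qed

lemma weyl_length_eq: "w permutes {1..n} \<Longrightarrow> weyl_length n w = card (inversions n w)"
  unfolding weyl_length_def
proof (rule Least_equality)
  assume "w permutes {1..n}"
  from reduced_word_exists[OF this, of 0]
  show "\<exists>is. set is \<subseteq> {1..<n} \<and> length is = card (inversions n w) \<and> reflection_word is = w"
    by auto
next
  fix k assume "\<exists>is. set is \<subseteq> {1..<n} \<and> length is = k \<and> reflection_word is = w"
  then show "card (inversions n w) \<le> k" using card_inversions_reflection_word by blast
qed

section \<open>Longest elements of the maximal parabolic subgroups\<close>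

definition block_reversal :: "nat \<Rightarrow> nat \<Rightarrow> nat \<Rightarrow> nat"
  where "block_reversal n r i =
    (if 1 \<le> i \<and> i \<le> r then Suc r - i else if r < i \<and> i \<le> n then Suc (n + r) - i else i)"

lemma block_reversal_involution: "r \<le> n \<Longrightarrow> block_reversal n r \<circ> block_reversal n r = id"
  by (auto simp: block_reversal_def fun_eq_iff)

lemma block_reversal_permutes: "r \<le> n \<Longrightarrow> block_reversal n r permutes {1..n}"
proof (rule bij_imp_permutes)
  assume r: "r \<le> n"
  show "bij_betw (block_reversal n r) {1..n} {1..n}"
    by (rule bij_betw_byWitness[where f' = "block_reversal n r"])
      (use block_reversal_involution[OF r] r in \<open>auto simp: fun_eq_iff block_reversal_def\<close>)
qed (auto simp: block_reversal_def)

text \<open>A simple reflection other than the one at \<open>r\<close> maps \<open>{1..r}\<close>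
  into itself; conversely a reduced word of a permutation with this property avoids
  \<open>r\<close>.\<close>

lemma parabolic_subgroup_iff:
  assumes "r \<le> n"
  shows "w \<in> parabolic_subgroup ({1..<n} - {r}) \<longleftrightarrow> w permutes {1..n} \<and> w ` {1..r} \<subseteq> {1..r}"
proof
  assume "w \<in> parabolic_subgroup ({1..<n} - {r})"
  then obtain "is" where "is": "set is \<subseteq> {1..<n} - {r}" "w = reflection_word is"
    unfolding parabolic_subgroup_def by blast
  have "reflection_word is ` {1..r} \<subseteq> {1..r}" using "is"(1)
  proof (induction "is" rule: rev_induct)
    case (snoc i "is")
    have "Transposition.transpose i (Suc i) ` {1..r} \<subseteq> {1..r}"
      using snoc.prems by (auto simp: Transposition.transpose_def)
    then show ?case using snoc by (auto simp: reflection_word_append reflection_word_single image_comp[symmetric])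
  qed simp
  then show "w permutes {1..n} \<and> w ` {1..r} \<subseteq> {1..r}"
    using "is" reflection_word_permutes[of "is" n] by auto
next
  assume "w permutes {1..n} \<and> w ` {1..r} \<subseteq> {1..r}"
  then show "w \<in> parabolic_subgroup ({1..<n} - {r})"
    using reduced_word_exists[of w n r] assms unfolding parabolic_subgroup_def by blast
qed

text \<open>A permutation preserving \<open>{1..r}\<close> has inversions only inside the two
  blocks, and \<open>block_reversal\<close> inverts every pair there. An element of maximal length
  must therefore have the same inversions, and its composite with \<open>block_reversal\<close> is
  increasing, hence the identity.\<close>

lemma longest_element_eq:
  assumes r: "r \<le> n"
  shows "longest_element n ({1..<n} - {r}) = block_reversal n r"
  unfolding longest_element_def
proof (rule the_equality)
  let ?w = "block_reversal n r"
  let ?B = "{(a, b). 1 \<le> a \<and> a < b \<and> b \<le> n \<and> (b \<le> r \<or> r < a)}"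
  have P: "?w \<in> parabolic_subgroup ({1..<n} - {r})"
    unfolding parabolic_subgroup_iff[OF r] using block_reversal_permutes[OF r] by (auto simp: block_reversal_def)
  have B: "inversions n ?w = ?B" using r by (auto simp: inversions_def block_reversal_def)
  have fB: "finite ?B" using finite_inversions[of n ?w] unfolding B .
  have sub: "inversions n v \<subseteq> ?B" if v: "v permutes {1..n}" "v ` {1..r} \<subseteq> {1..r}" for v
  proof -
    have surj: "v ` {1..r} = {1..r}"
      using v(2) permutes_inj_on[OF v(1)] by (intro endo_inj_surj) auto
    have "v b > r" if "r < b" "b \<le> n" for b
    proof (rule ccontr)
      assume "\<not> r < v b"
      then have "v b \<in> {1..r}" using permutes_in_image[OF v(1), of b] that by auto
      with surj obtain j where "j \<in> {1..r}" "v j = v b" by (metis (no_types, lifting) imageE)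
      then show False using that by (auto simp: inj_eq[OF permutes_inj[OF v(1)]])
    qed
    moreover have "v a \<le> r" if "1 \<le> a" "a \<le> r" for a
    proof -
      have "a \<in> {1..r}" using that by simp
      then have "v a \<in> {1..r}" using v(2) by blast
      then show ?thesis by simp
    qed
    ultimately have "b \<le> r \<or> r < a" if "1 \<le> a" "b \<le> n" "v b < v a" for a b
      using that by (meson le_less_trans less_asym not_le order_le_less_trans)
    then show ?thesis by (auto simp: inversions_def)
  qed
  have len: "weyl_length n v = card (inversions n v)" if "v \<in> parabolic_subgroup ({1..<n} - {r})" for v
    using that unfolding parabolic_subgroup_iff[OF r] by (intro weyl_length_eq) blast
  have le: "weyl_length n v \<le> weyl_length n ?w" if "v \<in> parabolic_subgroup ({1..<n} - {r})" for v
    unfolding len[OF that] len[OF P] B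
    using that unfolding parabolic_subgroup_iff[OF r] by (intro card_mono fB sub) auto
  then show "?w \<in> parabolic_subgroup ({1..<n} - {r}) \<and>
      (\<forall>v\<in>parabolic_subgroup ({1..<n} - {r}). weyl_length n v \<le> weyl_length n ?w)" using P by blast
  fix v
  assume "v \<in> parabolic_subgroup ({1..<n} - {r}) \<and>
      (\<forall>u\<in>parabolic_subgroup ({1..<n} - {r}). weyl_length n u \<le> weyl_length n v)"
  then have v: "v \<in> parabolic_subgroup ({1..<n} - {r})" "weyl_length n ?w \<le> weyl_length n v" using P by auto
  have v': "v permutes {1..n}" "v ` {1..r} \<subseteq> {1..r}" using v(1) unfolding parabolic_subgroup_iff[OF r] by auto
  have "inversions n v = ?B"
    using v(2) unfolding len[OF v(1)] len[OF P] B by (intro card_seteq fB sub v')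
  then have dec: "v b < v a" if "1 \<le> a" "a < b" "b \<le> n" "b \<le> r \<or> r < a" for a b
    using that by (auto simp: inversions_def)
  have "v \<circ> ?w = id"
  proof (rule permutes_increasing_eq_id)
    show "(v \<circ> ?w) permutes {1..n}" by (intro permutes_compose block_reversal_permutes r v')
    fix i assume i: "i \<in> {1..<n}"
    show "(v \<circ> ?w) i < (v \<circ> ?w) (Suc i)"
    proof (cases "i = r")
      case False
      then have "1 \<le> ?w (Suc i)" "?w (Suc i) < ?w i" "?w i \<le> n" "?w i \<le> r \<or> r < ?w (Suc i)"
        using i r by (auto simp: block_reversal_def)
      then show ?thesis using dec by simp
    next
      case True
      have "?w i \<in> {1..r}" using True i by (auto simp: block_reversal_def)
      then have "v (?w i) \<in> {1..r}" using v'(2) by blast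
      moreover have "v (?w (Suc i)) \<notin> {1..r}"
      proof
        assume "v (?w (Suc i)) \<in> {1..r}"
        moreover have "v ` {1..r} = {1..r}"
          using v'(2) permutes_inj_on[OF v'(1)] by (intro endo_inj_surj) auto
        ultimately obtain j where "j \<in> {1..r}" "v j = v (?w (Suc i))" by (metis (no_types, lifting) imageE)
        then have "?w (Suc i) \<in> {1..r}" by (simp add: inj_eq[OF permutes_inj[OF v'(1)]])
        then show False using True i by (auto simp: block_reversal_def)
      qed
      moreover have "v (?w (Suc i)) \<ge> 1"
        using permutes_in_image[OF v'(1), of "?w (Suc i)"] True i by (auto simp: block_reversal_def)
      ultimately show ?thesis by auto
    qed
  qed
  then have "(v \<circ> ?w) \<circ> ?w = ?w" by simp
  then show "v = ?w" unfolding comp_assoc block_reversal_involution[OF r] by simp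
qed

lemma lambda_pairing_block_reversal:
  assumes "r \<le> n"
  shows "lambda_pairing n (weyl_act (longest_element n ({1..<n} - {r})) x) =
    (\<Sum>i=1..n. real (block_reversal n r i) * x i)"
proof -
  let ?w = "block_reversal n r"
  have inv: "?w (?w j) = j" for j using block_reversal_involution[OF assms] by (simp add: fun_eq_iff)
  have "inv_into UNIV ?w = ?w" by (rule inv_equality) (simp_all add: inv)
  then have "lambda_pairing n (weyl_act (longest_element n ({1..<n} - {r})) x) = (\<Sum>j=1..n. real j * x (?w j))"
    unfolding lambda_pairing_def weyl_act_def longest_element_eq[OF assms] by (simp only:)
  also have "\<dots> = sum ((\<lambda>j. real j * x (?w j)) \<circ> ?w) {1..n}"
    by (rule sum.permute[OF block_reversal_permutes[OF assms]])
  finally show ?thesis by (simp add: inv)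
qed

section \<open>Bounds for the pairing with the one-parameter subgroup\<close>

lemma sum_distinct_le:
  fixes A :: "nat set"
  assumes "A \<subseteq> {..<n}"
  shows "\<Sum>A \<le> (\<Sum>j<card A. n - 1 - j)"
  using assms
proof (induction "card A" arbitrary: A n)
  case 0
  then have "A = {}" using finite_subset by fastforce
  then show ?case by simp
next
  case (Suc m)
  have fin: "finite A" using Suc.prems finite_subset by blast
  have ne: "A \<noteq> {}" using Suc.hyps(2) by auto
  \<comment> \<open>The largest element is at most \<open>n - 1\<close>, and the others lie strictly
    below it, hence below \<open>n - 1\<close>.\<close>
  define M where "M = Max A"
  have M: "M \<in> A" "M \<le> n - 1" using Max_in[OF fin ne] Suc.prems unfolding M_def by auto
  have "A - {M} \<subseteq> {..<n - 1}"
  proof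
    fix a assume "a \<in> A - {M}"
    then have "a < M" using Max_ge[OF fin, of a] by (auto simp: M_def)
    then show "a \<in> {..<n - 1}" using M by simp
  qed
  then have "\<Sum>(A - {M}) \<le> (\<Sum>j<m. n - 1 - 1 - j)" using Suc.hyps M fin by (metis card_Diff_singleton diff_Suc_1)
  moreover have "\<Sum>A = M + \<Sum>(A - {M})" using M fin by (simp add: sum.remove)
  moreover have "(\<Sum>j<Suc m. n - 1 - j) = n - 1 + (\<Sum>j<m. n - 1 - 1 - j)"
    unfolding sum.lessThan_Suc_shift by simp
  ultimately show ?case using M unfolding Suc.hyps(2)[symmetric] by linarith
qed

text \<open>Summation by parts: the differences of the partial sums are nonnegative and so are the
  decrements of \<open>c\<close>. The boundary term disappears because the totals agree, so
  \<open>c\<close> may take negative values.\<close>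

lemma abel_summation_mono:
  fixes a b :: "nat \<Rightarrow> real"
  assumes c: "\<And>l. Suc l < n \<Longrightarrow> c (Suc l) \<le> c l"
    and ab: "\<And>m. m \<le> n \<Longrightarrow> (\<Sum>l<m. a l) \<le> (\<Sum>l<m. b l)" "(\<Sum>l<n. a l) = (\<Sum>l<n. b l)"
  shows "(\<Sum>l<n. c l * a l) \<le> (\<Sum>l<n. c l * b l)"
proof (cases n)
  case (Suc n')
  define D where "D m = (\<Sum>l<m. b l - a l)" for m
  have D: "D m \<ge> 0" if "m \<le> n" for m using ab(1)[OF that] by (simp add: D_def sum_subtractf)
  have "c m * D (Suc m) \<le> (\<Sum>l<Suc m. c l * (b l - a l))" if "m < n" for m
    using that
  proof (induction m)
    case (Suc m)
    have "c (Suc m) * D (Suc m) \<le> c m * D (Suc m)" using c Suc.prems D by (intro mult_right_mono) auto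
    moreover have "c (Suc m) * D (Suc (Suc m)) = c (Suc m) * D (Suc m) + c (Suc m) * (b (Suc m) - a (Suc m))"
      by (simp add: D_def algebra_simps)
    moreover have "(\<Sum>l<Suc (Suc m). c l * (b l - a l)) =
        (\<Sum>l<Suc m. c l * (b l - a l)) + c (Suc m) * (b (Suc m) - a (Suc m))"
      by (rule sum.lessThan_Suc)
    moreover have "c m * D (Suc m) \<le> (\<Sum>l<Suc m. c l * (b l - a l))" using Suc by simp
    ultimately show ?case by linarith
  qed (simp add: D_def)
  from this[of n'] Suc have "c n' * D n \<le> (\<Sum>l<n. c l * (b l - a l))" by simp
  moreover have "D n = 0" using ab(2) by (simp add: D_def sum_subtractf)
  ultimately show ?thesis by (simp add: algebra_simps sum_subtractf)
qed simp

text \<open>After the prescribed block \<open>r, ..., 0\<close> the values of \<open>w\<close> are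
  distinct numbers below \<open>n\<close>, so their partial sums are at most those of
  \<open>n - 1, n - 2, ...\<close>. Against decreasing coefficients the pairing is largest for the
  sequence \<open>v\<close>, which is the block reversal for \<open>Suc r\<close> with positions and
  values counted from zero.\<close>

lemma deep_chamber_pairing_negative:
  assumes x: "x \<in> deep_chamber n"
    and w: "inj_on w {..<n}" "w ` {..<n} \<subseteq> {..<n}"
    and r: "r < n - 1" "\<And>l. l \<le> r \<Longrightarrow> w l = r - l"
  shows "(\<Sum>l<n. real (Suc (w l)) * x (Suc l)) < 0"
proof -
  define v where "v l = (if l \<le> r then r - l else n + r - l)" for l
  have dec: "x (Suc (Suc l)) \<le> x (Suc l)" if "Suc l < n" for l
    using x that by (force simp: deep_chamber_def regular_dominant_def)
  have le: "(\<Sum>l<m. w l) \<le> (\<Sum>l<m. v l)" if m: "m \<le> n" for m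
  proof (cases "m \<le> Suc r")
    case True
    then have "(\<Sum>l<m. w l) = (\<Sum>l<m. v l)" by (intro sum.cong) (auto simp: v_def r)
    then show ?thesis by simp
  next
    case False
    have split: "(\<Sum>l<m. f l) = (\<Sum>l<Suc r. f l) + (\<Sum>l\<in>{Suc r..<m}. f l)" for f :: "nat \<Rightarrow> nat"
      using False sum.atLeastLessThan_concat[of 0 "Suc r" m f] by (simp add: lessThan_atLeast0)
    have 1: "(\<Sum>l<Suc r. w l) = (\<Sum>l<Suc r. v l)" by (intro sum.cong) (auto simp: v_def r)
    have inj: "inj_on w {Suc r..<m}" by (rule inj_on_subset[OF w(1)]) (use m in auto)
    have "(\<Sum>l\<in>{Suc r..<m}. w l) = \<Sum>(w ` {Suc r..<m})" by (simp add: sum.reindex[OF inj])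
    also have "\<dots> \<le> (\<Sum>j<card (w ` {Suc r..<m}). n - 1 - j)"
      by (rule sum_distinct_le) (use w(2) m in \<open>force simp: image_subset_iff\<close>)
    also have "\<dots> = (\<Sum>j<m - Suc r. n - 1 - j)" by (simp add: card_image[OF inj])
    also have "\<dots> = (\<Sum>l\<in>{Suc r..<m}. v l)"
    proof -
      have "(\<Sum>l\<in>{Suc r..<m}. v l) = (\<Sum>j\<in>{0..<m - Suc r}. v (j + Suc r))"
        using sum.shift_bounds_nat_ivl[of v 0 "Suc r" "m - Suc r"] False by simp
      also have "\<dots> = (\<Sum>j<m - Suc r. n - 1 - j)"
        unfolding lessThan_atLeast0 by (intro sum.cong) (auto simp: v_def)
      finally show ?thesis by simp
    qed
    finally show ?thesis unfolding split 1 by simp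
  qed
  have img: "w ` {..<n} = {..<n}" using w by (intro endo_inj_surj) auto
  have injv: "inj_on v {..<n}" using r(1) by (auto simp: inj_on_def v_def split: if_splits)
  have "v ` {..<n} \<subseteq> {..<n}" using r(1) by (auto simp: v_def split: if_splits)
  then have imgv: "v ` {..<n} = {..<n}" using injv by (intro endo_inj_surj) auto
  have eq: "(\<Sum>l<n. w l) = (\<Sum>l<n. v l)"
    using sum.reindex[OF w(1), of "\<lambda>j. j"] sum.reindex[OF injv, of "\<lambda>j. j"] by (simp add: img imgv)
  have "(\<Sum>l<n. x (Suc l) * real (Suc (w l))) \<le> (\<Sum>l<n. x (Suc l) * real (Suc (v l)))"
  proof (rule abel_summation_mono)
    show "(\<Sum>l<m. real (Suc (w l))) \<le> (\<Sum>l<m. real (Suc (v l)))" if "m \<le> n" for m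
      using le[OF that] by (simp add: sum.distrib flip: of_nat_sum)
    show "(\<Sum>l<n. real (Suc (w l))) = (\<Sum>l<n. real (Suc (v l)))"
      using eq by (simp add: sum.distrib flip: of_nat_sum)
  qed (rule dec)
  also have "\<dots> = (\<Sum>i=1..n. real (block_reversal n (Suc r) i) * x i)"
  proof -
    have "(\<Sum>i=1..n. real (block_reversal n (Suc r) i) * x i) =
        (\<Sum>l\<in>{0..<n}. real (block_reversal n (Suc r) (Suc l)) * x (Suc l))"
      using sum.shift_bounds_Suc_ivl[of "\<lambda>i. real (block_reversal n (Suc r) i) * x i" 0 n]
      by (simp add: atLeastLessThanSuc_atLeastAtMost)
    also have "\<dots> = (\<Sum>l<n. x (Suc l) * real (Suc (v l)))"
      unfolding lessThan_atLeast0 using r(1)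
      by (intro sum.cong) (auto simp: block_reversal_def v_def Suc_diff_le)
    finally show ?thesis by simp
  qed
  also have "\<dots> < 0"
  proof -
    have r': "Suc r \<in> {1..<n}" "Suc r \<le> n" using r(1) by auto
    have "lambda_pairing n (weyl_act (longest_element n ({1..<n} - {Suc r})) x) < 0"
      using x r'(1) unfolding deep_chamber_def by blast
    then show ?thesis unfolding lambda_pairing_block_reversal[OF r'(2)] .
  qed
  finally show ?thesis by (simp add: mult.commute)
qed

text \<open>This is the weight at \<open>w\<^sub>0 B\<close>. Since the coordinates sum to zero, the
  coefficients may be centred; pairing \<open>l\<close> with its mirror index then gives products of
  two factors of equal sign.\<close>

lemma regular_dominant_pairing_positive:
  assumes x: "x \<in> regular_dominant n" and n: "n \<ge> 2"
  shows "(\<Sum>l<n. real (n - l) * x (Suc l)) > 0"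
proof -
  define y where "y l = x (Suc l)" for l
  have step: "y (Suc l) < y l" if "Suc l < n" for l
    using x that by (auto simp: regular_dominant_def y_def)
  have anti: "y b \<le> y a" if "a \<le> b" "b < n" for a b
    using that
  proof (induction b)
    case (Suc b)
    then show ?case using step[of b] by (cases "a = Suc b") auto
  qed simp
  have "y (n - 1) \<le> y (Suc 0)" by (rule anti) (use n in auto)
  then have strict: "y (n - 1) < y 0" using step[of 0] n by simp
  have "(\<Sum>i=1..n. x i) = (\<Sum>l\<in>{0..<n}. y l)"
    using sum.shift_bounds_Suc_ivl[of x 0 n] by (simp add: y_def atLeastLessThanSuc_atLeastAtMost)
  then have sum0: "(\<Sum>l<n. y l) = 0" using x by (simp add: regular_dominant_def lessThan_atLeast0)
  define S where "S = (\<Sum>l<n. real (n - l) * y l)"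
  \<comment> \<open>The coefficients \<open>n - l\<close> are doubled and lowered by
    \<open>n + 1\<close>, which makes them antisymmetric under the exchange of \<open>l\<close> and
    \<open>n - 1 - l\<close>.\<close>
  define T where "T = (\<Sum>l<n. (real n - 1 - 2 * real l) * y l)"
  have "T = (\<Sum>l<n. 2 * (real (n - l) * y l) - (real n + 1) * y l)"
    unfolding T_def by (intro sum.cong) (auto simp: of_nat_diff algebra_simps)
  also have "\<dots> = 2 * S" by (simp add: sum_subtractf S_def sum0 flip: sum_distrib_left)
  finally have 1: "T = 2 * S" .
  have "T = (\<Sum>l<n. (real n - 1 - 2 * real (n - Suc l)) * y (n - Suc l))"
    unfolding T_def by (rule sum.nat_diff_reindex[symmetric])
  also have "\<dots> = (\<Sum>l<n. - ((real n - 1 - 2 * real l) * y (n - Suc l)))"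
    by (intro sum.cong) (auto simp: of_nat_diff algebra_simps)
  finally have "T + T = (\<Sum>l<n. (real n - 1 - 2 * real l) * (y l - y (n - Suc l)))"
    by (subst (1) T_def) (simp add: algebra_simps flip: sum.distrib)
  also have "\<dots> > 0"
  proof (rule sum_pos2[of _ 0])
    show "0 < (real n - 1 - 2 * real 0) * (y 0 - y (n - Suc 0))" using strict n by (intro mult_pos_pos) auto
    show "0 \<le> (real n - 1 - 2 * real l) * (y l - y (n - Suc l))" if "l \<in> {..<n}" for l
    proof (cases "2 * l \<le> n - 1")
      case True
      then show ?thesis using anti[of l "n - Suc l"] that n by (intro mult_nonneg_nonneg) auto
    next
      case False
      then show ?thesis using anti[of "n - Suc l" l] that n by (intro mult_nonpos_nonpos) auto
    qed
  qed (use n in auto)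
  finally show ?thesis using 1 by (simp add: S_def y_def)
qed

section \<open>Flags\<close>

lemma times_mat_entry:
  assumes "A \<in> carrier_mat n m" "B \<in> carrier_mat m k" "i < n" "j < k"
  shows "(A * B) $$ (i, j) = (\<Sum>l<m. A $$ (i, l) * B $$ (l, j))"
  using assms by (simp add: scalar_prod_def lessThan_atLeast0)

lemma square_mult_carrier:
  "A \<in> carrier_mat n n \<Longrightarrow> B \<in> carrier_mat n n \<Longrightarrow> A * B \<in> carrier_mat n n"
  by (rule mult_carrier_mat)

lemma square_mult_assoc:
  fixes A :: "'a :: semiring_0 mat"
  shows "A \<in> carrier_mat n n \<Longrightarrow> B \<in> carrier_mat n n \<Longrightarrow> C \<in> carrier_mat n n \<Longrightarrow> A * B * C = A * (B * C)"
  by (rule assoc_mult_mat)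

lemma GL_iff_det: "g \<in> GL n \<longleftrightarrow> g \<in> carrier_mat n n \<and> det g \<noteq> 0"
proof
  assume g: "g \<in> GL n"
  then obtain h where h: "g * h = 1\<^sub>m n" "h * g = 1\<^sub>m (dim_row h)" and gc: "g \<in> carrier_mat n n"
    unfolding GL_def invertible_mat_def inverts_mat_def by auto
  \<comment> \<open>\<open>invertible_mat\<close> does not fix the size of the inverse; it is read
    off from the sizes of the two identity matrices.\<close>
  have "dim_col h = n" using arg_cong[OF h(1), of dim_col] by simp
  moreover have "dim_row h = n" using arg_cong[OF h(2), of dim_col] gc by simp
  ultimately have hc: "h \<in> carrier_mat n n" by blast
  have "det g * det h = 1" using det_mult[OF gc hc] h(1) by simp
  then show "g \<in> carrier_mat n n \<and> det g \<noteq> 0" using gc by auto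
next
  assume g: "g \<in> carrier_mat n n \<and> det g \<noteq> 0"
  then have "g \<in> Units (ring_mat TYPE(complex) n ())" by (intro det_non_zero_imp_unit) auto
  then obtain h where "h \<in> carrier_mat n n" "h * g = 1\<^sub>m n" "g * h = 1\<^sub>m n"
    unfolding Units_def ring_mat_def by auto
  then have "invertible_mat g" using g unfolding invertible_mat_def inverts_mat_def by auto
  then show "g \<in> GL n" using g by (simp add: GL_def)
qed

lemma GL_carrier [simp]: "g \<in> GL n \<Longrightarrow> g \<in> carrier_mat n n"
  by (simp add: GL_def)

lemma GL_mult:
  assumes "g \<in> GL n" "h \<in> GL n"
  shows "g * h \<in> GL n"
proof -
  have *: "g \<in> carrier_mat n n" "h \<in> carrier_mat n n" using assms by simp_all
  have "det g \<noteq> 0" "det h \<noteq> 0" using assms GL_iff_det by blast+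
  then show ?thesis unfolding GL_iff_det det_mult[OF *] using * by simp
qed

lemma GL_inverse:
  assumes "g \<in> GL n"
  obtains h where "h \<in> GL n" "g * h = 1\<^sub>m n" "h * g = 1\<^sub>m n"
proof -
  have "g \<in> Units (ring_mat TYPE(complex) n ())" using assms GL_iff_det[of g n] by (intro det_non_zero_imp_unit) blast+
  then obtain h where h: "h \<in> carrier_mat n n" "h * g = 1\<^sub>m n" "g * h = 1\<^sub>m n"
    unfolding Units_def ring_mat_def by auto
  then have "inverts_mat h g" "inverts_mat g h"
    using carrier_matD(1)[OF h(1)] carrier_matD(1)[OF GL_carrier[OF assms]] by (simp_all add: inverts_mat_def)
  then have "invertible_mat h" using h(1) unfolding invertible_mat_def by auto
  then have "h \<in> GL n" using h(1) unfolding GL_def by simp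
  then show thesis using h that by blast
qed

lemma one_in_Borel: "1\<^sub>m n \<in> Borel n"
  unfolding Borel_def GL_iff_det by simp

lemma Borel_iff:
  "b \<in> Borel n \<longleftrightarrow> b \<in> carrier_mat n n \<and> (\<forall>i<n. \<forall>j<i. b $$ (i, j) = 0) \<and> (\<forall>i<n. b $$ (i, i) \<noteq> 0)"
proof -
  have "det b = 0 \<longleftrightarrow> (\<exists>i<n. b $$ (i, i) = 0)" if "b \<in> carrier_mat n n" "upper_triangular b"
    using upper_triangular_imp_det_eq_0_iff[OF that] that by (auto simp: diag_mat_def image_iff)
  then show ?thesis unfolding Borel_def GL_iff_det by (auto simp: upper_triangular_def)
qed

lemma Borel_carrier [simp]: "b \<in> Borel n \<Longrightarrow> b \<in> carrier_mat n n"
  unfolding Borel_iff by simp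

lemma Borel_lower: "b \<in> Borel n \<Longrightarrow> i < n \<Longrightarrow> j < i \<Longrightarrow> b $$ (i, j) = 0"
  unfolding Borel_iff by simp

lemma Borel_diag: "b \<in> Borel n \<Longrightarrow> i < n \<Longrightarrow> b $$ (i, i) \<noteq> 0"
  unfolding Borel_iff by simp

lemma Borel_GL: "b \<in> Borel n \<Longrightarrow> b \<in> GL n"
  by (simp add: Borel_def)

lemma upper_triangular_mult_diag:
  assumes "b \<in> Borel n" "c \<in> Borel n" "i < n"
  shows "(b * c) $$ (i, i) = b $$ (i, i) * c $$ (i, i)"
proof -
  have "(b * c) $$ (i, i) = (\<Sum>l<n. b $$ (i, l) * c $$ (l, i))"
    using assms by (intro times_mat_entry[of _ n n _ n]) auto
  also have "\<dots> = (\<Sum>l<n. if l = i then b $$ (i, i) * c $$ (i, i) else 0)"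
  proof (intro sum.cong refl)
    fix l assume "l \<in> {..<n}"
    then show "b $$ (i, l) * c $$ (l, i) = (if l = i then b $$ (i, i) * c $$ (i, i) else 0)"
      using assms by (cases l i rule: linorder_cases) (auto simp: Borel_lower Borel_diag)
  qed
  finally show ?thesis using assms(3) by simp
qed

lemma Borel_mult:
  assumes b: "b \<in> Borel n" and c: "c \<in> Borel n"
  shows "b * c \<in> Borel n"
  unfolding Borel_iff
proof (intro conjI allI impI)
  show "b * c \<in> carrier_mat n n" using b c by (intro square_mult_carrier) auto
  show "(b * c) $$ (i, i) \<noteq> 0" if "i < n" for i
    using upper_triangular_mult_diag[OF b c that] b c that by (simp add: Borel_lower Borel_diag)
  fix i j assume ij: "i < n" "j < i"
  have "(b * c) $$ (i, j) = (\<Sum>l<n. b $$ (i, l) * c $$ (l, j))"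
    using b c ij by (intro times_mat_entry[of _ n n _ n]) auto
  also have "\<dots> = 0"
  proof (intro sum.neutral ballI)
    fix l assume "l \<in> {..<n}"
    then show "b $$ (i, l) * c $$ (l, j) = 0"
      using b c ij by (cases "l < i") (auto simp: Borel_lower Borel_diag)
  qed
  finally show "(b * c) $$ (i, j) = 0" .
qed

lemma Borel_inverse:
  assumes b: "b \<in> Borel n"
  obtains c where "c \<in> Borel n" "b * c = 1\<^sub>m n" "c * b = 1\<^sub>m n"
proof -
  obtain c where c: "c \<in> GL n" "b * c = 1\<^sub>m n" "c * b = 1\<^sub>m n" using GL_inverse[OF Borel_GL[OF b]] .
  have "upper_triangular c"
  proof (rule ccontr)
    assume "\<not> upper_triangular c"
    then obtain i j where ij: "i < n" "j < i" "c $$ (i, j) \<noteq> 0"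
      using carrier_matD(1)[OF GL_carrier[OF c(1)]] unfolding upper_triangular_def by auto
    \<comment> \<open>At the lowest nonzero entry below the diagonal in column \<open>j\<close>, the
      product \<open>b * c\<close> has a single nonzero term, with a diagonal entry of
      \<open>b\<close> as factor, which contradicts the identity matrix.\<close>
    define I where "I = {i. i < n \<and> j < i \<and> c $$ (i, j) \<noteq> 0}"
    define r where "r = Max I"
    have fin: "finite I" "I \<noteq> {}" using ij unfolding I_def by auto
    have r: "r < n" "j < r" "c $$ (r, j) \<noteq> 0" using Max_in[OF fin] by (auto simp: r_def I_def)
    have max: "c $$ (l, j) = 0" if "r < l" "l < n" for l
    proof (rule ccontr)
      assume "c $$ (l, j) \<noteq> 0"
      then have "l \<in> I" using that r(2) by (simp add: I_def)
      then show False using Max_ge[OF fin(1), of l] that(1) by (simp add: r_def)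
    qed
    have "(b * c) $$ (r, j) = (\<Sum>l<n. b $$ (r, l) * c $$ (l, j))"
      using b c r by (intro times_mat_entry[of _ n n _ n]) auto
    also have "\<dots> = (\<Sum>l<n. if l = r then b $$ (r, r) * c $$ (r, j) else 0)"
    proof (intro sum.cong refl)
      fix l assume "l \<in> {..<n}"
      then show "b $$ (r, l) * c $$ (l, j) = (if l = r then b $$ (r, r) * c $$ (r, j) else 0)"
        using b r max[of l] by (cases l r rule: linorder_cases) (auto simp: Borel_lower Borel_diag)
    qed
    also have "\<dots> \<noteq> 0" using r b by (simp add: Borel_lower Borel_diag)
    finally show False using c(2) r by simp
  qed
  then show thesis using c that by (auto simp: Borel_def)
qed

section \<open>Flags as cosets and the Hessenberg condition\<close>

lemma flag_point_self: "g \<in> GL n \<Longrightarrow> g \<in> flag_point n g"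
  unfolding flag_point_def by (intro CollectI exI[of _ "1\<^sub>m n"]) (simp add: one_in_Borel right_mult_one_mat[of _ n n])

lemma flag_point_mult_Borel:
  assumes g: "g \<in> GL n" and b: "b \<in> Borel n"
  shows "flag_point n (g * b) = flag_point n g"
proof -
  obtain c where c: "c \<in> Borel n" "b * c = 1\<^sub>m n" "c * b = 1\<^sub>m n" using Borel_inverse[OF b] .
  have assoc: "g * b * x = g * (b * x)" if "x \<in> Borel n" for x
    using g b that by (intro square_mult_assoc[of _ n]) auto
  show ?thesis
  proof (intro equalityI subsetI)
    fix x assume "x \<in> flag_point n (g * b)"
    then show "x \<in> flag_point n g" using Borel_mult[OF b] assoc by (auto simp: flag_point_def)
  next
    fix x assume "x \<in> flag_point n g"
    then obtain y where y: "y \<in> Borel n" "x = g * y" by (auto simp: flag_point_def)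
    have "b * (c * y) = b * c * y" using b c y by (intro square_mult_assoc[of _ n, symmetric]) auto
    also have "\<dots> = y" unfolding c(2) using y by (intro left_mult_one_mat[of _ n n]) simp
    finally have "x = g * b * (c * y)" using y(2) assoc[of "c * y"] Borel_mult[OF c(1) y(1)] by simp
    then show "x \<in> flag_point n (g * b)" using Borel_mult[OF c(1) y(1)] by (auto simp: flag_point_def)
  qed
qed

lemma flag_point_mem: "g \<in> GL n \<Longrightarrow> h \<in> flag_point n g \<Longrightarrow> h \<in> GL n \<and> flag_point n h = flag_point n g"
  by (auto simp: flag_point_def[of n g] flag_point_mult_Borel GL_mult Borel_GL)

lemma flag_point_eqD:
  assumes "g \<in> GL n" "flag_point n g = flag_point n g'"
  shows "\<exists>b\<in>Borel n. g = g' * b"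
proof -
  have "g \<in> flag_point n g'" using flag_point_self[OF assms(1)] assms(2) by simp
  then show ?thesis by (auto simp: flag_point_def)
qed

definition hessenberg :: "nat \<Rightarrow> complex mat \<Rightarrow> bool"
  where "hessenberg n H \<longleftrightarrow> H \<in> carrier_mat n n \<and> (\<forall>i<n. \<forall>j<n. i > j + 1 \<longrightarrow> H $$ (i, j) = 0)"

lemma nilp_carrier [simp]: "nilp n \<in> carrier_mat n n"
  by (simp add: nilp_def)

lemma hessenberg_conj:
  assumes H: "hessenberg n H" and b: "b \<in> Borel n" and c: "c \<in> Borel n"
  shows "hessenberg n (c * H * b)"
proof -
  have 1: "hessenberg n (c * H)"
    unfolding hessenberg_def
  proof (intro conjI allI impI)
    show "c * H \<in> carrier_mat n n" using H c by (intro square_mult_carrier) (auto simp: hessenberg_def)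
    fix i j assume ij: "i < n" "j < n" "i > j + 1"
    have "(c * H) $$ (i, j) = (\<Sum>l<n. c $$ (i, l) * H $$ (l, j))"
      using H c ij by (intro times_mat_entry[of _ n n _ n]) (auto simp: hessenberg_def)
    also have "\<dots> = 0"
    proof (intro sum.neutral ballI)
      fix l assume "l \<in> {..<n}"
      then show "c $$ (i, l) * H $$ (l, j) = 0"
        using H c ij by (cases "l < i") (auto simp: Borel_lower Borel_diag hessenberg_def)
    qed
    finally show "(c * H) $$ (i, j) = 0" .
  qed
  show ?thesis
    unfolding hessenberg_def
  proof (intro conjI allI impI)
    show "c * H * b \<in> carrier_mat n n" by (rule square_mult_carrier) (use 1 b in \<open>auto simp: hessenberg_def\<close>)
    fix i j assume ij: "i < n" "j < n" "i > j + 1"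
    have "(c * H * b) $$ (i, j) = (\<Sum>l<n. (c * H) $$ (i, l) * b $$ (l, j))"
      using 1 b ij by (intro times_mat_entry[of _ n n _ n]) (auto simp: hessenberg_def)
    also have "\<dots> = 0"
    proof (intro sum.neutral ballI)
      fix l assume "l \<in> {..<n}"
      then show "(c * H) $$ (i, l) * b $$ (l, j) = 0"
        using 1 b ij by (cases "l \<le> j") (auto simp: Borel_lower Borel_diag hessenberg_def)
    qed
    finally show "(c * H * b) $$ (i, j) = 0" .
  qed
qed

text \<open>\<open>Pet\<close> asks for some representative of the coset; conjugation by
  \<open>B\<close> preserves Hessenberg matrices, so any representative may be tested. The form
  \<open>N g = g H\<close> avoids the inverse of \<open>g\<close>.\<close>

lemma flag_point_in_Pet_iff:
  assumes g: "g \<in> GL n"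
  shows "flag_point n g \<in> Pet n \<longleftrightarrow> (\<exists>H. hessenberg n H \<and> nilp n * g = g * H)"
proof
  assume "flag_point n g \<in> Pet n"
  then obtain g' h where *: "flag_point n g = flag_point n g'" "g' \<in> GL n" "h \<in> carrier_mat n n"
    "inverts_mat g' h" "\<forall>i<n. \<forall>j<n. i > j + 1 \<longrightarrow> (h * nilp n * g') $$ (i, j) = 0"
    unfolding Pet_def by blast
  define H where "H = h * nilp n * g'"
  have Hc: "H \<in> carrier_mat n n" unfolding H_def using * by (intro square_mult_carrier) auto
  have H: "hessenberg n H" using * Hc by (simp add: hessenberg_def H_def)
  have gh: "g' * h = 1\<^sub>m n" using *(4) carrier_matD(1)[OF GL_carrier[OF *(2)]] by (simp add: inverts_mat_def)
  have eq: "g' * H = nilp n * g'"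
  proof -
    have "g' * H = g' * h * nilp n * g'"
      unfolding H_def using * by (simp add: square_mult_assoc[of _ n] square_mult_carrier)
    then show ?thesis unfolding gh by (simp add: left_mult_one_mat[of _ n n])
  qed
  obtain b where b: "b \<in> Borel n" "g = g' * b" using flag_point_eqD[OF g *(1)] by blast
  obtain c where c: "c \<in> Borel n" "b * c = 1\<^sub>m n" using Borel_inverse[OF b(1)] .
  have "nilp n * g = nilp n * g' * b" unfolding b(2) using *(2) b by (simp add: square_mult_assoc[of _ n] square_mult_carrier)
  also have "\<dots> = g' * H * b" by (simp add: eq)
  also have "\<dots> = g' * (b * c) * H * b" unfolding c(2) right_mult_one_mat[OF GL_carrier[OF *(2)]] ..
  also have "\<dots> = g * (c * H * b)" unfolding b(2) using *(2) b(1) c(1) Hc by (simp add: square_mult_assoc[of _ n] square_mult_carrier)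
  finally show "\<exists>H. hessenberg n H \<and> nilp n * g = g * H" using hessenberg_conj[OF H b(1) c(1)] by blast
next
  assume "\<exists>H. hessenberg n H \<and> nilp n * g = g * H"
  then obtain H where H: "hessenberg n H" "nilp n * g = g * H" by blast
  obtain h where h: "h \<in> GL n" "g * h = 1\<^sub>m n" "h * g = 1\<^sub>m n" using GL_inverse[OF g] .
  have Hc: "H \<in> carrier_mat n n" using H by (simp add: hessenberg_def)
  have "h * nilp n * g = h * (g * H)" unfolding H(2)[symmetric] using g h(1) by (simp add: square_mult_assoc[of _ n] square_mult_carrier)
  also have "\<dots> = h * g * H" using g h(1) Hc by (simp add: square_mult_assoc[of _ n] square_mult_carrier)
  also have "\<dots> = H" unfolding h(3) using Hc by simp
  finally have "h * nilp n * g = H" .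
  moreover have "inverts_mat g h" "inverts_mat h g"
    using h carrier_matD(1)[OF GL_carrier[OF g]] carrier_matD(1)[OF GL_carrier[OF h(1)]]
    by (simp_all add: inverts_mat_def)
  ultimately show "flag_point n g \<in> Pet n"
    unfolding Pet_def using g h(1) H(1)
    by (intro CollectI exI[of _ g] exI[of _ h] conjI) (simp_all add: hessenberg_def)
qed

lemma nilp_mult_entry:
  assumes "g \<in> carrier_mat n m" "i < n" "j < m"
  shows "(nilp n * g) $$ (i, j) = (if Suc i < n then g $$ (Suc i, j) else 0)"
proof -
  have "(nilp n * g) $$ (i, j) = (\<Sum>l<n. nilp n $$ (i, l) * g $$ (l, j))"
    using assms by (intro times_mat_entry[of _ n n _ m]) auto
  also have "\<dots> = (\<Sum>l<n. if l = Suc i then g $$ (l, j) else 0)"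
    using assms(2) by (intro sum.cong) (auto simp: nilp_def)
  finally show ?thesis by simp
qed

lemma lam_mult_entry:
  assumes "g \<in> carrier_mat n m" "i < n" "j < m"
  shows "(lam n t * g) $$ (i, j) = t ^ Suc i * g $$ (i, j)"
proof -
  have "(lam n t * g) $$ (i, j) = (\<Sum>l<n. lam n t $$ (i, l) * g $$ (l, j))"
    using assms by (intro times_mat_entry[of _ n n _ m]) (auto simp: lam_def)
  also have "\<dots> = (\<Sum>l<n. if l = i then t ^ Suc i * g $$ (i, j) else 0)"
    using assms(2) by (intro sum.cong) (auto simp: lam_def)
  finally show ?thesis using assms(2) by simp
qed

lemma lam_in_Borel: "t \<noteq> 0 \<Longrightarrow> lam n t \<in> Borel n"
  unfolding Borel_iff by (auto simp: lam_def)

lemma lam_carrier [simp]: "lam n t \<in> carrier_mat n n"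
  by (simp add: lam_def)

lemma lam_in_GL: "t \<noteq> 0 \<Longrightarrow> lam n t \<in> GL n"
  by (intro Borel_GL lam_in_Borel)

lemma flag_act_flag_point:
  assumes "h \<in> GL n" "g \<in> GL n"
  shows "flag_act h (flag_point n g) = flag_point n (h * g)"
proof -
  have "h * (g * b) = h * g * b" if "b \<in> Borel n" for b
    using assms that by (intro square_mult_assoc[of _ n, symmetric]) auto
  then have "(\<lambda>x. h * x) (g * b) = h * g * b" if "b \<in> Borel n" for b using that by simp
  then show ?thesis unfolding flag_act_def flag_point_def Setcompr_eq_image image_image by (intro image_cong) auto
qed

lemma lam_Pet:
  assumes g: "g \<in> GL n" "flag_point n g \<in> Pet n" and t: "t \<noteq> 0"
  shows "flag_point n (lam n t * g) \<in> Pet n"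
proof -
  have gl: "lam n t * g \<in> GL n" by (intro GL_mult lam_in_GL t g)
  obtain H where H: "hessenberg n H" "nilp n * g = g * H" using g flag_point_in_Pet_iff by blast
  have Hc: "H \<in> carrier_mat n n" using H by (simp add: hessenberg_def)
  have gc: "g \<in> carrier_mat n n" using g(1) by simp
  have lc: "lam n t * g \<in> carrier_mat n n" using gl by simp
  \<comment> \<open>The torus normalizes the line spanned by the nilpotent matrix: moving
    \<open>lam n t\<close> past \<open>nilp n\<close> costs a factor \<open>t\<close>, which is
    absorbed in \<open>H\<close>.\<close>
  have "nilp n * (lam n t * g) = (lam n t * g) * (t \<cdot>\<^sub>m H)"
  proof (rule eq_matI)
    fix i j assume "i < dim_row (lam n t * g * (t \<cdot>\<^sub>m H))" "j < dim_col (lam n t * g * (t \<cdot>\<^sub>m H))"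
    then have ij: "i < n" "j < n" using Hc by (auto simp: lam_def)
    have "(nilp n * (lam n t * g)) $$ (i, j) = t * (t ^ Suc i * (nilp n * g) $$ (i, j))"
      using nilp_mult_entry[OF lc ij] nilp_mult_entry[OF gc ij] lam_mult_entry[OF gc, of "Suc i" j t] ij by simp
    also have "\<dots> = (\<Sum>l<n. (lam n t * g) $$ (i, l) * (t * H $$ (l, j)))"
      unfolding H(2) times_mat_entry[OF gc Hc ij] sum_distrib_left
      using lam_mult_entry[OF gc ij(1)] by (intro sum.cong) auto
    also have "\<dots> = ((lam n t * g) * (t \<cdot>\<^sub>m H)) $$ (i, j)"
      using times_mat_entry[OF lc smult_carrier_mat[OF Hc, of t] ij] Hc ij by simp
    finally show "(nilp n * (lam n t * g)) $$ (i, j) = ((lam n t * g) * (t \<cdot>\<^sub>m H)) $$ (i, j)" .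
  qed (use Hc gc in \<open>auto simp: lam_def nilp_def\<close>)
  moreover have "hessenberg n (t \<cdot>\<^sub>m H)" using H(1) by (auto simp: hessenberg_def)
  ultimately show ?thesis using flag_point_in_Pet_iff[OF gl] by blast
qed

section \<open>Pivots\<close>

text \<open>
  For \<open>\<sigma> = id\<close> the coordinate flag of \<open>w\<close> is the limit of \<open>\<lambda>(t) g B\<close> for \<open>t\<close> tending to infinity, for
  an order-reversing \<open>\<sigma>\<close> the limit at \<open>t = 0\<close>.
\<close>

definition pivots :: "nat \<Rightarrow> (nat \<Rightarrow> nat) \<Rightarrow> (nat \<Rightarrow> nat) \<Rightarrow> complex mat \<Rightarrow> bool"
  where "pivots n \<sigma> w g \<longleftrightarrow> w ` {..<n} \<subseteq> {..<n} \<and> inj_on w {..<n} \<and>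
    (\<forall>l<n. g $$ (w l, l) = 1 \<and> (\<forall>i<n. g $$ (i, l) \<noteq> 0 \<longrightarrow> \<sigma> i \<le> \<sigma> (w l)))"

text \<open>Among all combinations of the columns up to \<open>l\<close> with coefficient
  \<open>1\<close> at \<open>l\<close>, one is chosen whose leading row is smallest with respect to
  \<open>\<sigma>\<close>. If two columns had the same leading row, subtracting a multiple of the
  earlier would lower the later one, so the pivots are distinct. This is the Bruhat decomposition
  for the row order \<open>\<sigma>\<close>.\<close>

lemma pivots_exist:
  assumes g: "g \<in> GL n" and \<sigma>: "inj_on \<sigma> {..<n}"
  shows "\<exists>b\<in>Borel n. \<exists>w. pivots n \<sigma> w (g * b)"
proof -
  obtain h where h: "h \<in> GL n" "h * g = 1\<^sub>m n" using GL_inverse[OF g] by blast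
  have hc: "h \<in> carrier_mat n n" and gc: "g \<in> carrier_mat n n" using h(1) g by simp_all
  define u where "u c i = (\<Sum>m<n. g $$ (i, m) * c m)" for c :: "nat \<Rightarrow> complex" and i
  define C where "C l = {c :: nat \<Rightarrow> complex. c l = 1 \<and> (\<forall>m>l. c m = 0)}" for l :: nat
  \<comment> \<open>\<open>u c\<close> is the combination of the columns with coefficients
    \<open>c\<close>, and \<open>T l c i\<close> records that \<open>i\<close> is its leading row
    and that \<open>c\<close> is admissible for column \<open>l\<close>.\<close>
  define T where "T l c i \<longleftrightarrow> c \<in> C l \<and> i < n \<and> u c i \<noteq> 0 \<and> (\<forall>j<n. u c j \<noteq> 0 \<longrightarrow> \<sigma> j \<le> \<sigma> i)" for l c i
  have T: "\<exists>i. T l c i" if c: "c \<in> C l" and l: "l < n" for l c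
  proof -
    define I where "I = {i. i < n \<and> u c i \<noteq> 0}"
    have "I \<noteq> {}"
    proof
      assume "I = {}"
      then have 0: "u c i = 0" if "i < n" for i using that by (auto simp: I_def)
      \<comment> \<open>The inverse recovers the coefficient \<open>c l = 1\<close> from
        \<open>u c\<close>, so the combination cannot vanish.\<close>
      have "(\<Sum>i<n. h $$ (l, i) * u c i) = (\<Sum>m<n. (\<Sum>i<n. h $$ (l, i) * g $$ (i, m)) * c m)"
        unfolding u_def sum_distrib_left sum_distrib_right mult.assoc by (rule sum.swap)
      also have "\<dots> = (\<Sum>m<n. if m = l then c l else 0)"
        using times_mat_entry[OF hc gc l, symmetric] l by (intro sum.cong) (auto simp: h(2))
      also have "\<dots> = 1" using c l by (simp add: C_def)
      finally show False using 0 by simp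
    qed
    moreover have "finite I" by (auto simp: I_def)
    ultimately have "\<sigma> ` I \<noteq> {}" "finite (\<sigma> ` I)" by auto
    from Max_in[OF this(2,1)] obtain i where "i \<in> I" "\<sigma> i = Max (\<sigma> ` I)" by auto
    moreover have "\<sigma> j \<le> Max (\<sigma> ` I)" if "j \<in> I" for j using that \<open>finite I\<close> by simp
    ultimately show ?thesis using c by (auto simp: T_def I_def intro!: exI[of _ i])
  qed
  have "\<exists>c i. T l c i \<and> (\<forall>c' i'. T l c' i' \<longrightarrow> \<sigma> i \<le> \<sigma> i')" if l: "l < n" for l
  proof -
    have "(\<lambda>m. if m = l then 1 else 0) \<in> C l" by (auto simp: C_def)
    then obtain c i where "T l c i" using T[OF _ l] by blast
    then have "\<exists>k c i. T l c i \<and> \<sigma> i = k" by blast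
    define k where "k = (LEAST k. \<exists>c i. T l c i \<and> \<sigma> i = k)"
    have "\<exists>c i. T l c i \<and> \<sigma> i = k" unfolding k_def by (rule LeastI_ex) fact
    moreover have "k \<le> \<sigma> i'" if "T l c' i'" for c' i' unfolding k_def by (rule Least_le) (use that in blast)
    ultimately show ?thesis by blast
  qed
  then have "\<forall>l. \<exists>p. l < n \<longrightarrow> T l (fst p) (snd p) \<and> (\<forall>c' i'. T l c' i' \<longrightarrow> \<sigma> (snd p) \<le> \<sigma> i')" by fastforce
  from choice[OF this] obtain p where p: "\<And>l. l < n \<Longrightarrow> T l (fst (p l)) (snd (p l))"
    "\<And>l c' i'. l < n \<Longrightarrow> T l c' i' \<Longrightarrow> \<sigma> (snd (p l)) \<le> \<sigma> i'" by blast
  define c where "c l = fst (p l)" for l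
  define w where "w l = snd (p l)" for l
  have Tc: "T l (c l) (w l)" if "l < n" for l using p(1)[OF that] by (simp add: c_def w_def)
  have least: "\<sigma> (w l) \<le> \<sigma> i'" if "l < n" "T l c' i'" for l c' i' using p(2)[OF that] by (simp add: w_def)
  have ne: "w l \<noteq> w l'" if l: "l < l'" "l' < n" for l l'
  proof
    assume eq: "w l = w l'"
    have l1: "l < n" using l by simp
    define q where "q = u (c l') (w l) / u (c l) (w l)"
    define c' where "c' = (\<lambda>m. c l' m - q * c l m)"
    have "c' \<in> C l'" using Tc[OF l1] Tc[OF l(2)] l by (auto simp: T_def C_def c'_def)
    then obtain i where i: "T l' c' i" using T l(2) by blast
    have u: "u c' j = u (c l') j - q * u (c l) j" for j
      by (simp add: u_def c'_def sum_subtractf sum_distrib_left algebra_simps)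
    have "u c' (w l) = 0" using Tc[OF l1] by (simp add: u q_def T_def)
    then have "i \<noteq> w l" using i by (auto simp: T_def)
    have "u (c l') i \<noteq> 0 \<or> u (c l) i \<noteq> 0" using i by (auto simp: T_def u)
    then have "\<sigma> i \<le> \<sigma> (w l)" using Tc[OF l1] Tc[OF l(2)] i eq by (auto simp: T_def)
    moreover have "\<sigma> i \<noteq> \<sigma> (w l)"
      using \<sigma> i Tc[OF l1] \<open>i \<noteq> w l\<close> by (auto simp: T_def inj_on_def)
    ultimately show False using least[OF l(2) i] eq by simp
  qed
  define b where "b = mat n n (\<lambda>(m, l). c l m / u (c l) (w l))"
  have b: "b \<in> Borel n"
    using Tc unfolding Borel_iff by (auto simp: b_def T_def C_def)
  have gb: "(g * b) $$ (i, l) = u (c l) i / u (c l) (w l)" if "i < n" "l < n" for i l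
    using times_mat_entry[OF gc Borel_carrier[OF b] that] that
    by (simp add: b_def u_def sum_divide_distrib)
  have "inj_on w {..<n}"
    unfolding inj_on_def using ne by (metis lessThan_iff linorder_neqE_nat)
  then have "pivots n \<sigma> w (g * b)"
    using Tc gb by (auto simp: pivots_def T_def)
  then show ?thesis using b by blast
qed

text \<open>In column \<open>l\<close> of \<open>N g = g H\<close>, let \<open>m\<close> have the
  \<open>\<sigma>\<close>-largest pivot among the columns entering with nonzero coefficient. No
  cancellation occurs in row \<open>w m\<close>, so \<open>w m\<close> is the leading row of the
  right side. The left side is column \<open>l\<close> shifted up, whose leading row is
  \<open>w l - 1\<close> because \<open>shift\<close> makes the order compatible with moving rows.
  The two rows agree, and the Hessenberg shape bounds \<open>m\<close>.\<close>

lemma pivots_step: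
  assumes g: "g \<in> GL n" and H: "hessenberg n H" "nilp n * g = g * H"
    and piv: "pivots n \<sigma> w g" and \<sigma>: "inj_on \<sigma> {..<n}"
    and shift: "\<And>i j. Suc i < n \<Longrightarrow> Suc j < n \<Longrightarrow> \<sigma> (Suc i) \<le> \<sigma> (Suc j) \<Longrightarrow> \<sigma> i \<le> \<sigma> j"
    and l: "l < n" "w l > 0"
  shows "\<exists>m\<le>Suc l. m < n \<and> w m = w l - 1"
proof -
  have gc: "g \<in> carrier_mat n n" using g by simp
  have Hc: "H \<in> carrier_mat n n" using H(1) by (simp add: hessenberg_def)
  have wn: "w m < n" if "m < n" for m using piv that by (auto simp: pivots_def)
  have one: "g $$ (w m, m) = 1" if "m < n" for m using piv that by (simp add: pivots_def)
  have top: "\<sigma> i \<le> \<sigma> (w m)" if "m < n" "i < n" "g $$ (i, m) \<noteq> 0" for i m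
    using piv that by (simp add: pivots_def)
  have inj: "m = m'" if "m < n" "m' < n" "w m = w m'" for m m'
    using piv that by (auto simp: pivots_def inj_on_def)
  have col: "(\<Sum>m<n. g $$ (i, m) * H $$ (m, l)) = (if Suc i < n then g $$ (Suc i, l) else 0)" if "i < n" for i
    using times_mat_entry[OF gc Hc that l(1)] nilp_mult_entry[OF gc that l(1)] H(2) by simp
  define M where "M = {m. m < n \<and> H $$ (m, l) \<noteq> 0}"
  have "(\<Sum>m<n. g $$ (w l - 1, m) * H $$ (m, l)) \<noteq> 0"
    using col[of "w l - 1"] wn[OF l(1)] l one[OF l(1)] by simp
  \<comment> \<open>Row \<open>w l - 1\<close> of the right side is nonzero, so some column entering
    there is nonzero in that row; its pivot dominates \<open>w l - 1\<close>.\<close>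
  then obtain m0 where m0: "m0 < n" "g $$ (w l - 1, m0) * H $$ (m0, l) \<noteq> 0"
    by (meson lessThan_iff sum.not_neutral_contains_not_neutral)
  then have M: "m0 \<in> M" "finite M" by (auto simp: M_def)
  then have "Max ((\<sigma> \<circ> w) ` M) \<in> (\<sigma> \<circ> w) ` M" by (intro Max_in) auto
  then obtain m where m: "m \<in> M" "\<sigma> (w m) = Max ((\<sigma> \<circ> w) ` M)" by auto
  have max: "\<sigma> (w m') \<le> \<sigma> (w m)" if "m' \<in> M" for m' unfolding m(2) using that M(2) by (intro Max_ge) auto
  have mn: "m < n" "H $$ (m, l) \<noteq> 0" using m by (auto simp: M_def)
  \<comment> \<open>In row \<open>w m\<close> another contributing column would need a pivot that is
    both at least and at most \<open>w m\<close> in the order, hence equal to it, against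
    injectivity.\<close>
  have "(\<Sum>m'<n. g $$ (w m, m') * H $$ (m', l)) = (\<Sum>m'<n. if m' = m then H $$ (m, l) else 0)"
  proof (intro sum.cong refl)
    fix m' assume "m' \<in> {..<n}"
    then have m': "m' < n" by simp
    show "g $$ (w m, m') * H $$ (m', l) = (if m' = m then H $$ (m, l) else 0)"
    proof (cases "m' = m")
      case False
      have "g $$ (w m, m') = 0 \<or> H $$ (m', l) = 0"
      proof (rule ccontr)
        assume *: "\<not> ?thesis"
        then have "\<sigma> (w m) \<le> \<sigma> (w m')" using top[OF m' wn[OF mn(1)]] by simp
        moreover have "\<sigma> (w m') \<le> \<sigma> (w m)" using * m' by (intro max) (auto simp: M_def)
        ultimately have "w m = w m'" using \<sigma> wn mn m' by (auto simp: inj_on_def)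
        then show False using inj[OF mn(1) m'] False by simp
      qed
      then show ?thesis using False by auto
    qed (simp add: one mn)
  qed
  also have "\<dots> \<noteq> 0" using mn by simp
  finally have S: "Suc (w m) < n" "g $$ (Suc (w m), l) \<noteq> 0" using col[OF wn[OF mn(1)]] by (auto split: if_splits)
  have "\<sigma> (Suc (w m)) \<le> \<sigma> (Suc (w l - 1))" "Suc (w l - 1) < n" using top[OF l(1) S] l(2) wn[OF l(1)] by simp_all
  then have 1: "\<sigma> (w m) \<le> \<sigma> (w l - 1)" by (intro shift[OF S(1)])
  have "w l - 1 < n" using wn[OF l(1)] by simp
  then have "\<sigma> (w l - 1) \<le> \<sigma> (w m0)" using m0 by (intro top) auto
  also have "\<dots> \<le> \<sigma> (w m)" by (rule max[OF M(1)])
  finally have "\<sigma> (w m) = \<sigma> (w l - 1)" using 1 by simp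
  then have "w m = w l - 1" using \<sigma> wn[OF mn(1)] \<open>w l - 1 < n\<close> by (auto simp: inj_on_def)
  moreover have "m \<le> Suc l" using mn H(1) l(1) by (auto simp: hessenberg_def not_less[symmetric])
  ultimately show ?thesis using mn(1) by blast
qed

text \<open>The value \<open>w l - 1\<close> occurs no later than position \<open>l + 1\<close>, and
  the positions up to \<open>l\<close> already carry the larger values
  \<open>w 0, ..., w l\<close>.\<close>

lemma pivots_descend:
  assumes step: "\<And>l. l < n \<Longrightarrow> w l > 0 \<Longrightarrow> \<exists>m\<le>Suc l. m < n \<and> w m = w l - 1"
    and w0: "w 0 < n" and l: "l \<le> w 0"
  shows "w l = w 0 - l"
  using l
proof (induction l rule: less_induct)
  case (less l)
  show ?case
  proof (cases l)
    case (Suc l')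
    then have l': "w l' = w 0 - l'" using less.IH[of l'] less.prems by simp
    then obtain m where m: "m \<le> Suc l'" "m < n" "w m = w l' - 1" using step[of l'] less.prems w0 Suc by force
    have "m = Suc l'"
    proof (rule ccontr)
      assume "m \<noteq> Suc l'"
      then have "m < l" using m Suc by simp
      then have "w m = w 0 - m" using less.IH[of m] less.prems by simp
      then show False using m l' less.prems Suc \<open>m < l\<close> by simp
    qed
    then show ?thesis using m l' Suc by simp
  qed simp
qed

section \<open>Minors as Pluecker coordinates of the flag\<close>

definition minor :: "(nat \<Rightarrow> nat) \<Rightarrow> nat \<Rightarrow> complex mat \<Rightarrow> complex"
  where "minor w k g = det (mat k k (\<lambda>(i, l). g $$ (w i, l)))"

lemma det_diagonal:
  assumes "b \<in> carrier_mat k k" "\<And>i j. j < i \<Longrightarrow> i < k \<Longrightarrow> b $$ (i, j) = (0 :: complex)"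
  shows "det b = (\<Prod>l<k. b $$ (l, l))"
proof -
  have "upper_triangular b" using assms by (auto simp: upper_triangular_def)
  then show ?thesis using det_upper_triangular[OF _ assms(1)] assms(1)
    by (simp add: prod_list_diag_prod lessThan_atLeast0)
qed

text \<open>The first \<open>k\<close> columns of \<open>g * b\<close> depend only on the first
  \<open>k\<close> columns of \<open>g\<close>, because \<open>b\<close> is upper
  triangular.\<close>

lemma minor_mult_Borel:
  assumes g: "g \<in> carrier_mat n n" and b: "b \<in> Borel n" and k: "k \<le> n" and w: "\<And>i. i < k \<Longrightarrow> w i < n"
  shows "minor w k (g * b) = minor w k g * (\<Prod>l<k. b $$ (l, l))"
proof -
  let ?G = "mat k k (\<lambda>(i, l). g $$ (w i, l))" and ?B = "mat k k (\<lambda>(i, l). b $$ (i, l))"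
  have bc: "b \<in> carrier_mat n n" using b by simp
  have "mat k k (\<lambda>(i, l). (g * b) $$ (w i, l)) = ?G * ?B"
  proof (rule eq_matI)
    fix i j assume "i < dim_row (?G * ?B)" "j < dim_col (?G * ?B)"
    then have ij: "i < k" "j < k" by simp_all
    have "(g * b) $$ (w i, j) = (\<Sum>l<n. g $$ (w i, l) * b $$ (l, j))"
      using w ij k by (intro times_mat_entry[OF g bc]) auto
    also have "\<dots> = (\<Sum>l<k. g $$ (w i, l) * b $$ (l, j))"
      using b k ij by (intro sum.mono_neutral_right) (auto simp: Borel_lower Borel_diag)
    also have "\<dots> = (?G * ?B) $$ (i, j)"
      using times_mat_entry[of ?G k k ?B k i j] ij by simp
    finally show "mat k k (\<lambda>(i, l). (g * b) $$ (w i, l)) $$ (i, j) = (?G * ?B) $$ (i, j)" using ij by simp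
  qed simp_all
  moreover have "det ?B = (\<Prod>l<k. b $$ (l, l))"
    using b k det_diagonal[of ?B k] by (simp add: Borel_lower Borel_diag)
  ultimately show ?thesis using det_mult[of ?G k ?B] by (simp add: minor_def)
qed

lemma minor_lam_mult:
  assumes g: "g \<in> carrier_mat n n" and k: "k \<le> n" and w: "\<And>i. i < k \<Longrightarrow> w i < n"
  shows "minor w k (lam n t * g) = minor w k g * (\<Prod>l<k. t ^ Suc (w l))"
proof -
  let ?G = "mat k k (\<lambda>(i, l). g $$ (w i, l))"
  let ?D = "mat k k (\<lambda>(i, l). if i = l then t ^ Suc (w i) else 0)"
  have "mat k k (\<lambda>(i, l). (lam n t * g) $$ (w i, l)) = ?D * ?G"
  proof (rule eq_matI)
    fix i j assume "i < dim_row (?D * ?G)" "j < dim_col (?D * ?G)"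
    then have ij: "i < k" "j < k" by simp_all
    have "(?D * ?G) $$ (i, j) = (\<Sum>l<k. ?D $$ (i, l) * ?G $$ (l, j))"
      using ij by (intro times_mat_entry[of _ k k _ k]) auto
    also have "\<dots> = (\<Sum>l<k. if l = i then t ^ Suc (w i) * g $$ (w i, j) else 0)"
      using ij by (intro sum.cong) auto
    also have "\<dots> = (lam n t * g) $$ (w i, j)"
      using lam_mult_entry[OF g, of "w i" j t] w k ij by simp
    finally show "mat k k (\<lambda>(i, l). (lam n t * g) $$ (w i, l)) $$ (i, j) = (?D * ?G) $$ (i, j)" using ij by simp
  qed simp_all
  moreover have "det ?D = (\<Prod>l<k. t ^ Suc (w l))"
    using det_diagonal[of ?D k] by simp
  ultimately show ?thesis using det_mult[of ?D k ?G] by (simp add: minor_def mult.commute)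
qed

text \<open>Only the identity permutation contributes, because a permutation cannot raise all values of \<open>\<sigma> \<circ> w\<close>.\<close>

lemma minor_pivots:
  assumes piv: "pivots n \<sigma> w g" and \<sigma>: "inj_on \<sigma> {..<n}" and k: "k \<le> n"
  shows "minor w k g = 1"
proof -
  let ?G = "mat k k (\<lambda>(i, l). g $$ (w i, l))"
  have wn: "w m < n" if "m < n" for m using piv that by (auto simp: pivots_def)
  have zero: "(\<Prod>i = 0..<k. ?G $$ (i, p i)) = 0" if p: "p permutes {0..<k}" "p \<noteq> id" for p
  proof (rule ccontr)
    assume nz: "(\<Prod>i = 0..<k. ?G $$ (i, p i)) \<noteq> 0"
    have pk: "p i < k" if "i < k" for i using permutes_in_image[OF p(1), of i] that by simp
    have le: "\<sigma> (w i) \<le> \<sigma> (w (p i))" if "i < k" for i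
    proof -
      have "?G $$ (i, p i) \<noteq> 0" using nz that by auto
      then have "g $$ (w i, p i) \<noteq> 0" using that pk by simp
      then show ?thesis using piv that pk[OF that] k wn[of i] by (auto simp: pivots_def)
    qed
    have "(\<Sum>i\<in>{0..<k}. \<sigma> (w i)) = (\<Sum>i\<in>{0..<k}. \<sigma> (w (p i)))"
      using sum.permute[OF p(1), of "\<lambda>i. \<sigma> (w i)"] by (simp add: o_def)
    then have eq: "\<sigma> (w i) = \<sigma> (w (p i))" if "i < k" for i
      using sum_mono_inv[of "\<lambda>i. \<sigma> (w i)" "{0..<k}" "\<lambda>i. \<sigma> (w (p i))" i] le that by simp
    have "p i = i" if "i < k" for i
    proof -
      have "w i = w (p i)" using eq[OF that] \<sigma> wn[of i] wn[of "p i"] pk[OF that] that k by (auto simp: inj_on_def)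
      then show ?thesis using piv pk[OF that] that k by (auto simp: pivots_def inj_on_def)
    qed
    then have "p = id" using p(1) by (auto simp: permutes_def fun_eq_iff)
    then show False using p(2) by simp
  qed
  have "minor w k g = (\<Sum>p\<in>{p. p permutes {0..<k}}. signof p * (\<Prod>i = 0..<k. ?G $$ (i, p i)))"
    unfolding minor_def by (rule det_def'[of _ k]) simp
  also have "\<dots> = (\<Sum>p\<in>{id}. signof p * (\<Prod>i = 0..<k. ?G $$ (i, p i)))"
    by (rule sum.mono_neutral_right) (use zero in \<open>auto simp: finite_permutations permutes_id\<close>)
  also have "\<dots> = 1" using piv k by (auto simp: pivots_def intro!: prod.neutral)
  finally show ?thesis .
qed

lemma minor_polynomial:
  assumes "k \<le> n" "\<And>i. i < k \<Longrightarrow> w i < n"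
  shows "minor w k \<in> polynomial_functions {\<lambda>g. g $$ (i, j) | i j. i < n \<and> j < n}"
proof -
  have co: "(\<lambda>g. g $$ (w i, j)) \<in> polynomial_functions {\<lambda>g. g $$ (i, j) | i j. i < n \<and> j < n}"
    if "i < k" "j < k" for i j
    using that assms by (intro polynomial_functions.coord) force
  have "minor w k = (\<lambda>g. \<Sum>p\<in>{p. p permutes {0..<k}}. signof p * (\<Prod>i\<in>{0..<k}. g $$ (w i, p i)))"
  proof
    fix g
    have "minor w k g = (\<Sum>p\<in>{p. p permutes {0..<k}}. signof p * (\<Prod>i = 0..<k. mat k k (\<lambda>(i, l). g $$ (w i, l)) $$ (i, p i)))"
      unfolding minor_def by (rule det_def'[of _ k]) simp
    also have "\<dots> = (\<Sum>p\<in>{p. p permutes {0..<k}}. signof p * (\<Prod>i\<in>{0..<k}. g $$ (w i, p i)))"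
      by (intro sum.cong prod.cong arg_cong2[of _ _ _ _ "(*)"] refl) (auto dest: permutes_in_image)
    finally show "minor w k g = \<dots>" .
  qed
  moreover have "(\<lambda>g. \<Sum>p\<in>{p. p permutes {0..<k}}. signof p * (\<Prod>i\<in>{0..<k}. g $$ (w i, p i))) \<in>
      polynomial_functions {\<lambda>g. g $$ (i, j) | i j. i < n \<and> j < n}"
    by (intro polynomial_functions_sum polynomial_functions.mult polynomial_functions.const
      polynomial_functions_prod co) (auto dest: permutes_in_image)
  ultimately show ?thesis by simp
qed

section \<open>Sections of the line bundles\<close>

text \<open>The extremal weight vector attached to \<open>w\<close>, as a product of Pluecker
  coordinates: the \<open>k\<close>-th minor belongs to the \<open>k\<close>-th fundamental weight,
  and its exponent is the coefficient of that weight in \<open>\<chi>\<close>. For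
  \<open>\<chi>\<close> vanishing at \<open>Suc n\<close> the last exponent is
  \<open>\<chi> n\<close>.\<close>

definition minor_product :: "nat \<Rightarrow> (nat \<Rightarrow> int) \<Rightarrow> (nat \<Rightarrow> nat) \<Rightarrow> complex mat \<Rightarrow> complex"
  where "minor_product n \<chi> w g = (\<Prod>k=1..n. minor w k g powi (\<chi> k - \<chi> (Suc k)))"

text \<open>The number \<open>\<langle>w(\<chi>), \<lambda>\<rangle>\<close> with \<open>w\<close>
  counted from zero, hence the successor and the shifted index.\<close>

definition pairing :: "nat \<Rightarrow> (nat \<Rightarrow> int) \<Rightarrow> (nat \<Rightarrow> nat) \<Rightarrow> int"
  where "pairing n \<chi> w = (\<Sum>i=1..n. int (Suc (w (i - 1))) * \<chi> i)"

text \<open>Summation by parts in the exponents: \<open>c l\<close> occurs in the factors with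
  \<open>k > l\<close>, whose exponents telescope from \<open>\<chi> (Suc l)\<close>.\<close>

lemma prod_powi_telescope:
  fixes c :: "nat \<Rightarrow> complex"
  assumes "\<And>l. l < n \<Longrightarrow> c l \<noteq> 0"
  shows "(\<Prod>k=1..n. (\<Prod>l<k. c l) powi (\<chi> k - \<chi> (Suc k))) * (\<Prod>l<n. c l) powi \<chi> (Suc n) =
    (\<Prod>i=1..n. c (i - 1) powi \<chi> i)"
  using assms
proof (induction n)
  case (Suc n)
  have nz: "(\<Prod>l<Suc n. c l) \<noteq> 0" using Suc.prems by auto
  have "(\<Prod>l<Suc n. c l) powi (\<chi> (Suc n) - \<chi> (Suc (Suc n))) * (\<Prod>l<Suc n. c l) powi \<chi> (Suc (Suc n)) =
      (\<Prod>l<Suc n. c l) powi \<chi> (Suc n)"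
    using power_int_add[of "\<Prod>l<Suc n. c l" "\<chi> (Suc n) - \<chi> (Suc (Suc n))" "\<chi> (Suc (Suc n))"] nz by simp
  also have "\<dots> = (\<Prod>l<n. c l) powi \<chi> (Suc n) * c n powi \<chi> (Suc n)"
    by (simp add: power_int_mult_distrib)
  finally have *: "(\<Prod>l<Suc n. c l) powi (\<chi> (Suc n) - \<chi> (Suc (Suc n))) * (\<Prod>l<Suc n. c l) powi \<chi> (Suc (Suc n)) =
      (\<Prod>l<n. c l) powi \<chi> (Suc n) * c n powi \<chi> (Suc n)" .
  have IH: "(\<Prod>k=1..n. (\<Prod>l<k. c l) powi (\<chi> k - \<chi> (Suc k))) * (\<Prod>l<n. c l) powi \<chi> (Suc n) =
    (\<Prod>i=1..n. c (i - 1) powi \<chi> i)"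
    using Suc by simp
  have "{1..Suc n} = insert (Suc n) {1..n}" by auto
  then have split: "(\<Prod>k=1..Suc n. f k) = (\<Prod>k=1..n. f k) * f (Suc n)" for f :: "nat \<Rightarrow> complex"
    by (simp add: mult.commute)
  show ?case
    unfolding split mult.assoc * using IH by (simp add: mult.assoc[symmetric])
qed simp

text \<open>Right multiplication by \<open>B\<close> and left multiplication by the torus both scale
  every minor by a partial product of numbers \<open>c l\<close>, so the two transformation laws
  have one proof.\<close>

lemma minor_product_scale:
  assumes "\<And>k. 1 \<le> k \<Longrightarrow> k \<le> n \<Longrightarrow> minor w k g' = minor w k g * (\<Prod>l<k. c l)"
    and "\<And>l. l < n \<Longrightarrow> c l \<noteq> 0" "\<chi> (Suc n) = 0"
  shows "minor_product n \<chi> w g' = minor_product n \<chi> w g * (\<Prod>i=1..n. c (i - 1) powi \<chi> i)"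
proof -
  have "minor_product n \<chi> w g' = minor_product n \<chi> w g * (\<Prod>k=1..n. (\<Prod>l<k. c l) powi (\<chi> k - \<chi> (Suc k)))"
    unfolding minor_product_def using assms(1)
    by (simp add: power_int_mult_distrib flip: prod.distrib)
  then show ?thesis using prod_powi_telescope[where n = n and c = c and \<chi> = \<chi>] assms(2,3) by simp
qed

lemma minor_product_mult_Borel:
  assumes "g \<in> GL n" "b \<in> Borel n" "w ` {..<n} \<subseteq> {..<n}" "\<chi> (Suc n) = 0"
  shows "minor_product n \<chi> w (g * b) = minor_product n \<chi> w g * char_value n \<chi> b"
proof -
  have wn: "w i < n" if "i < n" for i using assms(3) that by auto
  show ?thesis
    unfolding char_value_def
    by (rule minor_product_scale[where c = "\<lambda>l. b $$ (l, l)"])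
      (use assms minor_mult_Borel[of g n b _ w] wn in \<open>auto simp: Borel_diag\<close>)
qed

lemma prod_powi_pairing:
  fixes t :: complex
  assumes "t \<noteq> 0"
  shows "(\<Prod>i=1..n. (t ^ Suc (w (i - 1))) powi \<chi> i) = t powi pairing n \<chi> w"
proof -
  have "(\<Prod>i\<in>I. (t ^ m i) powi \<chi> i) = t powi (\<Sum>i\<in>I. int (m i) * \<chi> i)"
    if "finite I" for m :: "nat \<Rightarrow> nat" and I :: "nat set"
    using that
  proof (induction I)
    case (insert i I)
    have "(t ^ m i) powi \<chi> i = t powi (int (m i) * \<chi> i)"
      by (simp add: power_int_mult)
    then show ?case using insert assms by (simp add: power_int_add)
  qed simp
  from this[of "{1..n}" "\<lambda>i. Suc (w (i - 1))"] show ?thesis by (simp only: pairing_def finite_atLeastAtMost)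
qed

lemma minor_product_lam_mult:
  assumes "g \<in> GL n" "t \<noteq> 0" "w ` {..<n} \<subseteq> {..<n}" "\<chi> (Suc n) = 0"
  shows "minor_product n \<chi> w (lam n t * g) = minor_product n \<chi> w g * t powi pairing n \<chi> w"
proof -
  have wn: "w i < n" if "i < n" for i using assms(3) that by auto
  show ?thesis
    unfolding prod_powi_pairing[OF assms(2), symmetric]
    by (rule minor_product_scale[where c = "\<lambda>l. t ^ Suc (w l)"])
      (use assms minor_lam_mult[of g n _ w t] wn in auto)
qed

lemma minor_permutation:
  assumes g: "g \<in> carrier_mat n n" and w: "w ` {..<n} \<subseteq> {..<n}" "inj_on w {..<n}"
  shows "minor w n g = 0 \<longleftrightarrow> det g = 0"
proof -
  define p where "p i = (if i < n then w i else i)" for i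
  have "bij_betw w {0..<n} {0..<n}"
    using endo_inj_surj[OF _ w] w by (simp add: bij_betw_def lessThan_atLeast0)
  then have "bij_betw p {0..<n} {0..<n}" by (rule bij_betw_cong[THEN iffD1, rotated]) (simp add: p_def)
  then have p: "p permutes {0..<n}" by (rule bij_imp_permutes) (simp add: p_def)
  have "mat n n (\<lambda>(i, l). g $$ (w i, l)) = mat n n (\<lambda>(i, l). g $$ (p i, l))"
    by (rule cong_mat) (simp_all add: p_def)
  then have "minor w n g = signof p * det g"
    unfolding minor_def using det_permute_rows[OF g p] by simp
  then show ?thesis by (simp add: sign_def)
qed

lemma pivots_GL:
  assumes "g \<in> carrier_mat n n" "pivots n \<sigma> w g" "inj_on \<sigma> {..<n}"
  shows "g \<in> GL n"
  using minor_pivots[OF assms(2,3) order_refl] minor_permutation[OF assms(1), of w] assms(1,2)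
  unfolding GL_iff_det pivots_def by auto

lemma points_GL_space [simp]: "points (GL_space n) = GL n"
  by (simp add: GL_space_def points_coordinate_space)

lemma function_space_GL_space: "function_space (GL_space n)"
  unfolding GL_space_def by (rule function_space_coordinate_space)

lemma openin_GL: "openin (zar (GL_space n)) (GL n)"
  using openin_topspace[of "zar (GL_space n)"] by simp

text \<open>The exponents are nonnegative except possibly for \<open>k = n\<close>, where the minor
  is the determinant up to sign and has no zero on \<open>GL n\<close>.\<close>

lemma minor_product_regular:
  assumes w: "w ` {..<n} \<subseteq> {..<n}" "inj_on w {..<n}"
    and \<chi>: "\<And>k. 1 \<le> k \<Longrightarrow> k < n \<Longrightarrow> \<chi> (Suc k) \<le> \<chi> k"
  shows "minor_product n \<chi> w \<in> reg (GL_space n) (GL n)"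
proof -
  interpret function_space "GL_space n" by (rule function_space_GL_space)
  have wn: "w i < n" if "i < n" for i using w(1) that by auto
  have poly: "minor w k \<in> reg (GL_space n) (GL n)" if "k \<le> n" for k
    using openin_GL[of n] that wn unfolding GL_space_def
    by (intro polynomial_functions_reg minor_polynomial) auto
  have "(\<lambda>g. \<Prod>k\<in>{1..n}. minor w k g powi (\<chi> k - \<chi> (Suc k))) \<in> reg (GL_space n) (GL n)"
  proof (intro reg_prod openin_GL reg_power_int poly)
    fix k assume k: "k \<in> {1..n}"
    then show "k \<le> n" by simp
    show "0 \<le> \<chi> k - \<chi> (Suc k) \<or> (\<forall>g\<in>GL n. minor w k g \<noteq> 0)"
    proof (cases "k = n")
      case True
      then show ?thesis using minor_permutation[OF GL_carrier w] GL_iff_det by blast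
    next
      case False
      then show ?thesis using \<chi>[of k] k by simp
    qed
  qed
  then show ?thesis unfolding minor_product_def[abs_def] .
qed

lemma minor_product_nonzero:
  "(\<And>k. 1 \<le> k \<Longrightarrow> k \<le> n \<Longrightarrow> minor w k g \<noteq> 0) \<Longrightarrow> minor_product n \<chi> w g \<noteq> 0"
  by (simp add: minor_product_def)

lemma minor_product_pivots:
  "pivots n \<sigma> w g \<Longrightarrow> inj_on \<sigma> {..<n} \<Longrightarrow> minor_product n \<chi> w g = 1"
  by (simp add: minor_product_def minor_pivots)

section \<open>Points and sections of the line bundles\<close>

abbreviation line_class :: "nat \<Rightarrow> (nat \<Rightarrow> int) \<Rightarrow> complex mat \<times> complex \<Rightarrow> (complex mat \<times> complex) set"
  where "line_class n \<chi> \<equiv> bundle_class n (\<lambda>i. - \<chi> i)"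

abbreviation total_space :: "nat \<Rightarrow> (complex mat \<times> complex) fspace"
  where "total_space n \<equiv> coordinate_space (GL n \<times> UNIV)
    (insert (\<lambda>(g, v). v) {\<lambda>(g, v). g $$ (i, j) | i j. i < n \<and> j < n})"

text \<open>The sign in \<open>- \<chi>\<close> and the inverse in the definition of the bundle
  cancel, so fibre coordinates are multiplied by the value of \<open>\<chi>\<close> at
  \<open>b\<close>.\<close>

lemma line_class_eq: "line_class n \<chi> (g, v) = {(g * b, char_value n \<chi> b * v) | b. b \<in> Borel n}"
proof -
  have "inverse (char_value n (\<lambda>i. - \<chi> i) b) = char_value n \<chi> b" for b
    unfolding char_value_def power_int_minus prod_inversef[symmetric] by simp
  then show ?thesis by (simp add: bundle_class_def)
qed

lemma line_bundle_eq: "line_bundle n \<chi> = quotient_space (total_space n) (line_class n \<chi>)"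
  by (simp add: line_bundle_def assoc_bundle_def)

lemma fst_line_class: "fst ` line_class n \<chi> (g, v) = flag_point n g"
  unfolding line_class_eq flag_point_def by force

lemma char_value_nonzero: "b \<in> Borel n \<Longrightarrow> char_value n \<chi> b \<noteq> 0"
  by (auto simp: char_value_def Borel_diag)

lemma char_value_one [simp]: "char_value n \<chi> (1\<^sub>m n) = 1"
  by (auto simp: char_value_def intro!: prod.neutral)

lemma char_value_multiple: "char_value n (\<lambda>i. int k * \<chi> i) b = char_value n \<chi> b ^ k"
  by (simp add: char_value_def prod_power_distrib power_int_mult mult.commute[of "int k"])

lemma line_class_self: "g \<in> GL n \<Longrightarrow> (g, v) \<in> line_class n \<chi> (g, v)"
  unfolding line_class_eq
  by (intro CollectI exI[of _ "1\<^sub>m n"]) (simp add: one_in_Borel right_mult_one_mat[of _ n n])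

lemma Pet_subset: "Pet n \<subseteq> flag_point n ` GL n"
  by (auto simp: Pet_def)

lemma points_flag_variety [simp]: "points (flag_variety n) = flag_point n ` GL n"
  by (simp add: flag_variety_def)

lemma points_Peterson_variety [simp]: "points (Peterson_variety n) = Pet n"
  using Pet_subset by (auto simp: Peterson_variety_def)

lemma function_space_flag_variety: "function_space (flag_variety n)"
  unfolding flag_variety_def by (intro function_space_quotient_space function_space_GL_space)

lemma function_space_Peterson_variety: "function_space (Peterson_variety n)"
  unfolding Peterson_variety_def by (intro function_space_induced_on function_space_flag_variety)

lemma coordinate_reg_GL: "i < n \<Longrightarrow> j < n \<Longrightarrow> (\<lambda>g. g $$ (i, j)) \<in> reg (GL_space n) (GL n)"
  using openin_GL[of n] unfolding GL_space_def
  by (intro polynomial_functions_reg polynomial_functions.coord) auto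

text \<open>The section attached to an equivariant function is its graph over each coset.\<close>

lemma section_of_equivariant_function:
  assumes F: "F \<in> reg (GL_space n) (GL n)"
      "\<And>g b. g \<in> GL n \<Longrightarrow> b \<in> Borel n \<Longrightarrow> F (g * b) = char_value n \<chi> b * F g"
  shows "Pet_section n \<chi> (\<lambda>x. (\<lambda>g. (g, F g)) ` x)"
proof -
  let ?s = "\<lambda>x. (\<lambda>g. (g, F g)) ` x"
  have s: "?s (flag_point n g) = line_class n \<chi> (g, F g)" if "g \<in> GL n" for g
    unfolding line_class_eq flag_point_def using F(2)[OF that] by auto
  have "morphism (GL_space n) (total_space n) (\<lambda>g. (g, F g))"
  proof (rule morphism_to_coordinate_space[OF function_space_GL_space])
    show "(\<lambda>g. f (g, F g)) \<in> reg (GL_space n) (points (GL_space n))"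
      if "f \<in> insert (\<lambda>(g, v). v) {\<lambda>(g, v). g $$ (i, j) | i j. i < n \<and> j < n}" for f
      using that F(1) coordinate_reg_GL by auto
  qed simp
  then have "morphism (GL_space n) (line_bundle n \<chi>) (line_class n \<chi> \<circ> (\<lambda>g. (g, F g)))"
    unfolding line_bundle_eq by (rule morphism_compose[OF _ morphism_quotient_map])
  then have "morphism (GL_space n) (line_bundle n \<chi>) (?s \<circ> flag_point n)"
    by (rule morphism_cong[OF function_space_GL_space]) (simp add: s)
  then have "morphism (flag_variety n) (line_bundle n \<chi>) ?s"
    unfolding flag_variety_def by (rule morphism_from_quotient)
  then have "morphism (Peterson_variety n) (line_bundle n \<chi>) ?s"
    unfolding Peterson_variety_def by (rule morphism_induced_on_restrict[OF function_space_flag_variety])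
  moreover have "bundle_proj (?s x) = x" for x by (simp add: bundle_proj_def image_image)
  ultimately show ?thesis by (simp add: Pet_section_def)
qed

text \<open>A bundle point over a coset comes with some representative of it; moving that
  representative to the given \<open>g\<close> multiplies the fibre coordinate by the value of the
  character.\<close>

lemma section_representative:
  assumes s: "Pet_section n \<chi> s" and g: "g \<in> GL n" "flag_point n g \<in> Pet n"
  shows "\<exists>v. s (flag_point n g) = line_class n \<chi> (g, v)"
proof -
  have "s (flag_point n g) \<in> points (line_bundle n \<chi>)"
    using s g morphism_maps[of "Peterson_variety n" "line_bundle n \<chi>" s] by (simp add: Pet_section_def)
  then obtain g' v' where g': "g' \<in> GL n" "s (flag_point n g) = line_class n \<chi> (g', v')"
    by (auto simp: line_bundle_eq points_coordinate_space)
  have "fst ` s (flag_point n g) = flag_point n g"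
    using s g(2) by (auto simp: Pet_section_def bundle_proj_def)
  then have "flag_point n g' = flag_point n g" unfolding g'(2) fst_line_class .
  then obtain b where b: "b \<in> Borel n" "g = g' * b" using flag_point_eqD[OF g(1)] by metis
  have "line_class n \<chi> (g' * b, char_value n \<chi> b * v') = line_class n \<chi> (g', v')"
  proof -
    obtain c where c: "c \<in> Borel n" "b * c = 1\<^sub>m n" "c * b = 1\<^sub>m n" using Borel_inverse[OF b(1)] .
    have cv: "char_value n \<chi> (x * y) = char_value n \<chi> x * char_value n \<chi> y" if "x \<in> Borel n" "y \<in> Borel n" for x y
      unfolding char_value_def prod.distrib[symmetric] using upper_triangular_mult_diag[OF that]
      by (intro prod.cong) (auto simp: power_int_mult_distrib)
    have assoc: "g' * b * x = g' * (b * x)" if "x \<in> Borel n" for x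
      using g' b that by (intro square_mult_assoc[of _ n]) auto
    show ?thesis
    proof (intro equalityI subsetI)
      fix p assume "p \<in> line_class n \<chi> (g' * b, char_value n \<chi> b * v')"
      then obtain x where x: "x \<in> Borel n" "p = (g' * b * x, char_value n \<chi> x * (char_value n \<chi> b * v'))"
        unfolding line_class_eq by blast
      then have "p = (g' * (b * x), char_value n \<chi> (b * x) * v')" by (simp add: assoc cv b)
      then show "p \<in> line_class n \<chi> (g', v')" unfolding line_class_eq using Borel_mult[OF b(1) x(1)] by blast
    next
      fix p assume "p \<in> line_class n \<chi> (g', v')"
      then obtain x where x: "x \<in> Borel n" "p = (g' * x, char_value n \<chi> x * v')"
        unfolding line_class_eq by blast
      have cx: "c * x \<in> Borel n" by (rule Borel_mult[OF c(1) x(1)])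
      have "b * (c * x) = b * c * x" using b c x by (intro square_mult_assoc[of _ n, symmetric]) auto
      also have "\<dots> = x" unfolding c(2) using x by (intro left_mult_one_mat[of _ n n]) simp
      finally have "p = (g' * b * (c * x), char_value n \<chi> (c * x) * (char_value n \<chi> b * v'))"
        using x(2) assoc[OF cx] cv[OF b(1) cx] by (simp add: mult_ac)
      then show "p \<in> line_class n \<chi> (g' * b, char_value n \<chi> b * v')"
        unfolding line_class_eq using cx by blast
    qed
  qed
  then show ?thesis using g' b by metis
qed

lemma line_class_zero: "line_class n \<chi> (g, 0) = zero_vector (flag_point n g)"
  unfolding line_class_eq zero_vector_def flag_point_def by auto

lemma bundle_act_line_class:
  "g \<in> GL n \<Longrightarrow> (h * g, v) \<in> bundle_act h (line_class n \<chi> (g, v))"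
  using line_class_self[of g n v \<chi>] unfolding bundle_act_def by force

section \<open>Unstable points\<close>

text \<open>The choice of \<open>p\<close> does not matter when \<open>f\<close> transforms by the character of the bundle.\<close>

definition trivialization :: "(complex mat \<Rightarrow> complex) \<Rightarrow> (complex mat \<times> complex) set \<Rightarrow> complex"
  where "trivialization f e = (let p = SOME p. p \<in> e in snd p / f (fst p))"

lemma trivialization_eq:
  assumes f: "\<And>b. b \<in> Borel n \<Longrightarrow> f (g * b) = f g * char_value n \<chi> b" and g: "g \<in> GL n"
    and p: "(g', v') \<in> line_class n \<chi> (g, v)"
  shows "trivialization f (line_class n \<chi> (g, v)) = v' / f g'"
proof -
  have *: "snd p / f (fst p) = v / f g" if "p \<in> line_class n \<chi> (g, v)" for p
    using that f char_value_nonzero[of _ n \<chi>] unfolding line_class_eq by auto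
  have "(SOME p. p \<in> line_class n \<chi> (g, v)) \<in> line_class n \<chi> (g, v)"
    using line_class_self[OF g] by (rule someI)
  then show ?thesis using * *[OF p] by (simp add: trivialization_def Let_def)
qed

text \<open>Where \<open>f\<close> does not vanish, the quotient of the fibre coordinate by
  \<open>f\<close> is unchanged under \<open>B\<close>, both being multiplied by the same character
  value; regularity is therefore checked on \<open>total_space\<close>.\<close>

lemma trivialization_regular:
  assumes F: "f \<in> reg (GL_space n) (GL n)"
    and f: "\<And>g b. g \<in> GL n \<Longrightarrow> b \<in> Borel n \<Longrightarrow> f (g * b) = f g * char_value n \<chi> b"
  defines "W \<equiv> {line_class n \<chi> (g, v) | g v. g \<in> GL n \<and> f g \<noteq> 0}"
  shows "openin (zar (line_bundle n \<chi>)) W" "trivialization f \<in> reg (line_bundle n \<chi>) W"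
proof -
  let ?T = "total_space n"
  interpret T: function_space ?T by (rule function_space_coordinate_space)
  have oT: "openin (zar ?T) (GL n \<times> UNIV)"
    using openin_topspace[of "zar ?T"] by (simp add: points_coordinate_space)
  have "morphism ?T (GL_space n) fst"
    unfolding GL_space_def
  proof (rule morphism_to_coordinate_space[OF function_space_coordinate_space])
    fix c :: "complex mat \<Rightarrow> complex" assume "c \<in> {\<lambda>g. g $$ (i, j) | i j. i < n \<and> j < n}"
    then obtain i j where ij: "i < n" "j < n" "c = (\<lambda>g. g $$ (i, j))" by blast
    have "(\<lambda>x :: complex mat \<times> complex. c (fst x)) = (\<lambda>(g, v). g $$ (i, j))" by (auto simp: ij)
    moreover have "(\<lambda>(g, v). g $$ (i, j)) \<in> reg ?T (GL n \<times> UNIV)"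
      using ij by (intro polynomial_functions_reg oT polynomial_functions.coord) auto
    ultimately show "(\<lambda>x. c (fst x)) \<in> reg ?T (points ?T)" by (simp add: points_coordinate_space)
  qed (auto simp: points_coordinate_space)
  from morphism_reg[OF this openin_GL F] have "f \<circ> fst \<in> reg ?T {x \<in> points ?T. fst x \<in> GL n}" .
  moreover have "{x \<in> points ?T. fst x \<in> GL n} = GL n \<times> UNIV" by (auto simp: points_coordinate_space)
  ultimately have f1: "f \<circ> fst \<in> reg ?T (GL n \<times> UNIV)" by simp
  let ?D = "{x \<in> GL n \<times> (UNIV :: complex set). (f \<circ> fst) x \<noteq> 0}"
  have oD: "openin (zar ?T) ?D" by (rule T.open_nonzero[OF oT f1])
  have fb: "f (g * b) \<noteq> 0 \<longleftrightarrow> f g \<noteq> 0" if "g \<in> GL n" "b \<in> Borel n" for g b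
    using f[OF that] char_value_nonzero[OF that(2)] by simp
  have pre: "{x \<in> points ?T. line_class n \<chi> x \<in> W} = ?D"
  proof (intro equalityI subsetI)
    fix x assume x: "x \<in> {x \<in> points ?T. line_class n \<chi> x \<in> W}"
    obtain g v where gv: "x = (g, v)" by force
    with x obtain g' v' where g': "line_class n \<chi> (g, v) = line_class n \<chi> (g', v')" "g' \<in> GL n" "f g' \<noteq> 0"
      unfolding W_def by blast
    have g: "g \<in> GL n" using x gv by (auto simp: points_coordinate_space)
    have "(g, v) \<in> line_class n \<chi> (g', v')" using line_class_self[OF g, of v \<chi>] g'(1) by simp
    then obtain b where "b \<in> Borel n" "g = g' * b" unfolding line_class_eq by blast
    then show "x \<in> ?D" using fb[of g' b] g' g gv by simp
  next
    fix x assume "x \<in> ?D"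
    then show "x \<in> {x \<in> points ?T. line_class n \<chi> x \<in> W}"
      unfolding W_def by (cases x) (auto simp: points_coordinate_space)
  qed
  show "openin (zar (line_bundle n \<chi>)) W"
    unfolding line_bundle_eq openin_quotient_space pre using oD by (auto simp: W_def points_coordinate_space)
  have "(\<lambda>x. (case x of (g, v) \<Rightarrow> v) / (f \<circ> fst) x) \<in> reg ?T ?D"
  proof (intro T.reg_divide oD)
    show "(\<lambda>(g, v). v) \<in> reg ?T ?D" by (intro polynomial_functions_reg oD polynomial_functions.coord) simp
    show "f \<circ> fst \<in> reg ?T ?D" by (rule T.reg_restrict[OF oT oD _ f1]) auto
  qed auto
  then have "trivialization f \<circ> line_class n \<chi> \<in> reg ?T ?D"
  proof (rule T.reg_cong[OF oD])
    fix x assume x: "x \<in> ?D"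
    obtain g v where gv: "x = (g, v)" by force
    then have g: "g \<in> GL n" using x by simp
    show "(trivialization f \<circ> line_class n \<chi>) x = (case x of (g, v) \<Rightarrow> v) / (f \<circ> fst) x"
      using trivialization_eq[OF f[OF g] g line_class_self[OF g], of v] by (simp add: gv)
  qed
  then show "trivialization f \<in> reg (line_bundle n \<chi>) W"
    unfolding line_bundle_eq reg_quotient_space pre .
qed

section \<open>Limits of torus orbits and vanishing of invariant sections\<close>

lemma polynomial_function_isCont:
  assumes "p \<in> polynomial_functions {\<lambda>z::complex. z}"
  shows "isCont p z"
  using assms by induction auto

lemma pairing_eq_sum: "pairing n \<chi> w = (\<Sum>l<n. int (Suc (w l)) * \<chi> (Suc l))"
proof -
  have "pairing n \<chi> w = (\<Sum>l\<in>{0..<n}. int (Suc (w l)) * \<chi> (Suc l))"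
    unfolding pairing_def
    using sum.shift_bounds_Suc_ivl[of "\<lambda>i. int (Suc (w (i - 1))) * \<chi> i" 0 n]
    by (simp add: atLeastLessThanSuc_atLeastAtMost)
  then show ?thesis by (simp add: lessThan_atLeast0)
qed

lemma real_pairing: "real_of_int (pairing n \<chi> w) = (\<Sum>l<n. real (Suc (w l)) * real_of_int (\<chi> (Suc l)))"
  by (simp add: pairing_eq_sum)

text \<open>The pivots descend from \<open>w 0\<close> to zero, and \<open>w 0 < n - 1\<close> makes
  \<open>Suc (w 0)\<close> the index of a simple root, so the inequality of the deep chamber for
  this index applies.\<close>

lemma pivots_pairing_negative:
  assumes \<chi>: "(\<lambda>i. real_of_int (\<chi> i)) \<in> deep_chamber n"
    and g: "g \<in> GL n" "flag_point n g \<in> Pet n" and piv: "pivots n \<sigma> w g" and \<sigma>: "inj_on \<sigma> {..<n}"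
    and shift: "\<And>i j. Suc i < n \<Longrightarrow> Suc j < n \<Longrightarrow> \<sigma> (Suc i) \<le> \<sigma> (Suc j) \<Longrightarrow> \<sigma> i \<le> \<sigma> j"
    and w0: "w 0 < n - 1"
  shows "pairing n \<chi> w < 0"
proof -
  obtain H where H: "hessenberg n H" "nilp n * g = g * H" using flag_point_in_Pet_iff[OF g(1)] g(2) by blast
  have desc: "w l = w 0 - l" if "l \<le> w 0" for l
  proof (rule pivots_descend)
    show "\<exists>m\<le>Suc l. m < n \<and> w m = w l - 1" if "l < n" "w l > 0" for l
      by (rule pivots_step[OF g(1) H piv \<sigma> shift that])
  qed (use w0 that in auto)
  have "real_of_int (pairing n \<chi> w) < 0"
    unfolding real_pairing
    by (rule deep_chamber_pairing_negative[OF \<chi> _ _ w0 desc]) (use piv in \<open>auto simp: pivots_def\<close>)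
  then show ?thesis by simp
qed

text \<open>
  The curve \<open>z \<mapsto> \<lambda>(1/z) g\<close>, rescaled by elements of \<open>B\<close>, extends over \<open>z = 0\<close> with the permutation
  matrix of \<open>w\<close> as its value.
\<close>

definition degeneration :: "nat \<Rightarrow> (nat \<Rightarrow> nat) \<Rightarrow> complex mat \<Rightarrow> complex \<Rightarrow> complex mat"
  where "degeneration n w g z = mat n n (\<lambda>(i, l). if i \<le> w l then g $$ (i, l) * z ^ (w l - i) else 0)"

lemma degeneration_carrier [simp]: "degeneration n w g z \<in> carrier_mat n n"
  by (simp add: degeneration_def)

context
  fixes n :: nat and w :: "nat \<Rightarrow> nat" and g :: "complex mat"
  assumes g: "g \<in> GL n" "flag_point n g \<in> Pet n" and piv: "pivots n (\<lambda>i. i) w g"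
begin

lemma pivots_degeneration: "pivots n (\<lambda>i. i) w (degeneration n w g z)"
proof -
  have "w l < n" if "l < n" for l using piv that by (auto simp: pivots_def)
  then show ?thesis using piv by (auto simp: pivots_def degeneration_def)
qed

lemma degeneration_GL: "degeneration n w g z \<in> GL n"
  by (rule pivots_GL[OF _ pivots_degeneration]) auto

lemma degeneration_flag:
  assumes z: "z \<noteq> 0"
  shows "flag_point n (degeneration n w g z) = flag_point n (lam n (inverse z) * g)"
proof -
  \<comment> \<open>The pivot of column \<open>i\<close> acquires the factor
    \<open>inverse z ^ Suc (w i)\<close> from the torus; \<open>D\<close> restores it to
    \<open>1\<close>, and the entries above it keep nonnegative powers of \<open>z\<close>.\<close>
  define D where "D = mat n n (\<lambda>(i, j). if i = j then z ^ Suc (w i) else 0)"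
  have D: "D \<in> Borel n" unfolding Borel_iff using z by (auto simp: D_def)
  have gl: "lam n (inverse z) * g \<in> GL n" using z by (intro GL_mult lam_in_GL g) simp
  have gc: "g \<in> carrier_mat n n" using g by simp
  have "degeneration n w g z = lam n (inverse z) * g * D"
  proof (rule eq_matI)
    fix i j assume "i < dim_row (lam n (inverse z) * g * D)" "j < dim_col (lam n (inverse z) * g * D)"
    then have ij: "i < n" "j < n" by (auto simp: lam_def D_def)
    have "(lam n (inverse z) * g * D) $$ (i, j) = (\<Sum>l<n. (lam n (inverse z) * g) $$ (i, l) * D $$ (l, j))"
      using gl D ij by (intro times_mat_entry[of _ n n _ n]) auto
    also have "\<dots> = (\<Sum>l<n. if l = j then inverse z ^ Suc i * g $$ (i, j) * z ^ Suc (w j) else 0)"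
      using ij lam_mult_entry[OF gc ij(1)] by (intro sum.cong) (auto simp: D_def)
    also have "\<dots> = inverse z ^ Suc i * g $$ (i, j) * z ^ Suc (w j)" using ij by simp
    also have "\<dots> = degeneration n w g z $$ (i, j)"
    proof (cases "i \<le> w j")
      case True
      then have "z ^ w j = z ^ (w j - i) * z ^ i" by (simp flip: power_add)
      then show ?thesis using ij z True by (simp add: degeneration_def power_inverse field_simps)
    next
      case False
      then have "g $$ (i, j) = 0" using piv ij by (auto simp: pivots_def)
      then show ?thesis using ij False by (simp add: degeneration_def)
    qed
    finally show "degeneration n w g z $$ (i, j) = (lam n (inverse z) * g * D) $$ (i, j)" by simp
  qed (auto simp: lam_def D_def degeneration_def)
  then show ?thesis using flag_point_mult_Borel[OF gl D] by simp
qed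

text \<open>At \<open>z = 0\<close> the matrix is the permutation matrix of \<open>w\<close>, and
  the matrix of \<open>N\<close> in that basis lowers pivots by one; that it is Hessenberg is
  exactly the bound on positions in \<open>pivots_step\<close>.\<close>

lemma degeneration_Pet: "flag_point n (degeneration n w g z) \<in> Pet n"
proof (cases "z = 0")
  case False
  then show ?thesis unfolding degeneration_flag[OF False] using g by (intro lam_Pet) auto
next
  case True
  define P where "P = degeneration n w g 0"
  obtain H where H: "hessenberg n H" "nilp n * g = g * H" using flag_point_in_Pet_iff[OF g(1)] g(2) by blast
  have inj: "m = m'" if "m < n" "m' < n" "w m = w m'" for m m'
    using piv that by (auto simp: pivots_def inj_on_def)
  have surj: "w ` {..<n} = {..<n}" using piv by (intro endo_inj_surj) (auto simp: pivots_def)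
  have P: "P $$ (i, l) = (if i = w l then 1 else 0)" if "i < n" "l < n" for i l
    using that piv by (auto simp: P_def degeneration_def pivots_def)
  have Pc: "P \<in> carrier_mat n n" by (simp add: P_def)
  define H0 where "H0 = mat n n (\<lambda>(i, j). if Suc (w i) = w j then 1 else 0 :: complex)"
  have "hessenberg n H0"
    unfolding hessenberg_def
  proof (intro conjI allI impI)
    fix i j assume ij: "i < n" "j < n" "i > j + 1"
    show "H0 $$ (i, j) = 0"
    proof (rule ccontr)
      assume "H0 $$ (i, j) \<noteq> 0"
      then have eq: "Suc (w i) = w j" using ij by (auto simp: H0_def split: if_splits)
      have "\<exists>m\<le>Suc j. m < n \<and> w m = w j - 1"
        by (rule pivots_step[OF g(1) H piv]) (use ij eq in auto)
      then obtain m where m: "m \<le> Suc j" "m < n" "w m = w j - 1" by blast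
      then have "m = i" using inj[OF m(2) ij(1)] eq by simp
      then show False using m ij by simp
    qed
  qed (simp add: H0_def)
  moreover have "nilp n * P = P * H0"
  proof (rule eq_matI)
    fix i j assume "i < dim_row (P * H0)" "j < dim_col (P * H0)"
    then have ij: "i < n" "j < n" using Pc by (auto simp: H0_def)
    obtain m where m: "m < n" "w m = i" using surj ij(1) by (metis imageE lessThan_iff)
    have "(P * H0) $$ (i, j) = (\<Sum>l<n. P $$ (i, l) * H0 $$ (l, j))"
      using Pc ij by (intro times_mat_entry[of _ n n _ n]) (auto simp: H0_def)
    also have "\<dots> = (\<Sum>l<n. if l = m then (if Suc i = w j then 1 else 0) else 0)"
      using ij m inj by (intro sum.cong) (auto simp: P H0_def)
    also have "\<dots> = (nilp n * P) $$ (i, j)"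
    proof -
      have "w j < n" using surj ij(2) by auto
      then show ?thesis using m ij nilp_mult_entry[OF Pc ij] by (auto simp: P)
    qed
    finally show "(nilp n * P) $$ (i, j) = (P * H0) $$ (i, j)" by simp
  qed (use Pc in \<open>auto simp: H0_def nilp_def\<close>)
  ultimately show ?thesis
    using flag_point_in_Pet_iff[OF degeneration_GL[of 0]] True unfolding P_def by blast
qed

lemma degeneration_morphism:
  "morphism (coordinate_space UNIV {\<lambda>z. z}) (Peterson_variety n) (\<lambda>z. flag_point n (degeneration n w g z))"
proof -
  let ?A = "coordinate_space UNIV {\<lambda>z :: complex. z}"
  have fsA: "function_space ?A" by (rule function_space_coordinate_space)
  have "morphism ?A (GL_space n) (degeneration n w g)"
    unfolding GL_space_def
  proof (rule morphism_to_coordinate_space[OF fsA])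
    show "degeneration n w g z \<in> GL n" for z by (rule degeneration_GL)
    fix f :: "complex mat \<Rightarrow> complex" assume "f \<in> {\<lambda>g. g $$ (i, j) | i j. i < n \<and> j < n}"
    then obtain i j where ij: "i < n" "j < n" "f = (\<lambda>g. g $$ (i, j))" by blast
    have "(\<lambda>z :: complex. z) \<in> polynomial_functions {\<lambda>z. z}" by (rule polynomial_functions.coord) simp
    then have 1: "(\<lambda>z. g $$ (i, j) * z ^ (w j - i)) \<in> polynomial_functions {\<lambda>z. z}"
      by (intro polynomial_functions.mult polynomial_functions.const polynomial_functions_power)
    have 2: "(\<lambda>z. 0) \<in> polynomial_functions {\<lambda>z :: complex. z}" by (rule polynomial_functions.const)
    have "(\<lambda>z. f (degeneration n w g z)) \<in> polynomial_functions {\<lambda>z. z}"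
      using ij 1 2 by (cases "i \<le> w j") (simp_all add: degeneration_def)
    then show "(\<lambda>z. f (degeneration n w g z)) \<in> reg ?A (points ?A)"
      by (intro polynomial_functions_reg openin_topspace)
  qed
  from morphism_compose[OF this morphism_quotient_map]
  have "morphism ?A (flag_variety n) (flag_point n \<circ> degeneration n w g)"
    unfolding flag_variety_def .
  then have "morphism ?A (Peterson_variety n) (flag_point n \<circ> degeneration n w g)"
    unfolding Peterson_variety_def
    by (rule morphism_into_induced_on[OF fsA]) (simp add: degeneration_Pet)
  then show ?thesis by (simp add: o_def)
qed

text \<open>
  Along the curve the section is \<open>v * z powi N\<close> with \<open>N < 0\<close> in the trivialization, which is regular
  at \<open>z = 0\<close> only if \<open>v = 0\<close>.
\<close>

lemma negative_weight_vanishing: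
  assumes \<chi>: "\<And>k. 1 \<le> k \<Longrightarrow> k < n \<Longrightarrow> \<chi> (Suc k) \<le> \<chi> k" "\<chi> (Suc n) = 0"
    and neg: "pairing n \<chi> w < 0"
    and s: "Pet_section n \<chi> s" "G0_invariant_section n s"
  shows "s (flag_point n g) = zero_vector (flag_point n g)"
proof -
  let ?A = "coordinate_space UNIV {\<lambda>z :: complex. z}"
  let ?P = "polynomial_functions {\<lambda>z :: complex. z}"
  let ?f = "minor_product n \<chi> w"
  let ?\<gamma> = "degeneration n w g"
  have w: "w ` {..<n} \<subseteq> {..<n}" "inj_on w {..<n}" using piv by (auto simp: pivots_def)
  have fB: "?f (h * b) = ?f h * char_value n \<chi> b" if "h \<in> GL n" "b \<in> Borel n" for h b
    by (rule minor_product_mult_Borel[where \<chi> = \<chi>, OF that w(1) \<chi>(2)])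
  have freg: "?f \<in> reg (GL_space n) (GL n)" by (rule minor_product_regular[where \<chi> = \<chi>, OF w \<chi>(1)])
  have one: "?f (?\<gamma> z) = 1" for z by (rule minor_product_pivots[OF pivots_degeneration]) simp
  have fg: "?f g = 1" by (rule minor_product_pivots[OF piv]) simp
  define W where "W = {line_class n \<chi> (g, v) | g v. g \<in> GL n \<and> ?f g \<noteq> 0}"
  have oW: "openin (zar (line_bundle n \<chi>)) W" and tr: "trivialization ?f \<in> reg (line_bundle n \<chi>) W"
    unfolding W_def by (rule trivialization_regular[OF freg fB], assumption+)+
  obtain v where v: "s (flag_point n g) = line_class n \<chi> (g, v)"
    using section_representative[OF s(1) g] by blast
  have sm: "morphism (Peterson_variety n) (line_bundle n \<chi>) s" using s(1) by (simp add: Pet_section_def)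
  have comp: "morphism ?A (line_bundle n \<chi>) (s \<circ> (\<lambda>z. flag_point n (?\<gamma> z)))"
    by (rule morphism_compose[OF degeneration_morphism sm])
  let ?h = "trivialization ?f \<circ> (s \<circ> (\<lambda>z. flag_point n (?\<gamma> z)))"
  let ?U = "{z \<in> points ?A. (s \<circ> (\<lambda>z. flag_point n (?\<gamma> z))) z \<in> W}"
  have h: "?h \<in> reg ?A ?U" by (rule morphism_reg[OF comp oW tr])
  \<comment> \<open>The trivializing function is identically \<open>1\<close> along
    \<open>degeneration\<close>, so the curve never leaves the locus where it is nonzero.\<close>
  have "0 \<in> ?U"
  proof -
    obtain u where "s (flag_point n (?\<gamma> 0)) = line_class n \<chi> (?\<gamma> 0, u)"
      using section_representative[OF s(1) degeneration_GL degeneration_Pet] by blast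
    then show ?thesis
      using degeneration_GL one by (auto simp: W_def points_coordinate_space)
  qed
  with h obtain r p q where pq: "r \<in> ?P" "p \<in> ?P" "q \<in> ?P" "r 0 \<noteq> 0"
    "\<And>z. z \<in> UNIV \<Longrightarrow> r z \<noteq> 0 \<Longrightarrow> z \<in> ?U \<and> q z \<noteq> 0 \<and> ?h z = p z / q z"
    by (rule reg_coordinate_spaceE) (rule that)
  define m where "m = nat (- pairing n \<chi> w)"
  have m: "m > 0" "pairing n \<chi> w = - int m" using neg by (auto simp: m_def)
  have hz: "?h z = v / z ^ m" if z: "z \<noteq> 0" for z
  proof -
    let ?l = "lam n (inverse z)"
    have l: "?l \<in> G0 n" unfolding G0_def using z by (intro CollectI exI[of _ "inverse z"]) auto
    have lg: "?l * g \<in> GL n" using z by (intro GL_mult lam_in_GL g) simp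
    have "s (flag_point n (?\<gamma> z)) = s (flag_act ?l (flag_point n g))"
      using z by (simp add: degeneration_flag flag_act_flag_point lam_in_GL g)
    also have "\<dots> = bundle_act ?l (s (flag_point n g))"
      using s(2) l g(2) by (simp add: G0_invariant_section_def)
    finally have act: "s (flag_point n (?\<gamma> z)) = bundle_act ?l (s (flag_point n g))" .
    obtain u where u: "s (flag_point n (?\<gamma> z)) = line_class n \<chi> (?\<gamma> z, u)"
      using section_representative[OF s(1) degeneration_GL degeneration_Pet] by blast
    have "(?l * g, v) \<in> line_class n \<chi> (?\<gamma> z, u)"
      using bundle_act_line_class[OF g(1), of ?l v \<chi>] act u v by simp
    from trivialization_eq[OF fB[OF degeneration_GL] degeneration_GL this]
    have "?h z = v / ?f (?l * g)" by (simp add: u)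
    \<comment> \<open>Invariance keeps the fibre coordinate \<open>v\<close> fixed at the
      representative \<open>?l * g\<close>, so the whole dependence on \<open>z\<close> comes from
      the trivializing function.\<close>
    also have "?f (?l * g) = inverse z powi pairing n \<chi> w"
      using minor_product_lam_mult[OF g(1), of "inverse z" w \<chi>] z w(1) \<chi>(2) fg by simp
    also have "\<dots> = z ^ m" unfolding m(2) by (simp add: power_int_minus power_inverse)
    finally show ?thesis .
  qed
  \<comment> \<open>Clearing denominators in \<open>v / z ^ m = p z / q z\<close> gives an identity
    valid near zero but not at it; continuity extends it to \<open>z = 0\<close>, where
    \<open>m > 0\<close> kills the second term.\<close>
  define D where "D z = v * q z - p z * z ^ m" for z
  have zero: "D z = 0" if "z \<noteq> 0" "r z \<noteq> 0" for z
    using pq(5)[of z] hz[OF that(1)] that by (simp add: D_def field_simps)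
  have "isCont D 0"
    unfolding D_def using polynomial_function_isCont[OF pq(2)] polynomial_function_isCont[OF pq(3)]
    by (intro continuous_intros)
  then have lim: "(D \<longlongrightarrow> D 0) (at 0)" by (simp add: isCont_def)
  have "(r \<longlongrightarrow> r 0) (at 0)" using polynomial_function_isCont[OF pq(1)] by (simp add: isCont_def)
  then have "\<forall>\<^sub>F z in at 0. r z \<noteq> 0" using pq(4) by (rule tendsto_imp_eventually_ne)
  then have "\<forall>\<^sub>F z in at 0. D z = 0"
    using eventually_neq_at_within[of 0 0 UNIV] by eventually_elim (use zero in auto)
  then have "(D \<longlongrightarrow> 0) (at 0)" by (rule tendsto_eventually)
  then have "D 0 = 0" using lim by (intro tendsto_unique[of "at 0" D]) auto
  then have "v * q 0 = 0" using m(1) by (simp add: D_def)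
  moreover have "q 0 \<noteq> 0" using pq(4,5) by blast
  ultimately have "v = 0" by simp
  then show ?thesis unfolding v by (simp add: line_class_zero)
qed

end

section \<open>The open cell\<close>

text \<open>A function of the sum of row and column, since multiplication by
  \<open>w\<^sub>0\<close> turns the constant diagonals of a matrix commuting with
  \<open>nilp n\<close> into antidiagonals. The coordinate \<open>a $ j\<close> sits
  \<open>j + 1\<close> steps above the main antidiagonal, which is the source of its weight.\<close>

definition cell_entry :: "nat \<Rightarrow> complex vec \<Rightarrow> nat \<Rightarrow> complex"
  where "cell_entry n a i = (if i = n - 1 then 1 else if i < n - 1 then a $ (n - 2 - i) else 0)"

text \<open>
  \<open>cell_matrix n a\<close> is \<open>u w\<^sub>0\<close>, where \<open>u\<close> is the element of the centralizer of \<open>nilp n\<close> with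
  superdiagonals \<open>1\<close>, \<open>a $ 0\<close>, \<open>a $ 1\<close>, ...
\<close>

definition cell_matrix :: "nat \<Rightarrow> complex vec \<Rightarrow> complex mat"
  where "cell_matrix n a = mat n n (\<lambda>(i, l). cell_entry n a (i + l))"

lemma cell_matrix_carrier [simp]: "cell_matrix n a \<in> carrier_mat n n"
  by (simp add: cell_matrix_def)

lemma pivots_cell_matrix:
  assumes "n \<ge> 1"
  shows "pivots n (\<lambda>i. i) (\<lambda>l. n - 1 - l) (cell_matrix n a)"
  using assms by (auto simp: pivots_def inj_on_def cell_matrix_def cell_entry_def split: if_splits)

lemma cell_matrix_GL: "n \<ge> 1 \<Longrightarrow> cell_matrix n a \<in> GL n"
  by (rule pivots_GL[OF _ pivots_cell_matrix]) auto

lemma cell_matrix_Pet: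
  assumes n: "n \<ge> 1"
  shows "flag_point n (cell_matrix n a) \<in> Pet n"
proof -
  \<comment> \<open>Multiplication by \<open>nilp n\<close> shifts the argument of
    \<open>cell_entry\<close> through the row, multiplication by \<open>H\<close> through the
    column; the effect is the same.\<close>
  define H where "H = mat n n (\<lambda>(i, j). if i = Suc j then 1 else 0 :: complex)"
  let ?M = "cell_matrix n a"
  have "hessenberg n H" by (simp add: hessenberg_def H_def)
  moreover have "nilp n * ?M = ?M * H"
  proof (rule eq_matI)
    fix i j assume "i < dim_row (?M * H)" "j < dim_col (?M * H)"
    then have ij: "i < n" "j < n" by (auto simp: H_def cell_matrix_def)
    have "(?M * H) $$ (i, j) = (\<Sum>l<n. ?M $$ (i, l) * H $$ (l, j))"
      using ij by (intro times_mat_entry[of _ n n _ n]) (auto simp: H_def)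
    also have "\<dots> = (\<Sum>l<n. if l = Suc j then ?M $$ (i, Suc j) else 0)"
      using ij by (intro sum.cong) (auto simp: H_def)
    also have "\<dots> = (if Suc j < n then ?M $$ (i, Suc j) else 0)" by simp
    also have "\<dots> = (if Suc i < n then ?M $$ (Suc i, j) else 0)"
      using ij by (auto simp: cell_matrix_def cell_entry_def)
    also have "\<dots> = (nilp n * ?M) $$ (i, j)"
      using nilp_mult_entry[of ?M n n i j] ij by simp
    finally show "(nilp n * ?M) $$ (i, j) = (?M * H) $$ (i, j)" by simp
  qed (auto simp: H_def nilp_def cell_matrix_def)
  ultimately show ?thesis using flag_point_in_Pet_iff[OF cell_matrix_GL[OF n]] by blast
qed

text \<open>The columns of \<open>cell_matrix\<close> are the vectors \<open>N\<^sup>l v\<close>, which lie in the \<open>l\<close>-th step of the flag.\<close>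

lemma flag_point_eq_cell:
  assumes n: "n \<ge> 1" and g: "g \<in> GL n" "flag_point n g \<in> Pet n" "g $$ (n - 1, 0) \<noteq> 0"
  shows "flag_point n g = flag_point n (cell_matrix n (vec (n - 1) (\<lambda>j. g $$ (n - 2 - j, 0) / g $$ (n - 1, 0))))"
    (is "_ = flag_point n (cell_matrix n ?a)")
proof -
  let ?M = "cell_matrix n ?a"
  obtain H where H: "hessenberg n H" "nilp n * g = g * H" using flag_point_in_Pet_iff[OF g(1)] g(2) by blast
  have gc: "g \<in> carrier_mat n n" using g by simp
  have Hc: "H \<in> carrier_mat n n" using H by (simp add: hessenberg_def)
  \<comment> \<open>\<open>c l\<close> is \<open>H\<^sup>l\<close> applied to the first basis
    vector, that is, the coefficients of \<open>N\<^sup>l\<close> times the first column of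
    \<open>g\<close> with respect to the columns of \<open>g\<close>.\<close>
  define c where "c l = ((\<lambda>x m. \<Sum>j<n. H $$ (m, j) * x j) ^^ l) (\<lambda>m. if m = 0 then 1 else 0 :: complex)" for l
  have c0: "c 0 = (\<lambda>m. if m = 0 then 1 else 0)" by (simp add: c_def)
  have cS: "c (Suc l) m = (\<Sum>j<n. H $$ (m, j) * c l j)" for l m by (simp add: c_def)
  \<comment> \<open>A Hessenberg matrix extends the support by at most one position, which makes the
    matrix with columns \<open>c l\<close> upper triangular.\<close>
  have supp: "c l m = 0" if "l < m" "m < n" for l m
    using that
  proof (induction l arbitrary: m)
    case (Suc l)
    have "H $$ (m, j) * c l j = 0" if "j < n" for j
    proof (cases "j \<le> l")
      case True
      then show ?thesis using H(1) Suc.prems that by (simp add: hessenberg_def)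
    next
      case False
      then show ?thesis using Suc.IH[of j] that by simp
    qed
    then show ?case unfolding cS by (intro sum.neutral) simp
  qed (simp add: c0)
  have gcol: "(\<Sum>m<n. g $$ (i, m) * c l m) = (if i + l < n then g $$ (i + l, 0) else 0)" if "i < n" for i l
    using that
  proof (induction l arbitrary: i)
    case 0
    have "(\<Sum>m<n. g $$ (i, m) * c 0 m) = (\<Sum>m<n. if m = 0 then g $$ (i, 0) else 0)"
      by (intro sum.cong) (auto simp: c0)
    then show ?case using 0 n by simp
  next
    case (Suc l)
    have "(\<Sum>m<n. g $$ (i, m) * c (Suc l) m) = (\<Sum>j<n. (\<Sum>m<n. g $$ (i, m) * H $$ (m, j)) * c l j)"
      unfolding cS sum_distrib_left sum_distrib_right mult.assoc by (rule sum.swap)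
    also have "\<dots> = (\<Sum>j<n. (if Suc i < n then g $$ (Suc i, j) else 0) * c l j)"
    proof (intro sum.cong refl)
      fix j assume "j \<in> {..<n}"
      then have j: "j < n" by simp
      show "(\<Sum>m<n. g $$ (i, m) * H $$ (m, j)) * c l j = (if Suc i < n then g $$ (Suc i, j) else 0) * c l j"
        using times_mat_entry[OF gc Hc Suc.prems j] nilp_mult_entry[OF gc Suc.prems j] H(2) by simp
    qed
    also have "\<dots> = (if i + Suc l < n then g $$ (i + Suc l, 0) else 0)"
      using Suc.IH[of "Suc i"] by (cases "Suc i < n") simp_all
    finally show ?case .
  qed
  define b where "b = mat n n (\<lambda>(m, l). c l m / g $$ (n - 1, 0))"
  have bc: "b \<in> carrier_mat n n" by (simp add: b_def)
  have gb: "g * b = ?M"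
  proof (rule eq_matI)
    fix i l assume "i < dim_row ?M" "l < dim_col ?M"
    then have il: "i < n" "l < n" by (auto simp: cell_matrix_def)
    have "(g * b) $$ (i, l) = (\<Sum>m<n. g $$ (i, m) * c l m) / g $$ (n - 1, 0)"
      using times_mat_entry[OF gc bc il] il by (simp add: b_def sum_divide_distrib)
    also have "\<dots> = (if i + l < n then g $$ (i + l, 0) else 0) / g $$ (n - 1, 0)" unfolding gcol[OF il(1)] ..
    also have "\<dots> = cell_entry n ?a (i + l)"
    proof -
      consider "i + l = n - 1" | "i + l < n - 1" | "i + l \<ge> n" by linarith
      then show ?thesis
      proof cases
        case 2
        then have "n - 2 - (n - 2 - (i + l)) = i + l" "n - 2 - (i + l) < n - 1" by auto
        then show ?thesis using 2 by (simp add: cell_entry_def)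
      qed (use n g(3) in \<open>auto simp: cell_entry_def\<close>)
    qed
    finally show "(g * b) $$ (i, l) = ?M $$ (i, l)" using il by (simp add: cell_matrix_def)
  qed (use gc bc in \<open>auto simp: cell_matrix_def\<close>)
  have "det g * det b \<noteq> 0"
    using cell_matrix_GL[OF n, of ?a] det_mult[OF gc bc] unfolding GL_iff_det gb by simp
  then have "b \<in> GL n" unfolding GL_iff_det using bc by simp
  moreover have "upper_triangular b"
    using supp bc by (auto simp: upper_triangular_def b_def)
  ultimately have "b \<in> Borel n" by (simp add: Borel_def)
  from flag_point_mult_Borel[OF g(1) this] show ?thesis unfolding gb by simp
qed

text \<open>\<open>D\<close> is the torus element conjugated by \<open>w\<^sub>0\<close>, and
  conjugating the unipotent factor by \<open>lam n t\<close> multiplies its superdiagonal at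
  distance \<open>j + 1\<close> by \<open>inverse t ^ (j + 1)\<close>.\<close>

lemma lam_cell_matrix:
  assumes n: "n \<ge> 1" and a: "a \<in> carrier_vec (n - 1)" and t: "t \<noteq> 0"
  defines "D \<equiv> mat n n (\<lambda>(i, j). if i = j then t ^ (n - i) else 0)"
  shows "lam n t * cell_matrix n a = cell_matrix n (weighted_scale [1..<n] (inverse t) a) * D"
proof -
  let ?a = "weighted_scale [1..<n] (inverse t) a"
  have Dc: "D \<in> carrier_mat n n" by (simp add: D_def)
  have entry: "t ^ Suc i * cell_entry n a (i + l) = cell_entry n ?a (i + l) * t ^ (n - l)" if il: "i < n" "l < n" for i l
  proof -
    consider "i + l = n - 1" | "i + l < n - 1" | "i + l \<ge> n" by linarith
    then show ?thesis
    proof cases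
      case 1
      then have "n - l = Suc i" using il by simp
      then show ?thesis using 1 by (simp add: cell_entry_def)
    next
      case 2
      define j where "j = n - 2 - (i + l)"
      have j: "j < n - 1" "n - l = Suc i + Suc j" using 2 il by (auto simp: j_def)
      have "?a $ j = inverse t ^ Suc j * a $ j" using j(1) by (simp add: nth_upt)
      then have "?a $ j * t ^ (n - l) = t ^ Suc i * a $ j"
        using t unfolding j(2) power_add by (simp add: power_inverse field_simps)
      moreover have "cell_entry n b (i + l) = b $ j" for b using 2 by (simp add: cell_entry_def j_def)
      ultimately show ?thesis by (simp only:)
    qed (use n in \<open>auto simp: cell_entry_def\<close>)
  qed
  show ?thesis
  proof (rule eq_matI)
    fix i l assume "i < dim_row (cell_matrix n ?a * D)" "l < dim_col (cell_matrix n ?a * D)"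
    then have il: "i < n" "l < n" by (auto simp: cell_matrix_def D_def)
    have "(cell_matrix n ?a * D) $$ (i, l) = (\<Sum>m<n. cell_matrix n ?a $$ (i, m) * D $$ (m, l))"
      using il Dc by (intro times_mat_entry[of _ n n _ n]) auto
    also have "\<dots> = (\<Sum>m<n. if m = l then cell_entry n ?a (i + l) * t ^ (n - l) else 0)"
      using il by (intro sum.cong) (auto simp: D_def cell_matrix_def)
    also have "\<dots> = (lam n t * cell_matrix n a) $$ (i, l)"
      using il entry[OF il] lam_mult_entry[of "cell_matrix n a" n n i l t] by (simp add: cell_matrix_def)
    finally show "(lam n t * cell_matrix n a) $$ (i, l) = (cell_matrix n ?a * D) $$ (i, l)" by simp
  qed (auto simp: lam_def D_def cell_matrix_def)
qed

lemma diagonal_in_Borel: "t \<noteq> 0 \<Longrightarrow> mat n n (\<lambda>(i, j). if i = j then t ^ (n - i) else 0) \<in> Borel n"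
  unfolding Borel_iff by auto

lemma flag_act_cell:
  assumes n: "n \<ge> 1" and a: "a \<in> carrier_vec (n - 1)" and t: "t \<noteq> 0"
  shows "flag_act (lam n t) (flag_point n (cell_matrix n a)) =
    flag_point n (cell_matrix n (weighted_scale [1..<n] (inverse t) a))"
  using flag_act_flag_point[OF lam_in_GL[OF t] cell_matrix_GL[OF n, of a]] lam_cell_matrix[OF n a t]
    flag_point_mult_Borel[OF cell_matrix_GL[OF n] diagonal_in_Borel[OF t]] by simp

section \<open>The semistable locus\<close>

text \<open>The torus element with parameter \<open>2\<close> fixes this point and multiplies its
  fibre by a power of \<open>2\<close> with nonzero exponent, so an invariant vector in the fibre is
  zero. Any parameter that is not a root of unity would serve.\<close>

lemma fixed_point_section_zero:
  assumes n: "n \<ge> 2" and \<chi>: "(\<lambda>i. real_of_int (\<chi> i)) \<in> regular_dominant n"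
    and s: "Pet_section n \<chi> s" "G0_invariant_section n s"
  shows "s (flag_point n (cell_matrix n (0\<^sub>v (n - 1)))) = zero_vector (flag_point n (cell_matrix n (0\<^sub>v (n - 1))))"
proof -
  let ?M = "cell_matrix n (0\<^sub>v (n - 1))" and ?t = "2 :: complex"
  let ?x = "flag_point n ?M"
  have n1: "n \<ge> 1" using n by simp
  define D where "D = mat n n (\<lambda>(i, j). if i = j then ?t ^ (n - i) else 0)"
  have D: "D \<in> Borel n" unfolding D_def by (rule diagonal_in_Borel) simp
  have M: "?M \<in> GL n" by (rule cell_matrix_GL[OF n1])
  have Pet: "?x \<in> Pet n" by (rule cell_matrix_Pet[OF n1])
  have "weighted_scale [1..<n] (inverse ?t) (0\<^sub>v (n - 1)) = 0\<^sub>v (n - 1)"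
    by (intro eq_vecI) auto
  then have lM: "lam n ?t * ?M = ?M * D" and fixed: "flag_act (lam n ?t) ?x = ?x"
    using lam_cell_matrix[OF n1, of "0\<^sub>v (n - 1)" ?t] flag_act_cell[OF n1, of "0\<^sub>v (n - 1)" ?t]
    by (simp_all add: D_def)
  obtain v where v: "s ?x = line_class n \<chi> (?M, v)" using section_representative[OF s(1) M Pet] by blast
  have "lam n ?t \<in> G0 n" unfolding G0_def by (intro CollectI exI[of _ ?t]) simp
  then have "s ?x = bundle_act (lam n ?t) (s ?x)"
    using s(2) Pet fixed unfolding G0_invariant_section_def by metis
  then have "(?M * D, v) \<in> line_class n \<chi> (?M, v)"
    using bundle_act_line_class[OF M, of "lam n ?t" v \<chi>] v lM by simp
  then obtain b where b: "b \<in> Borel n" "?M * D = ?M * b" "v = char_value n \<chi> b * v"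
    unfolding line_class_eq by blast
  have "D = b"
  proof -
    obtain h where h: "h \<in> GL n" "h * ?M = 1\<^sub>m n" using GL_inverse[OF M] by blast
    have "h * ?M * D = h * ?M * b"
      using b(1,2) h(1) D M square_mult_assoc[of h n ?M D] square_mult_assoc[of h n ?M b] by simp
    then show ?thesis unfolding h(2) using D b(1) left_mult_one_mat[of D n n] left_mult_one_mat[of b n n] by simp
  qed
  define w where "w l = n - 1 - l" for l
  have "char_value n \<chi> D = (\<Prod>i=1..n. (?t ^ Suc (w (i - 1))) powi \<chi> i)"
    unfolding char_value_def by (intro prod.cong) (auto simp: D_def w_def Suc_diff_le)
  also have "\<dots> = ?t powi pairing n \<chi> w" by (rule prod_powi_pairing) simp
  finally have cv: "char_value n \<chi> D = ?t powi pairing n \<chi> w" .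
  have "pairing n \<chi> w > 0"
  proof -
    have "real_of_int (pairing n \<chi> w) = (\<Sum>l<n. real (n - l) * real_of_int (\<chi> (Suc l)))"
      unfolding real_pairing w_def by (intro sum.cong) auto
    then show ?thesis using regular_dominant_pairing_positive[OF \<chi> n] by simp
  qed
  then obtain m where m: "pairing n \<chi> w = int (Suc m)" by (metis zero_less_imp_eq_int gr0_implies_Suc)
  have "char_value n \<chi> b \<noteq> 1"
  proof
    assume "char_value n \<chi> b = 1"
    then have "?t powi int (Suc m) = 1" using cv \<open>D = b\<close> m by metis
    then have "?t ^ Suc m = 1" by (simp only: power_int_of_nat)
    then have "norm (?t ^ Suc m) = 1" by simp
    then show False using one_less_power[of "2::real" "Suc m"] by (simp add: norm_power del: power_Suc)
  qed
  then have "v = 0" using b(3) by (metis mult_cancel_right1)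
  then show ?thesis unfolding v by (simp add: line_class_zero)
qed

text \<open>The extremal section for \<open>w0\<close> is nonzero on the whole cell and has positive
  weight; the one for the limit at \<open>t = 0\<close> is nonzero at the given point and has
  negative weight. Raising each to the absolute value of the weight of the other makes the total
  weight zero.\<close>

lemma cell_semistable:
  assumes n: "n \<ge> 2" and \<chi>: "(\<lambda>i. real_of_int (\<chi> i)) \<in> deep_chamber n"
    and a: "a \<in> carrier_vec (n - 1)" "a \<noteq> 0\<^sub>v (n - 1)"
  shows "flag_point n (cell_matrix n a) \<in> Pet_ss n \<chi>"
proof -
  let ?M = "cell_matrix n a"
  have n1: "n \<ge> 1" using n by simp
  have M: "?M \<in> GL n" and Pet: "flag_point n ?M \<in> Pet n"
    using cell_matrix_GL[OF n1] cell_matrix_Pet[OF n1] by auto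
  have rd: "(\<lambda>i. real_of_int (\<chi> i)) \<in> regular_dominant n" using \<chi> by (simp add: deep_chamber_def)
  have mono: "\<chi> (Suc k) \<le> \<chi> k" if "1 \<le> k" "k < n" for k
    using rd that by (force simp: regular_dominant_def)
  have end0: "\<chi> (Suc n) = 0" using rd by (auto simp: regular_dominant_def)
  define w0 where "w0 l = n - 1 - l" for l
  have piv0: "pivots n (\<lambda>i. i) w0 ?M" unfolding w0_def by (rule pivots_cell_matrix[OF n1])
  have w0: "w0 ` {..<n} \<subseteq> {..<n}" "inj_on w0 {..<n}" using piv0 by (auto simp: pivots_def)
  have pos: "pairing n \<chi> w0 > 0"
  proof -
    have "real_of_int (pairing n \<chi> w0) = (\<Sum>l<n. real (n - l) * real_of_int (\<chi> (Suc l)))"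
      unfolding real_pairing w0_def by (intro sum.cong) auto
    then show ?thesis using regular_dominant_pairing_positive[OF rd n] by simp
  qed
  \<comment> \<open>The row order is reversed because, as \<open>t\<close> tends to zero, the
    topmost nonzero entry of a column dominates.\<close>
  define \<sigma> where "\<sigma> i = n - 1 - i" for i
  have \<sigma>: "inj_on \<sigma> {..<n}" by (auto simp: \<sigma>_def inj_on_def)
  obtain b w where b: "b \<in> Borel n" and piv: "pivots n \<sigma> w (?M * b)" using pivots_exist[OF M \<sigma>] by blast
  have w: "w ` {..<n} \<subseteq> {..<n}" "inj_on w {..<n}" using piv by (auto simp: pivots_def)
  have Mb: "?M * b \<in> GL n" by (rule GL_mult[OF M Borel_GL[OF b]])
  have neg: "pairing n \<chi> w < 0"
  proof (rule pivots_pairing_negative[OF \<chi> Mb _ piv \<sigma>])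
    show "flag_point n (?M * b) \<in> Pet n" using Pet flag_point_mult_Borel[OF M b] by simp
    show "\<sigma> i \<le> \<sigma> j" if "Suc i < n" "Suc j < n" "\<sigma> (Suc i) \<le> \<sigma> (Suc j)" for i j
      using that by (simp add: \<sigma>_def)
    \<comment> \<open>A nonzero coordinate of \<open>a\<close> is a nonzero entry of the first
      column above its bottom row; multiplication by \<open>b\<close> only rescales this column, so
      its topmost nonzero entry lies above the bottom row.\<close>
    obtain j where j: "j < n - 1" "a $ j \<noteq> 0" using a by (auto simp: vec_eq_iff)
    define i where "i = n - 2 - j"
    have "n - 2 - i = j" "i < n - 1" using j(1) by (auto simp: i_def)
    then have i: "i < n - 1" "cell_entry n a i \<noteq> 0" using j(2) by (auto simp: cell_entry_def)
    have "(?M * b) $$ (i, 0) = (\<Sum>m<n. ?M $$ (i, m) * b $$ (m, 0))"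
      using i b by (intro times_mat_entry[of _ n n _ n]) auto
    also have "\<dots> = (\<Sum>m<n. if m = 0 then cell_entry n a i * b $$ (0, 0) else 0)"
      using i b by (intro sum.cong) (auto simp: cell_matrix_def Borel_lower)
    also have "\<dots> \<noteq> 0" using i b n by (simp add: Borel_diag)
    finally have "\<sigma> i \<le> \<sigma> (w 0)" using piv i n by (auto simp: pivots_def)
    then show "w 0 < n - 1" using i by (auto simp: \<sigma>_def)
  qed
  define A where "A = nat (- pairing n \<chi> w)"
  define B where "B = nat (pairing n \<chi> w0)"
  define F where "F g = minor_product n \<chi> w0 g ^ A * minor_product n \<chi> w g ^ B" for g
  interpret G: function_space "GL_space n" by (rule function_space_GL_space)
  have reg: "F \<in> reg (GL_space n) (GL n)"
    unfolding F_def
    by (intro G.reg_mult G.reg_power openin_GL minor_product_regular w w0 mono)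
  have FB: "F (g * b) = char_value n (\<lambda>i. int (A + B) * \<chi> i) b * F g" if "g \<in> GL n" "b \<in> Borel n" for g b
    unfolding F_def char_value_multiple minor_product_mult_Borel[where \<chi> = \<chi>, OF that w(1) end0]
      minor_product_mult_Borel[where \<chi> = \<chi>, OF that w0(1) end0]
    by (simp add: power_mult_distrib power_add mult_ac)
  have Fl: "F (lam n t * g) = F g" if "g \<in> GL n" "t \<noteq> 0" for g t
  proof -
    have "(t powi pairing n \<chi> w0) ^ A * (t powi pairing n \<chi> w) ^ B =
        t powi (pairing n \<chi> w0 * int A + pairing n \<chi> w * int B)"
      using that(2) by (simp add: power_int_add power_int_power')
    also have "pairing n \<chi> w0 * int A + pairing n \<chi> w * int B = 0"
      using pos neg by (simp add: A_def B_def)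
    finally have 1: "(t powi pairing n \<chi> w0) ^ A * (t powi pairing n \<chi> w) ^ B = 1" by simp
    have "F (lam n t * g) = F g * ((t powi pairing n \<chi> w0) ^ A * (t powi pairing n \<chi> w) ^ B)"
      unfolding F_def minor_product_lam_mult[where \<chi> = \<chi>, OF that w(1) end0] minor_product_lam_mult[where \<chi> = \<chi>, OF that w0(1) end0]
      by (simp add: power_mult_distrib mult_ac)
    then show ?thesis unfolding 1 by simp
  qed
  have FM: "F ?M \<noteq> 0"
  proof -
    have wn: "w i < n" if "i < n" for i using w(1) that by auto
    have "minor w k ?M \<noteq> 0" if "k \<le> n" for k
    proof -
      have "minor w k (?M * b) = 1" by (rule minor_pivots[OF piv \<sigma> that])
      then show ?thesis using minor_mult_Borel[of ?M n b k w] b that wn by auto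
    qed
    then have "minor_product n \<chi> w ?M \<noteq> 0" by (intro minor_product_nonzero) auto
    moreover have "minor_product n \<chi> w0 ?M = 1" by (rule minor_product_pivots[OF piv0]) simp
    ultimately show ?thesis by (simp add: F_def)
  qed
  let ?s = "\<lambda>x. (\<lambda>g. (g, F g)) ` x"
  have "Pet_section n (\<lambda>i. int (A + B) * \<chi> i) ?s"
    by (rule section_of_equivariant_function[OF reg FB])
  moreover have "G0_invariant_section n ?s"
    unfolding G0_invariant_section_def
  proof (intro ballI)
    fix h x assume "h \<in> G0 n" "x \<in> Pet n"
    then obtain t where t: "t \<noteq> 0" "h = lam n t" by (auto simp: G0_def)
    obtain g where g: "g \<in> GL n" "x = flag_point n g" using Pet_subset \<open>x \<in> Pet n\<close> by blast
    have "g' \<in> GL n" if "g' \<in> x" for g' using flag_point_mem[OF g(1)] that g(2) by blast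
    then show "?s (flag_act h x) = bundle_act h (?s x)"
      using Fl[OF _ t(1)] unfolding flag_act_def bundle_act_def t(2) image_image
      by (intro image_cong) auto
  qed
  moreover have "?s (flag_point n ?M) \<noteq> zero_vector (flag_point n ?M)"
  proof
    assume eq: "?s (flag_point n ?M) = zero_vector (flag_point n ?M)"
    have "(?M, F ?M) \<in> ?s (flag_point n ?M)" using flag_point_self[OF M] by blast
    then show False unfolding eq using FM by (simp add: zero_vector_def)
  qed
  moreover have "A + B \<ge> 1" using pos by (simp add: B_def)
  ultimately show ?thesis unfolding Pet_ss_def using Pet by blast
qed

lemma regular_dominant_multiple:
  assumes "(\<lambda>i. real_of_int (\<chi> i)) \<in> regular_dominant n" "k \<ge> 1"
  shows "(\<lambda>i. real_of_int (int k * \<chi> i)) \<in> regular_dominant n"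
  using assms by (auto simp: regular_dominant_def simp flip: sum_distrib_left)

lemma Pet_ss_eq:
  assumes n: "n \<ge> 2" and \<chi>: "(\<lambda>i. real_of_int (\<chi> i)) \<in> deep_chamber n"
  shows "Pet_ss n \<chi> = (\<lambda>a. flag_point n (cell_matrix n a)) ` (carrier_vec (n - 1) - {0\<^sub>v (n - 1)})"
proof (intro equalityI subsetI)
  fix x assume "x \<in> (\<lambda>a. flag_point n (cell_matrix n a)) ` (carrier_vec (n - 1) - {0\<^sub>v (n - 1)})"
  then show "x \<in> Pet_ss n \<chi>" using cell_semistable[OF n \<chi>] by auto
next
  fix x assume "x \<in> Pet_ss n \<chi>"
  then obtain k s where x: "x \<in> Pet n" and k: "k \<ge> 1" and s: "Pet_section n (\<lambda>i. int k * \<chi> i) s"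
    "G0_invariant_section n s" "s x \<noteq> zero_vector x" unfolding Pet_ss_def by blast
  have rd: "(\<lambda>i. real_of_int (\<chi> i)) \<in> regular_dominant n" using \<chi> by (simp add: deep_chamber_def)
  obtain g where g: "g \<in> GL n" "x = flag_point n g" using Pet_subset x by blast
  have n1: "n \<ge> 1" using n by simp
  \<comment> \<open>By \<open>flag_point_eq_cell\<close> a Peterson point with nonzero entry here
    lies in the cell; if the entry vanishes, the first pivot for the limit at infinity is above the
    bottom row.\<close>
  have "g $$ (n - 1, 0) \<noteq> 0"
  proof
    assume g0: "g $$ (n - 1, 0) = 0"
    have inj: "inj_on (\<lambda>i. i) {..<n}" by simp
    obtain b w where b: "b \<in> Borel n" and piv: "pivots n (\<lambda>i. i) w (g * b)" using pivots_exist[OF g(1) inj] by blast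
    have gb: "g * b \<in> GL n" by (rule GL_mult[OF g(1) Borel_GL[OF b]])
    have xb: "x = flag_point n (g * b)" using flag_point_mult_Borel[OF g(1) b] g(2) by simp
    have "(g * b) $$ (n - 1, 0) = (\<Sum>m<n. g $$ (n - 1, m) * b $$ (m, 0))"
      using g b n by (intro times_mat_entry[of _ n n _ n]) auto
    also have "\<dots> = 0"
    proof (intro sum.neutral ballI)
      fix m assume "m \<in> {..<n}"
      then show "g $$ (n - 1, m) * b $$ (m, 0) = 0" using g0 b by (cases "m = 0") (auto simp: Borel_lower)
    qed
    finally have "(g * b) $$ (n - 1, 0) = 0" .
    moreover have "(g * b) $$ (w 0, 0) = 1" using piv n by (simp add: pivots_def)
    ultimately have "w 0 \<noteq> n - 1" by auto
    moreover have "w 0 < n" using piv n by (auto simp: pivots_def image_subset_iff)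
    ultimately have "w 0 < n - 1" by simp
    then have neg: "pairing n \<chi> w < 0"
      using pivots_pairing_negative[OF \<chi> gb _ piv inj] x xb by simp
    have "pairing n (\<lambda>i. int k * \<chi> i) w = int k * pairing n \<chi> w"
      by (simp add: pairing_def sum_distrib_left mult_ac)
    then have negk: "pairing n (\<lambda>i. int k * \<chi> i) w < 0" using neg k by (simp add: mult_less_0_iff)
    have "s (flag_point n (g * b)) = zero_vector (flag_point n (g * b))"
    proof (rule negative_weight_vanishing[OF gb _ piv _ _ negk s(1,2)])
      show "flag_point n (g * b) \<in> Pet n" using x xb by simp
      show "int k * \<chi> (Suc j) \<le> int k * \<chi> j" if "1 \<le> j" "j < n" for j
        using rd that by (intro mult_left_mono) (force simp: regular_dominant_def)+
      show "int k * \<chi> (Suc n) = 0" using rd by (auto simp: regular_dominant_def)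
    qed
    then show False using s(3) xb by simp
  qed
  from flag_point_eq_cell[OF n1 g(1) _ this] obtain a where a: "a \<in> carrier_vec (n - 1)" "x = flag_point n (cell_matrix n a)"
    using x g(2) by (metis vec_carrier)
  \<comment> \<open>The origin lies in the cell, so it is the nontrivial torus action on its fibre
    that excludes it.\<close>
  have "a \<noteq> 0\<^sub>v (n - 1)"
    using fixed_point_section_zero[OF n regular_dominant_multiple[OF rd k] s(1,2)] s(3) a(2) by auto
  then show "x \<in> (\<lambda>a. flag_point n (cell_matrix n a)) ` (carrier_vec (n - 1) - {0\<^sub>v (n - 1)})"
    using a by blast
qed

section \<open>Quotients with closed orbits\<close>

text \<open>Orbits equal their closures, so meeting closures means meeting orbits, and orbits that
  meet coincide.\<close>

lemma s_class_closed_orbits: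
  assumes closed: "\<And>x. x \<in> points X \<Longrightarrow> closedin (zar X) (group_orbit G act x)"
    and eq: "\<And>x y. x \<in> points X \<Longrightarrow> y \<in> points X \<Longrightarrow>
      group_orbit G act x \<inter> group_orbit G act y \<noteq> {} \<Longrightarrow> y \<in> group_orbit G act x"
    and self: "\<And>x. x \<in> points X \<Longrightarrow> x \<in> group_orbit G act x"
    and x: "x \<in> points X"
  shows "s_class G act X x = group_orbit G act x"
proof -
  have "s_class G act X x = {y \<in> points X. group_orbit G act x \<inter> group_orbit G act y \<noteq> {}}"
    unfolding s_class_def using closure_of_closedin[OF closed] x by auto
  also have "\<dots> = group_orbit G act x"
  proof (intro equalityI subsetI)
    fix y assume "y \<in> {y \<in> points X. group_orbit G act x \<inter> group_orbit G act y \<noteq> {}}"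
    then show "y \<in> group_orbit G act x" using eq[OF x] by blast
  next
    fix y assume y: "y \<in> group_orbit G act x"
    then have "y \<in> points X" using closedin_subset[OF closed[OF x]] by blast
    then show "y \<in> {y \<in> points X. group_orbit G act x \<inter> group_orbit G act y \<noteq> {}}"
      using self y by blast
  qed
  finally show ?thesis .
qed

text \<open>The fibres of \<open>\<pi>\<close> are exactly the orbits, so invariant closed sets are
  full preimages; this gives both conditions on closed sets, while invariant functions descend by
  definition of the quotient structure. Affineness has to be supplied from outside, through the
  cover.\<close>

lemma good_quotient_orbit_space:
  assumes X: "function_space X"
    and orbit: "\<And>x y. x \<in> points X \<Longrightarrow> y \<in> points X \<Longrightarrow> \<pi> x = \<pi> y \<Longrightarrow> \<exists>g\<in>G. y = act g x"
    and inv: "\<And>g x. g \<in> G \<Longrightarrow> x \<in> points X \<Longrightarrow> \<pi> (act g x) = \<pi> x"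
    and cover: "\<Union> \<V> = \<pi> ` points X"
      "\<And>V. V \<in> \<V> \<Longrightarrow> openin (zar (quotient_space X \<pi>)) V"
      "\<And>V. V \<in> \<V> \<Longrightarrow> affine_variety (induced_on (quotient_space X \<pi>) V)"
      "\<And>V. V \<in> \<V> \<Longrightarrow> affine_variety (induced_on X {x \<in> points X. \<pi> x \<in> V})"
  shows "good_quotient G act X (quotient_space X \<pi>) \<pi>"
  unfolding good_quotient_def
proof (intro conjI allI impI ballI)
  interpret X: function_space X by fact
  let ?Y = "quotient_space X \<pi>"
  show "morphism X ?Y \<pi>" by (rule morphism_quotient_map)
  show "\<pi> ` points X = points ?Y" by simp
  show "\<pi> (act g x) = \<pi> x" if "g \<in> G" "x \<in> points X" for g x using inv that by blast
  show "\<exists>f\<in>reg ?Y U. \<forall>x\<in>points X. \<pi> x \<in> U \<longrightarrow> h x = f (\<pi> x)"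
    if h: "openin (zar ?Y) U \<and> h \<in> reg X {x \<in> points X. \<pi> x \<in> U} \<and>
       (\<forall>g\<in>G. \<forall>x\<in>points X. \<pi> x \<in> U \<longrightarrow> h (act g x) = h x)" for U h
  proof -
    define f where "f y = h (SOME x. x \<in> points X \<and> \<pi> x = y)" for y
    have f: "f (\<pi> x) = h x" if x: "x \<in> points X" "\<pi> x \<in> U" for x
    proof -
      let ?x = "SOME x'. x' \<in> points X \<and> \<pi> x' = \<pi> x"
      have x': "?x \<in> points X \<and> \<pi> ?x = \<pi> x" by (rule someI[of _ x]) (use x in simp)
      then obtain g where "g \<in> G" "?x = act g x" using orbit[OF x(1), of ?x] by metis
      then show ?thesis using h x unfolding f_def by metis
    qed
    have oU: "openin (zar X) {x \<in> points X. \<pi> x \<in> U}" using h by (simp add: openin_quotient_space)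
    have "f \<circ> \<pi> \<in> reg X {x \<in> points X. \<pi> x \<in> U}"
      by (rule X.reg_cong[OF oU]) (use h f in auto)
    then show ?thesis using f by (intro bexI[of _ f]) (auto simp: reg_quotient_space)
  qed
  have saturated: "x \<in> Z" if "invariant_set G act Z" "Z \<subseteq> points X" "x \<in> points X" "\<pi> x \<in> \<pi> ` Z" for Z x
  proof -
    from that(4) obtain z where z: "z \<in> Z" "\<pi> x = \<pi> z" by blast
    have "z \<in> points X" using z(1) that(2) by blast
    from orbit[OF this that(3) z(2)[symmetric]] obtain g where "g \<in> G" "x = act g z" by blast
    then show ?thesis using that(1) z(1) by (auto simp: invariant_set_def)
  qed
  show "closedin (zar ?Y) (\<pi> ` Z)" if Z: "closedin (zar X) Z \<and> invariant_set G act Z" for Z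
  proof -
    have Zs: "Z \<subseteq> points X" using Z closedin_subset by blast
    have "{x \<in> points X. \<pi> x \<in> points ?Y - \<pi> ` Z} = points X - Z"
      using saturated[of Z] Z Zs by auto
    then have "openin (zar ?Y) (points ?Y - \<pi> ` Z)"
      unfolding openin_quotient_space using Z by (auto simp: closedin_def)
    then show ?thesis using Zs by (auto simp: closedin_def)
  qed
  show "\<pi> ` Z \<inter> \<pi> ` Z' = {}"
    if Z: "closedin (zar X) Z \<and> invariant_set G act Z \<and> closedin (zar X) Z' \<and> invariant_set G act Z' \<and> Z \<inter> Z' = {}"
    for Z Z'
  proof (rule ccontr)
    assume "\<pi> ` Z \<inter> \<pi> ` Z' \<noteq> {}"
    then obtain y where "y \<in> \<pi> ` Z" "y \<in> \<pi> ` Z'" by (meson disjoint_iff)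
    then obtain z where z: "z \<in> Z'" "\<pi> z \<in> \<pi> ` Z" by (metis imageE)
    have sub: "Z \<subseteq> points X" "Z' \<subseteq> points X" using Z closedin_subset by metis+
    have "z \<in> Z" by (rule saturated[OF _ sub(1) _ z(2)]) (use Z z(1) sub(2) in auto)
    then show False using Z z(1) by auto
  qed
  show "\<exists>\<V>. \<Union> \<V> = points ?Y \<and> (\<forall>V\<in>\<V>. openin (zar ?Y) V \<and> affine_variety (induced_on ?Y V) \<and>
          affine_variety (induced_on X {x \<in> points X. \<pi> x \<in> V}))"
    using cover by (intro exI[of _ \<V>]) auto
qed

section \<open>The quotient of the semistable locus\<close>

text \<open>Ratios of entries in the first column do not depend on the representative of the coset,
  so an arbitrary one is chosen; on the cell they recover the argument of
  \<open>cell_matrix\<close>.\<close>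

definition cell_coordinates :: "nat \<Rightarrow> complex mat set \<Rightarrow> complex vec"
  where "cell_coordinates n x =
    (let g = SOME g. g \<in> x in vec (n - 1) (\<lambda>j. g $$ (n - 2 - j, 0) / g $$ (n - 1, 0)))"

lemma cell_coordinates_flag_point:
  assumes n: "n \<ge> 1" and g: "g \<in> GL n"
  shows "cell_coordinates n (flag_point n g) = vec (n - 1) (\<lambda>j. g $$ (n - 2 - j, 0) / g $$ (n - 1, 0))"
proof -
  have "(SOME h. h \<in> flag_point n g) \<in> flag_point n g" using flag_point_self[OF g] by (rule someI)
  then obtain b where b: "b \<in> Borel n" "(SOME h. h \<in> flag_point n g) = g * b" by (auto simp: flag_point_def)
  have "(g * b) $$ (i, 0) = g $$ (i, 0) * b $$ (0, 0)" if "i < n" for i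
  proof -
    have "(g * b) $$ (i, 0) = (\<Sum>m<n. g $$ (i, m) * b $$ (m, 0))"
      using g b n that by (intro times_mat_entry[of _ n n _ n]) auto
    also have "\<dots> = (\<Sum>m<n. if m = 0 then g $$ (i, 0) * b $$ (0, 0) else 0)"
      using b by (intro sum.cong) (auto simp: Borel_lower)
    finally show ?thesis using n by simp
  qed
  moreover have "b $$ (0, 0) \<noteq> 0" using b n by (simp add: Borel_diag)
  ultimately show ?thesis
    unfolding cell_coordinates_def b(2) Let_def using n by (intro eq_vecI) auto
qed

lemma cell_coordinates_cell:
  assumes n: "n \<ge> 1" and a: "a \<in> carrier_vec (n - 1)"
  shows "cell_coordinates n (flag_point n (cell_matrix n a)) = a"
  unfolding cell_coordinates_flag_point[OF n cell_matrix_GL[OF n]]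
proof (rule eq_vecI)
  fix j assume "j < dim_vec a"
  then have j: "j < n - 1" using a by simp
  then have "n - 2 - (n - 2 - j) = j" by simp
  then show "vec (n - 1) (\<lambda>j. cell_matrix n a $$ (n - 2 - j, 0) / cell_matrix n a $$ (n - 1, 0)) $ j = a $ j"
    using j n by (simp add: cell_matrix_def cell_entry_def)
qed (use a in simp)

lemma weighted_orbit_eq:
  assumes "b \<in> weighted_orbit ws a"
  shows "weighted_orbit ws b = weighted_orbit ws a"
proof -
  obtain t where "t \<noteq> 0" "b = weighted_scale ws t a" using assms by (auto simp: weighted_orbit_def)
  then show ?thesis by (simp add: weighted_orbit_scale)
qed

section \<open>The punctured cell as a model of the semistable locus\<close>

locale deep_linearization =
  fixes n :: nat and \<chi> :: "nat \<Rightarrow> int"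
  assumes n: "n \<ge> 2" and deep: "(\<lambda>i. real_of_int (\<chi> i)) \<in> deep_chamber n"
begin

abbreviation "X \<equiv> Pet_ss_space n \<chi>"
abbreviation "A \<equiv> punctured_space (n - 1)"
abbreviation "ws \<equiv> [1..<n]"
abbreviation "\<Theta> a \<equiv> flag_point n (cell_matrix n a)"
abbreviation "\<kappa> \<equiv> cell_coordinates n"
abbreviation "orbit \<equiv> group_orbit (G0 n) flag_act"

lemma n1: "n \<ge> 1" using n by simp

lemma positive_weights: "j < length ws \<Longrightarrow> ws ! j > 0"
  by simp

lemma function_space_X: "function_space X"
  unfolding Pet_ss_space_def by (intro function_space_induced_on function_space_Peterson_variety)

lemma points_X: "points X = Pet_ss n \<chi>"
  by (auto simp: Pet_ss_space_def Pet_ss_def)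

lemma Theta_in_X: "a \<in> points A \<Longrightarrow> \<Theta> a \<in> points X"
  unfolding points_X Pet_ss_eq[OF n deep] by simp

lemma X_cases:
  assumes "x \<in> points X"
  obtains a where "a \<in> points A" "x = \<Theta> a"
  using assms unfolding points_X Pet_ss_eq[OF n deep] by auto

lemma kappa_Theta: "a \<in> points A \<Longrightarrow> \<kappa> (\<Theta> a) = a"
  by (intro cell_coordinates_cell n1) simp

lemma kappa_in_A: "x \<in> points X \<Longrightarrow> \<kappa> x \<in> points A"
  using X_cases kappa_Theta by metis

lemma Theta_kappa: "x \<in> points X \<Longrightarrow> \<Theta> (\<kappa> x) = x"
  using X_cases kappa_Theta by metis

lemma morphism_Theta: "morphism A X \<Theta>"
proof -
  have fsA: "function_space A" by (rule function_space_punctured_space)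
  interpret A: function_space A by (rule fsA)
  have oA: "openin (zar A) (points A)" by (rule openin_topspace)
  have "morphism A (GL_space n) (cell_matrix n)"
    unfolding GL_space_def
  proof (rule morphism_to_coordinate_space[OF fsA])
    show "cell_matrix n a \<in> GL n" for a by (rule cell_matrix_GL[OF n1])
    fix f :: "complex mat \<Rightarrow> complex" assume "f \<in> {\<lambda>g. g $$ (i, j) | i j. i < n \<and> j < n}"
    then obtain i j where ij: "i < n" "j < n" "f = (\<lambda>g. g $$ (i, j))" by blast
    then have f: "(\<lambda>a. f (cell_matrix n a)) = (\<lambda>a. cell_entry n a (i + j))" by (simp add: cell_matrix_def)
    show "(\<lambda>a. f (cell_matrix n a)) \<in> reg A (points A)"
    proof (cases "i + j < n - 1")
      case True
      then have "(\<lambda>a. a $ (n - 2 - (i + j))) \<in> reg A (points A)"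
        by (intro polynomial_reg_punctured_space coordinate_polynomial oA) simp
      then show ?thesis unfolding f using True by (simp add: cell_entry_def)
    next
      case False
      then have "(\<lambda>a. cell_entry n a (i + j)) = (\<lambda>_. if i + j = n - 1 then 1 else 0)"
        by (auto simp: cell_entry_def)
      then show ?thesis unfolding f by (simp only: A.reg_const[OF oA])
    qed
  qed
  from morphism_compose[OF this morphism_quotient_map]
  have "morphism A (flag_variety n) (flag_point n \<circ> cell_matrix n)" unfolding flag_variety_def .
  then have 1: "morphism A (flag_variety n) \<Theta>" by (simp add: o_def)
  have "\<Theta> a \<in> Pet_ss n \<chi>" if "a \<in> points A" for a
    using Theta_in_X[OF that] unfolding points_X .
  then show ?thesis
    unfolding Pet_ss_space_def Peterson_variety_def
    by (intro morphism_into_induced_on function_space_induced_on fsA 1) (auto simp: cell_matrix_Pet[OF n1])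
qed

lemma morphism_kappa: "morphism X A \<kappa>"
proof -
  let ?F = "flag_variety n"
  \<comment> \<open>An open set of flags given by the first column alone, in general larger than the
    open Bruhat cell; it contains the semistable locus and the coordinate ratios are regular on
    it.\<close>
  define O1 where "O1 = {flag_point n g | g. g \<in> GL n \<and> g $$ (n - 1, 0) \<noteq> 0}"
  interpret G: function_space "GL_space n" by (rule function_space_GL_space)
  have co: "(\<lambda>g. g $$ (i, j)) \<in> reg (GL_space n) (GL n)" if "i < n" "j < n" for i j
    by (rule coordinate_reg_GL[OF that])
  let ?D = "{g \<in> GL n. g $$ (n - 1, 0) \<noteq> 0}"
  have oD: "openin (zar (GL_space n)) ?D" using n by (intro G.open_nonzero openin_GL co) auto
  have pre: "{g \<in> points (GL_space n). flag_point n g \<in> O1} = ?D"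
  proof (intro equalityI subsetI)
    fix g assume "g \<in> {g \<in> points (GL_space n). flag_point n g \<in> O1}"
    then obtain h where g: "g \<in> GL n" and h: "h \<in> GL n" "h $$ (n - 1, 0) \<noteq> 0" "flag_point n g = flag_point n h"
      unfolding O1_def by auto
    obtain b where b: "b \<in> Borel n" "h = g * b" using flag_point_eqD[OF h(1) h(3)[symmetric]] by blast
    have "h $$ (n - 1, 0) = (\<Sum>m<n. g $$ (n - 1, m) * b $$ (m, 0))"
      unfolding b(2) using g b n by (intro times_mat_entry[of _ n n _ n]) auto
    also have "\<dots> = (\<Sum>m<n. if m = 0 then g $$ (n - 1, 0) * b $$ (0, 0) else 0)"
      using b by (intro sum.cong) (auto simp: Borel_lower)
    also have "\<dots> = g $$ (n - 1, 0) * b $$ (0, 0)" using n by simp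
    finally have "g $$ (n - 1, 0) \<noteq> 0" using h(2) by auto
    then show "g \<in> ?D" using g by simp
  qed (auto simp: O1_def)
  have oO1: "openin (zar ?F) O1"
    unfolding flag_variety_def openin_quotient_space pre using oD by (auto simp: O1_def)
  have ss: "Pet_ss n \<chi> \<subseteq> O1"
    using cell_matrix_GL[OF n1] n unfolding Pet_ss_eq[OF n deep] O1_def
    by (auto simp: cell_matrix_def cell_entry_def intro!: exI)
  have reg: "(\<lambda>x. \<kappa> x $ j) \<in> reg X (points X)" if j: "j < n - 1" for j
  proof -
    have "(\<lambda>g. g $$ (n - 2 - j, 0) / g $$ (n - 1, 0)) \<in> reg (GL_space n) ?D"
    proof (intro G.reg_divide oD)
      show "(\<lambda>g. g $$ (n - 2 - j, 0)) \<in> reg (GL_space n) ?D"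
        by (rule G.reg_restrict[OF openin_GL oD _ co[of "n - 2 - j" 0]]) (use n in auto)
      show "(\<lambda>g. g $$ (n - 1, 0)) \<in> reg (GL_space n) ?D"
        by (rule G.reg_restrict[OF openin_GL oD _ co[of "n - 1" 0]]) (use n in auto)
    qed auto
    then have "(\<lambda>x. \<kappa> x $ j) \<circ> flag_point n \<in> reg (GL_space n) ?D"
      by (rule G.reg_cong[OF oD]) (use j cell_coordinates_flag_point[OF n1] in auto)
    then have 1: "(\<lambda>x. \<kappa> x $ j) \<in> reg ?F O1"
      unfolding flag_variety_def reg_quotient_space pre .
    have o2: "openin (zar (Peterson_variety n)) (O1 \<inter> Pet n)"
      unfolding Peterson_variety_def using oO1 by (auto simp: openin_subtopology)
    have 2: "(\<lambda>x. \<kappa> x $ j) \<in> reg (Peterson_variety n) (O1 \<inter> Pet n)"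
      unfolding Peterson_variety_def by (rule reg_induced_onI[OF oO1 _ 1]) simp
    show ?thesis
      unfolding points_X unfolding Pet_ss_space_def
      by (rule reg_induced_onI[OF o2 _ 2]) (use ss in \<open>auto simp: Pet_ss_def\<close>)
  qed
  show ?thesis
    unfolding punctured_space_def
  proof (intro morphism_into_induced_on morphism_to_affine_space function_space_X reg)
    fix x assume "x \<in> points X"
    from kappa_in_A[OF this] show "\<kappa> x \<in> carrier_vec (n - 1) - {0\<^sub>v (n - 1)}" by simp
    then show "\<kappa> x \<in> carrier_vec (n - 1)" by simp
  qed
qed

lemma act_Theta:
  "a \<in> points A \<Longrightarrow> t \<noteq> 0 \<Longrightarrow> flag_act (lam n t) (\<Theta> a) = \<Theta> (weighted_scale ws (inverse t) a)"
  by (intro flag_act_cell n1) auto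

lemma scale_in_A: "a \<in> points A \<Longrightarrow> t \<noteq> 0 \<Longrightarrow> weighted_scale ws t a \<in> points A"
  using weighted_scale_eq_zero_iff[of t a ws] weighted_scale_carrier[of ws t a] by simp

lemma orbit_Theta:
  assumes a: "a \<in> points A"
  shows "orbit (\<Theta> a) = \<Theta> ` weighted_orbit ws a"
proof (intro equalityI subsetI)
  fix x assume "x \<in> orbit (\<Theta> a)"
  then obtain t where "t \<noteq> 0" "x = flag_act (lam n t) (\<Theta> a)" by (auto simp: group_orbit_def G0_def)
  then have "x = \<Theta> (weighted_scale ws (inverse t) a)" "inverse t \<noteq> 0" using act_Theta[OF a] by auto
  then show "x \<in> \<Theta> ` weighted_orbit ws a" unfolding weighted_orbit_def by blast
next
  fix x assume "x \<in> \<Theta> ` weighted_orbit ws a"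
  then obtain t where t: "t \<noteq> 0" "x = \<Theta> (weighted_scale ws t a)" by (auto simp: weighted_orbit_def)
  then have "x = flag_act (lam n (inverse t)) (\<Theta> a)" using act_Theta[OF a, of "inverse t"] by simp
  moreover have "lam n (inverse t) \<in> G0 n" unfolding G0_def using t(1) by (intro CollectI exI[of _ "inverse t"]) simp
  ultimately show "x \<in> orbit (\<Theta> a)" by (simp add: group_orbit_def)
qed

lemma weighted_orbit_subset: "a \<in> points A \<Longrightarrow> weighted_orbit ws a \<subseteq> points A"
  unfolding weighted_orbit_def using scale_in_A by blast

text \<open>Written as a preimage under \<open>\<kappa>\<close>, an orbit inherits closedness from
  the weighted orbit in the punctured space.\<close>

lemma orbit_eq_preimage:
  assumes a: "a \<in> points A"
  shows "orbit (\<Theta> a) = {x \<in> points X. \<kappa> x \<in> weighted_orbit ws a}"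
proof (intro equalityI subsetI)
  fix x assume "x \<in> orbit (\<Theta> a)"
  then obtain b where b: "b \<in> weighted_orbit ws a" "x = \<Theta> b" unfolding orbit_Theta[OF a] by blast
  show "x \<in> {x \<in> points X. \<kappa> x \<in> weighted_orbit ws a}"
  proof -
    have "b \<in> points A" using weighted_orbit_subset[OF a] b by blast
    then show ?thesis using Theta_in_X kappa_Theta b by simp
  qed
next
  fix x assume x: "x \<in> {x \<in> points X. \<kappa> x \<in> weighted_orbit ws a}"
  then have "x = \<Theta> (\<kappa> x)" using Theta_kappa by simp
  then show "x \<in> orbit (\<Theta> a)" unfolding orbit_Theta[OF a] using x by blast
qed

lemma orbit_closed:
  assumes "x \<in> points X"
  shows "closedin (zar X) (orbit x)"
proof -
  obtain a where a: "a \<in> points A" "x = \<Theta> a" using X_cases[OF assms] .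
  have "closedin (zar (punctured_space (length ws))) (weighted_orbit ws a)"
    by (rule weighted_orbit_closed) (use a positive_weights in auto)
  then have "closedin (zar A) (weighted_orbit ws a)" by simp
  moreover have "continuous_map (zar X) (zar A) \<kappa>" using morphism_kappa by (simp add: morphism_def)
  ultimately show ?thesis
    unfolding a(2) orbit_eq_preimage[OF a(1)] by (rule closedin_continuous_map_preimage[rotated])
qed

lemma stabilizer_finite:
  assumes "x \<in> points X"
  shows "finite (group_stabilizer (G0 n) flag_act x)"
proof -
  obtain a where a: "a \<in> points A" "x = \<Theta> a" using X_cases[OF assms] .
  have "group_stabilizer (G0 n) flag_act x \<subseteq> (\<lambda>t. lam n (inverse t)) ` {t. weighted_scale ws t a = a}"
  proof
    fix h assume "h \<in> group_stabilizer (G0 n) flag_act x"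
    then obtain t where t: "t \<noteq> 0" "h = lam n t" "flag_act (lam n t) x = x"
      by (auto simp: group_stabilizer_def G0_def)
    then have "\<Theta> (weighted_scale ws (inverse t) a) = \<Theta> a" using act_Theta[OF a(1) t(1)] a(2) by simp
    then have "\<kappa> (\<Theta> (weighted_scale ws (inverse t) a)) = \<kappa> (\<Theta> a)" by simp
    then have "weighted_scale ws (inverse t) a = a"
      using kappa_Theta scale_in_A[OF a(1), of "inverse t"] a(1) t(1) by simp
    then show "h \<in> (\<lambda>t. lam n (inverse t)) ` {t. weighted_scale ws t a = a}"
      using t(2) by (intro image_eqI[of _ _ "inverse t"]) auto
  qed
  moreover have "finite {t. weighted_scale ws t a = a}"
    by (rule weighted_stabilizer_finite) (use a positive_weights in auto)
  ultimately show ?thesis by (meson finite_imageI finite_subset)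
qed

lemma Pet_ss_eq_Pet_s: "Pet_ss n \<chi> = Pet_s n \<chi>"
  using orbit_closed stabilizer_finite unfolding points_X Pet_s_def by auto

lemma s_class_eq: "x \<in> points X \<Longrightarrow> s_class (G0 n) flag_act X x = orbit x"
proof (rule s_class_closed_orbits[OF orbit_closed])
  fix x y assume xy: "x \<in> points X" "y \<in> points X" "orbit x \<inter> orbit y \<noteq> {}"
  obtain a where a: "a \<in> points A" "x = \<Theta> a" using X_cases[OF xy(1)] .
  obtain b where b: "b \<in> points A" "y = \<Theta> b" using X_cases[OF xy(2)] .
  obtain z where z: "\<kappa> z \<in> weighted_orbit ws a" "\<kappa> z \<in> weighted_orbit ws b"
    using xy(3) unfolding a(2) b(2) orbit_eq_preimage[OF a(1)] orbit_eq_preimage[OF b(1)] by blast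
  then have "weighted_orbit ws (\<kappa> z) = weighted_orbit ws a" "weighted_orbit ws (\<kappa> z) = weighted_orbit ws b"
    by (auto dest: weighted_orbit_eq)
  then have "b \<in> weighted_orbit ws a" using weighted_orbit_self[of b ws] b(1) by simp
  then show "y \<in> orbit x" unfolding a(2) b(2) orbit_Theta[OF a(1)] by blast
next
  fix x assume "x \<in> points X"
  then obtain a where a: "a \<in> points A" "x = \<Theta> a" using X_cases by metis
  then show "x \<in> orbit x" unfolding a(2) orbit_Theta[OF a(1)] using weighted_orbit_self[of a ws] by simp
qed

section \<open>Comparison with the weighted projective space\<close>

abbreviation "\<pi> \<equiv> s_class (G0 n) flag_act X"
abbreviation "Y \<equiv> git_quotient (G0 n) flag_act X"
abbreviation "P \<equiv> weighted_projective_space ws"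

lemma pi_Theta: "a \<in> points A \<Longrightarrow> \<pi> (\<Theta> a) = \<Theta> ` weighted_orbit ws a"
  using s_class_eq[OF Theta_in_X] orbit_Theta by simp

lemma weighted_projective_space_ws: "P = quotient_space A (weighted_orbit ws)"
  unfolding weighted_projective_space_eq by simp

text \<open>Points of either quotient are themselves sets of points, so the comparison maps are
  images of sets under \<open>\<kappa>\<close> and \<open>\<Theta>\<close>.\<close>

definition to_P :: "complex mat set set \<Rightarrow> complex vec set"
  where "to_P y = \<kappa> ` y"

definition from_P :: "complex vec set \<Rightarrow> complex mat set set"
  where "from_P z = \<Theta> ` z"

lemma to_P_pi:
  assumes "x \<in> points X"
  shows "to_P (\<pi> x) = weighted_orbit ws (\<kappa> x)"
proof -
  obtain a where a: "a \<in> points A" "x = \<Theta> a" using X_cases[OF assms] .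
  have "\<kappa> (\<Theta> b) = b" if "b \<in> weighted_orbit ws a" for b
    using weighted_orbit_subset[OF a(1)] that by (intro kappa_Theta) blast
  then show ?thesis unfolding to_P_def a(2) pi_Theta[OF a(1)] kappa_Theta[OF a(1)] image_image by simp
qed

lemma from_P_orbit: "a \<in> points A \<Longrightarrow> from_P (weighted_orbit ws a) = \<pi> (\<Theta> a)"
  unfolding from_P_def by (rule pi_Theta[symmetric])

lemma morphism_to_P: "morphism Y P to_P"
  unfolding git_quotient_def weighted_projective_space_ws
  by (rule morphism_quotient_quotient[where f = \<kappa> and q = \<pi> and q' = "weighted_orbit ws" and \<phi> = to_P,
        OF function_space_X morphism_kappa to_P_pi])

lemma morphism_from_P: "morphism P Y from_P"
  unfolding git_quotient_def weighted_projective_space_ws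
  by (rule morphism_quotient_quotient[where f = \<Theta> and q = "weighted_orbit ws" and q' = \<pi> and \<phi> = from_P,
        OF function_space_punctured_space morphism_Theta from_P_orbit])

lemma points_Y: "points Y = \<pi> ` points X"
  by (simp add: git_quotient_def)

lemma points_P: "points P = weighted_orbit ws ` points A"
  unfolding weighted_projective_space_ws points_quotient_space ..

lemma from_to_P: "y \<in> points Y \<Longrightarrow> from_P (to_P y) = y"
  unfolding points_Y using to_P_pi from_P_orbit kappa_in_A Theta_kappa by auto

lemma to_from_P: "z \<in> points P \<Longrightarrow> to_P (from_P z) = z"
  unfolding points_P using to_P_pi from_P_orbit Theta_in_X kappa_Theta by auto

lemma isomorphic_Y_P: "isomorphic Y P"
  by (rule isomorphicI[OF morphism_to_P morphism_from_P from_to_P to_from_P])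

lemma function_space_Y: "function_space Y"
  unfolding git_quotient_def by (intro function_space_quotient_space function_space_X)

lemma good_quotient_Y: "good_quotient (G0 n) flag_act X Y \<pi>"
proof -
  define C where "C i = weighted_chart.projective_chart ws i" for i
  \<comment> \<open>The cover is transported from the standard charts of the weighted projective
    space: affineness downstairs comes from the isomorphism of quotients, upstairs from the chart of
    the punctured space.\<close>
  define V where "V i = {y \<in> points Y. to_P y \<in> C i}" for i
  have chart: "weighted_chart ws i" if "i < n - 1" for i
    using that by unfold_locales simp_all
  have oC: "openin (zar P) (C i)" if "i < n - 1" for i
    unfolding C_def by (rule weighted_chart.openin_projective_chart[OF chart[OF that]])
  have VX: "{x \<in> points X. \<pi> x \<in> V i} = {x \<in> points X. \<kappa> x \<in> affine_part (n - 1) i}" if i: "i < n - 1" for i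
  proof -
    have "\<pi> x \<in> V i \<longleftrightarrow> \<kappa> x \<in> affine_part (n - 1) i" if x: "x \<in> points X" for x
    proof -
      have "\<kappa> x \<in> carrier_vec (length ws)" using kappa_in_A[OF x] by simp
      then have "weighted_orbit ws (\<kappa> x) \<in> C i \<longleftrightarrow> \<kappa> x $ i \<noteq> 0"
        unfolding C_def by (rule weighted_chart.weighted_orbit_in_projective_chart[OF chart[OF i]])
      then show ?thesis
        using x kappa_in_A[OF x] by (auto simp: V_def points_Y to_P_pi affine_part_def)
    qed
    then show ?thesis by blast
  qed
  have cover: "\<Union> (V ` {..<n - 1}) = \<pi> ` points X"
  proof (intro equalityI subsetI)
    fix y assume "y \<in> \<pi> ` points X"
    then obtain x where x: "x \<in> points X" "y = \<pi> x" by blast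
    obtain i where i: "i < n - 1" "\<kappa> x $ i \<noteq> 0" using kappa_in_A[OF x(1)] by (auto simp: vec_eq_iff)
    then have "x \<in> {x \<in> points X. \<pi> x \<in> V i}"
      unfolding VX[OF i(1)] using x(1) kappa_in_A[OF x(1)] by (simp add: affine_part_def)
    then show "y \<in> \<Union> (V ` {..<n - 1})" using x(2) i(1) by blast
  qed (auto simp: V_def points_Y)
  have "good_quotient (G0 n) flag_act X (quotient_space X \<pi>) \<pi>"
  proof (rule good_quotient_orbit_space[OF function_space_X _ _ cover])
    fix x y assume xy: "x \<in> points X" "y \<in> points X" "\<pi> x = \<pi> y"
    have "y \<in> orbit y"
    proof -
      obtain a where a: "a \<in> points A" "y = \<Theta> a" using X_cases[OF xy(2)] .
      then show ?thesis unfolding a(2) orbit_Theta[OF a(1)] using weighted_orbit_self[of a ws] by simp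
    qed
    then have "y \<in> orbit x" using xy s_class_eq by simp
    then show "\<exists>g\<in>G0 n. y = flag_act g x" by (auto simp: group_orbit_def)
  next
    fix h x assume h: "h \<in> G0 n" and x: "x \<in> points X"
    then obtain t where t: "t \<noteq> 0" "h = lam n t" by (auto simp: G0_def)
    obtain a where a: "a \<in> points A" "x = \<Theta> a" using X_cases[OF x] .
    show "\<pi> (flag_act h x) = \<pi> x"
      using act_Theta[OF a(1) t(1)] scale_in_A[OF a(1), of "inverse t"] pi_Theta a t
      by (simp add: weighted_orbit_scale)
  next
    fix W assume "W \<in> V ` {..<n - 1}"
    then obtain i where i: "i < n - 1" "W = V i" by blast
    show "openin (zar (quotient_space X \<pi>)) W"
      unfolding i(2) V_def git_quotient_def[symmetric] by (rule morphism_openin[OF morphism_to_P oC[OF i(1)]])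
    have "isomorphic (induced_on Y (V i)) (induced_on P (C i))"
      by (rule isomorphic_induced_on[OF function_space_Y function_space_weighted_projective_space
            morphism_to_P morphism_from_P from_to_P to_from_P openin_subset[OF oC[OF i(1)]] V_def])
    moreover have "affine_variety (induced_on P (C i))"
      unfolding C_def by (rule weighted_chart.affine_variety_projective_chart[OF chart[OF i(1)]])
    ultimately show "affine_variety (induced_on (quotient_space X \<pi>) W)"
      unfolding i(2) git_quotient_def by (rule affine_variety_isomorphic)
    have "isomorphic (induced_on X {x \<in> points X. \<kappa> x \<in> affine_part (n - 1) i}) (induced_on A (affine_part (n - 1) i))"
      by (rule isomorphic_induced_on[OF function_space_X function_space_punctured_space
            morphism_kappa morphism_Theta Theta_kappa kappa_Theta _ refl])
        (use affine_part_subset[OF i(1)] in auto)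
    then show "affine_variety (induced_on X {x \<in> points X. \<pi> x \<in> W})"
      unfolding i(2) VX[OF i(1)] using affine_variety_affine_part[OF i(1)] by (rule affine_variety_isomorphic)
  qed
  then show ?thesis by (simp add: git_quotient_def)
qed

end

theorem theoremA:
  fixes n :: nat and \<chi> :: "nat \<Rightarrow> int"
  assumes "n \<ge> 2"
    and "\<chi> \<in> root_lattice n"
    and "(\<lambda>i. real_of_int (\<chi> i)) \<in> regular_dominant n"
    and "(\<lambda>i. real_of_int (\<chi> i)) \<in> deep_chamber n"
  shows "Pet_ss n \<chi> = Pet_s n \<chi> \<and>
    good_quotient (G0 n) flag_act (Pet_ss_space n \<chi>)
      (git_quotient (G0 n) flag_act (Pet_ss_space n \<chi>))
      (s_class (G0 n) flag_act (Pet_ss_space n \<chi>)) \<and>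
    isomorphic (git_quotient (G0 n) flag_act (Pet_ss_space n \<chi>))
      (weighted_projective_space [1..<n])"
proof -
  interpret deep_linearization n \<chi> by unfold_locales (use assms in auto)
  show ?thesis using Pet_ss_eq_Pet_s good_quotient_Y isomorphic_Y_P by blast
qed

end
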